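(* Let $k$ be a field of characteristic zero, let $q \in k^{\times}$ be not a root of unity, and let $D = k_q(x,y)$ be the $q$-division ring. (i) Let $\varphi$ be the $k$-algebra automorphism of $D$ defined by $$\varphi: x \mapsto (y^{-1}-q^{-1}y)x^{-1}, \quad y \mapsto -y^{-1},$$ and let $G$ be the group generated by $\varphi$. Then $D^G \cong D$ as $k$-algebras. (ii) Suppose $k$ contains a primitive third root of unity $\omega$, and both a second and a third root of $q$. If $G$ is a finite group of monomial automorphisms of $D$, then $D^G \cong D$ as $k$-algebras.
   Context: The quantum plane is $k_q[x,y] = k\langle x,y\rangle/(xy-qyx)$, a Noetherian domain; $D = k_q(x,y)$ denotes its division ring of fractions (so $xy=qyx$ in $D$). For a group $G$ of $k$-algebra automorphisms of $D$, $D^G = \{r \in D : g(r)=r\ \forall g \in G\}$. Monomial automorphisms (used in (ii)): fix a square root $\hat q \in k$ of $q$. The group $SL_2(\mathbb{Z})$ acts on $D$ by $k$-algebra automorphisms via $$g.y = \hat q^{\,ac}\, y^a x^c, \qquad g.x = \hat q^{\,bd}\, y^b x^d, \qquad g = \begin{pmatrix} a & b \\ c & d\end{pmatrix} \in SL_2(\mathbb{Z}).$$ An automorphism of $D$ is called monomial if it is the action of an element of $SL_2(\mathbb{Z})$ in this way. *)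

theory Defs
  imports Complex_Main "HOL-Library.Poly_Mapping" "HOL-Algebra.Generated_Groups"
begin

section \<open>Algebras over a field\<close>

locale k_algebra = vector_space scale
  for scale :: "'k::field \<Rightarrow> 'a::ring_1 \<Rightarrow> 'a" +
  assumes scale_mult_left: "scale c (a * b) = scale c a * b"
    and scale_mult_right: "scale c (a * b) = a * scale c b"

definition alg_hom ::
  "('k::field \<Rightarrow> 'a::ring_1 \<Rightarrow> 'a) \<Rightarrow> ('k \<Rightarrow> 'b::ring_1 \<Rightarrow> 'b) \<Rightarrow> ('a \<Rightarrow> 'b) \<Rightarrow> bool"
where
  "alg_hom s1 s2 f \<longleftrightarrow>
     Vector_Spaces.linear s1 s2 f \<and> (\<forall>a b. f (a * b) = f a * f b) \<and> f 1 = 1"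

definition alg_auts :: "('k::field \<Rightarrow> 'a::ring_1 \<Rightarrow> 'a) \<Rightarrow> ('a \<Rightarrow> 'a) set" where
  "alg_auts scale = {f. alg_hom scale scale f \<and> bij f}"

definition aut_group :: "('k::field \<Rightarrow> 'a::ring_1 \<Rightarrow> 'a) \<Rightarrow> ('a \<Rightarrow> 'a) monoid" where
  "aut_group scale = \<lparr>carrier = alg_auts scale, mult = (\<circ>), one = id\<rparr>"

definition fixed_ring :: "('a \<Rightarrow> 'a) set \<Rightarrow> 'a set" where
  "fixed_ring G = {r. \<forall>g\<in>G. g r = r}"

text \<open>A subset of an algebra is isomorphic to the whole algebra if it is the image of an
  injective algebra endomorphism; in particular it is then a subalgebra.\<close>

definition iso_to_whole :: "('k::field \<Rightarrow> 'a::ring_1 \<Rightarrow> 'a) \<Rightarrow> 'a set \<Rightarrow> bool" where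
  "iso_to_whole scale A \<longleftrightarrow> (\<exists>f. alg_hom scale scale f \<and> bij_betw f UNIV A)"


section \<open>The free algebra on two generators\<close>

datatype generator = GX | GY

datatype word = Word (letters: "generator list")

instantiation word :: monoid_add
begin

definition zero_word :: word where "0 = Word []"

definition plus_word :: "word \<Rightarrow> word \<Rightarrow> word" where
  "u + v = Word (letters u @ letters v)"

instance
  by standard (auto simp: zero_word_def plus_word_def)

end

text \<open>Words form a monoid under concatenation (written additively), so the convolution product
  on finitely supported functions makes this the monoid algebra of the free monoid.\<close>

type_synonym 'k free_algebra = "word \<Rightarrow>\<^sub>0 'k"

definition free_X :: "'k::field free_algebra" where
  "free_X = Poly_Mapping.single (Word [GX]) 1"

definition free_Y :: "'k::field free_algebra" where
  "free_Y = Poly_Mapping.single (Word [GY]) 1"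

definition free_scale :: "'k::field \<Rightarrow> 'k free_algebra \<Rightarrow> 'k free_algebra" where
  "free_scale c p = Poly_Mapping.map ((*) c) p"


section \<open>The quantum plane and its division ring of fractions\<close>

inductive_set ideal_gen :: "'a::ring_1 set \<Rightarrow> 'a set" for S :: "'a set" where
  zero: "0 \<in> ideal_gen S"
| base: "s \<in> S \<Longrightarrow> a * s * b \<in> ideal_gen S"
| add: "u \<in> ideal_gen S \<Longrightarrow> v \<in> ideal_gen S \<Longrightarrow> u + v \<in> ideal_gen S"

definition quantum_plane_ideal :: "'k::field \<Rightarrow> 'k free_algebra set" where
  "quantum_plane_ideal q = ideal_gen {free_X * free_Y - free_scale q (free_Y * free_X)}"

text \<open>The division algebra \<open>'d\<close> is the division ring of fractions of the quantum plane, with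
  \<open>x\<close> and \<open>y\<close> the images of the generators. Since the kernel of \<open>\<pi>\<close> is exactly the defining ideal,
  \<open>\<pi>\<close> is an embedding of the quotient \<open>k\<langle>X,Y\<rangle>/(XY - qYX)\<close> into \<open>'d\<close>; passing through the kernel avoids
  a quotient type, which could not depend on \<open>q\<close>. The last clause says that every element is a
  fraction of elements of the quantum plane.\<close>

definition is_q_division_ring ::
  "('k::field \<Rightarrow> 'd::division_ring \<Rightarrow> 'd) \<Rightarrow> 'k \<Rightarrow> 'd \<Rightarrow> 'd \<Rightarrow> bool"
where
  "is_q_division_ring scale q x y \<longleftrightarrow>
     k_algebra scale \<and>
     (\<exists>\<pi>. alg_hom free_scale scale \<pi> \<and> \<pi> free_X = x \<and> \<pi> free_Y = y \<and>
          {p. \<pi> p = 0} = quantum_plane_ideal q \<and>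
          (\<forall>d. \<exists>a b. \<pi> b \<noteq> 0 \<and> d = \<pi> a * inverse (\<pi> b)))"

text \<open>The automorphism is the action of the matrix with rows \<open>(a, b)\<close> and \<open>(c, d)\<close> in \<open>SL\<^sub>2(\<int>)\<close>;
  \<open>h\<close> is the chosen square root of \<open>q\<close>.\<close>

definition is_monomial_aut ::
  "('k::field \<Rightarrow> 'd::division_ring \<Rightarrow> 'd) \<Rightarrow> 'k \<Rightarrow> 'd \<Rightarrow> 'd \<Rightarrow> ('d \<Rightarrow> 'd) \<Rightarrow> bool"
where
  "is_monomial_aut scale h x y f \<longleftrightarrow>
     f \<in> alg_auts scale \<and>
     (\<exists>a b c d :: int. a * d - b * c = 1 \<and>
        f y = scale (h powi (a * c)) (y powi a * x powi c) \<and>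
        f x = scale (h powi (b * d)) (y powi b * x powi d))"


section \<open>Basic facts about these notions\<close>

lemma ideal_gen_mult_left: "u \<in> ideal_gen S \<Longrightarrow> a * u \<in> ideal_gen S"
proof (induction rule: ideal_gen.induct)
  case (base s b c)
  then show ?case using ideal_gen.base[of s S "a * b" c] by (simp add: mult.assoc)
qed (auto simp: distrib_left intro: ideal_gen.intros)

lemma ideal_gen_mult_right: "u \<in> ideal_gen S \<Longrightarrow> u * a \<in> ideal_gen S"
proof (induction rule: ideal_gen.induct)
  case (base s b c)
  then show ?case using ideal_gen.base[of s S b "c * a"] by (simp add: mult.assoc)
qed (auto simp: distrib_right intro: ideal_gen.intros)

lemma free_scale_eq: "free_scale c p = Poly_Mapping.single 0 c * p"
  unfolding free_scale_def by (rule Poly_Mapping.mult_map_scale_conv_mult)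

lemma lookup_free_scale: "Poly_Mapping.lookup (free_scale c p) w = c * Poly_Mapping.lookup p w"
  by (simp add: free_scale_def Poly_Mapping.map.rep_eq when_def)

lemma lookup_mult_single_zero:
  "Poly_Mapping.lookup (p * Poly_Mapping.single (0 :: word) c) w = Poly_Mapping.lookup p w * c"
proof -
  have "(\<Sum>v. Poly_Mapping.lookup (Poly_Mapping.single 0 c) v when w = u + v) = (c when w = u)"
    for u
    by (simp add: lookup_single when_when)
       (subst Sum_any.cong[where h = "\<lambda>v. (c when w = u) when v = 0"], auto simp: when_def)
  then show ?thesis
    by (simp add: lookup_mult mult_when)
qed

lemma k_algebra_free_scale: "k_algebra (free_scale :: 'k::field \<Rightarrow> _)"
proof
  fix c :: 'k and a b :: "'k free_algebra"
  show "free_scale c (a * b) = free_scale c a * b"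
    by (simp add: free_scale_eq mult.assoc)
  have comm: "Poly_Mapping.single 0 c * a = a * Poly_Mapping.single 0 c"
    by (rule poly_mapping_eqI)
      (simp flip: free_scale_eq add: lookup_free_scale lookup_mult_single_zero mult.commute)
  show "free_scale c (a * b) = a * free_scale c b"
    by (simp add: free_scale_eq mult.assoc[symmetric] comm)
qed (auto intro!: poly_mapping_eqI simp: lookup_free_scale Poly_Mapping.lookup_add algebra_simps)

lemma group_aut_group:
  assumes "k_algebra (scale :: 'k::field \<Rightarrow> 'a::ring_1 \<Rightarrow> 'a)"
  shows "group (aut_group scale)"
proof -
  interpret k_algebra scale by fact
  have lin: "Vector_Spaces.linear scale scale f \<longleftrightarrow>
      (\<forall>a b. f (a + b) = f a + f b) \<and> (\<forall>c a. f (scale c a) = scale c (f a))" for f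
    by (auto simp: Vector_Spaces.linear_def module_hom_def module_hom_axioms_def
        vector_space_axioms module_axioms)
  note defs = alg_auts_def alg_hom_def lin
  show ?thesis
  proof (rule groupI)
    fix f assume "f \<in> carrier (aut_group scale)"
    then have f: "alg_hom scale scale f" and bij: "bij f"
      by (auto simp: aut_group_def alg_auts_def)
    define g where "g = the_inv f"
    have fg: "f (g u) = u" and gf: "g (f u) = u" for u
      using bij by (auto simp: g_def f_the_inv_into_f_bij_betw bij_betw_def the_inv_f_f)
    have g_eq: "g u = v" if "f v = u" for u v using gf that by blast
    have "alg_hom scale scale g"
      using f by (auto simp: alg_hom_def lin fg intro!: g_eq)
    moreover have "bij g" by (metis bij_betw_byWitness fg gf subset_UNIV)
    moreover have "g \<circ> f = id" by (simp add: fun_eq_iff gf)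
    ultimately show "\<exists>g\<in>carrier (aut_group scale).
        g \<otimes>\<^bsub>aut_group scale\<^esub> f = \<one>\<^bsub>aut_group scale\<^esub>"
      by (auto simp: aut_group_def alg_auts_def)
  qed (auto simp: aut_group_def defs o_assoc bij_comp)
qed

lemma q_division_ring_commutation:
  assumes "is_q_division_ring scale q x y"
  shows "x * y = scale q (y * x)"
proof -
  obtain \<pi> where hom: "alg_hom free_scale scale \<pi>" and X: "\<pi> free_X = x" and Y: "\<pi> free_Y = y"
    and ker: "{p. \<pi> p = 0} = quantum_plane_ideal q"
    using assms unfolding is_q_division_ring_def by blast
  interpret Vector_Spaces.linear free_scale scale \<pi>
    using hom unfolding alg_hom_def by blast
  have mult: "\<pi> (a * b) = \<pi> a * \<pi> b" for a b
    using hom unfolding alg_hom_def by blast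
  let ?r = "free_X * free_Y - free_scale q (free_Y * free_X)"
  have "1 * ?r * 1 \<in> quantum_plane_ideal q"
    unfolding quantum_plane_ideal_def by (rule ideal_gen.base) simp
  then have "\<pi> ?r = 0" using ker by auto
  then show ?thesis by (simp add: diff scale mult X Y)
qed

end

theory Submission
  imports Defs
begin

text \<open>
  Write \<open>D\<close> for the \<open>q\<close>-division ring. Any two nonzero elements with \<open>u v = q v u\<close> define an
  endomorphism of \<open>D\<close> by \<open>x \<mapsto> u\<close>, \<open>y \<mapsto> v\<close>: the monomials \<open>v\<^sup>i u\<^sup>j\<close> are simultaneous eigenvectors of
  conjugation by \<open>u\<close> and by \<open>v\<close> with pairwise different eigenvalues, since \<open>q\<close> is not a root of unity,
  so they are linearly independent and the map on the quantum plane extends to fractions. The image is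
  the division subalgebra generated by \<open>u\<close> and \<open>v\<close> (\<open>universal_property\<close>). Hence a fixed ring is
  isomorphic to \<open>D\<close> as soon as it is generated, as a division algebra, by a \<open>q\<close>-commuting pair.

  That a pair of invariants generates all invariants is a matter of degree. Let \<open>K\<close> be the division
  subalgebra that it generates and let \<open>e\<^sub>1 = 1, e\<^sub>2, \<dots>\<close> be eigenvectors of the acting automorphism, those
  after the first with eigenvalue different from \<open>1\<close>. If \<open>\<Sum> e\<^sub>i K\<close> is stable under left
  multiplication by the generators of \<open>D\<close>, then it is stable under all of \<open>D\<close>, inverses
  included, because it has finite dimension over \<open>K\<close> (\<open>division_closure_subset_right_span\<close>). So it is
  \<open>D\<close>, and projecting to the eigenvalue \<open>1\<close> shows that an invariant lies in \<open>K\<close>.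

  Two computations feed this criterion.

  \<^item> Involutions \<open>y \<mapsto> \<epsilon> y\<^sup>-\<^sup>1\<close>, \<open>x \<mapsto> f x\<^sup>-\<^sup>1\<close> with \<open>\<epsilon> = \<plusminus>1\<close> and \<open>f = \<alpha> (y + \<epsilon> q y\<^sup>-\<^sup>1) + \<beta>\<close>
    (\<open>fixed_subalgebra_of_involution\<close>). Dividing two anti-invariants by \<open>y - \<epsilon> y\<^sup>-\<^sup>1\<close> gives invariants
    \<open>b\<close>, \<open>p\<close> with \<open>p b - q b p\<close> a scalar, a relation of quantum Weyl type, and adding a scalar to
    \<open>b p\<close> turns it into a \<open>q\<close>-commutation.
  \<^item> The automorphism of order three that permutes \<open>x\<close>, \<open>y\<close> and a multiple of \<open>y\<^sup>-\<^sup>1 x\<^sup>-\<^sup>1\<close> cyclically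
    (\<open>fixed_subalgebra_of_order_3\<close>). Quotients of Lagrange resolvents are invariant and satisfy a
    quadratic relation which can be written as \<open>(u - \<omega> v) (u - \<omega>\<^sup>2 v) = q (u - \<omega>\<^sup>2 v) (u - \<omega> v)\<close>.

  The first part of the theorem is the involution with \<open>\<epsilon> = -1\<close>, \<open>\<alpha> = - q\<^sup>-\<^sup>1\<close>, \<open>\<beta> = 0\<close>. For the second
  part, the element \<open>-1\<close> of \<open>SL\<^sub>2(\<int>)\<close> is the involution with \<open>\<epsilon> = 1\<close>, \<open>\<alpha> = 0\<close>, \<open>\<beta> = 1\<close>. Elements of order
  four and six are reached in two steps: the fixed ring of the square, respectively of the element of
  order three, is again generated by a \<open>q\<close>-commuting pair, and the remaining involution acts on a
  suitable such pair in the shape above. Finally, a finite subgroup of \<open>SL\<^sub>2(\<int>)\<close> has elements of trace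
  \<open>0\<close> or \<open>\<plusminus>1\<close> besides \<open>\<plusminus>1\<close>, a binary quadratic form of discriminant \<open>-4\<close> or \<open>-3\<close> provides a basis in
  which such an element is a standard matrix, and a trace estimate shows that the rest of the group
  consists of powers of it up to sign (\<open>fixed_subalgebra_of_finite_monomial_group\<close>).
\<close>

section \<open>Division algebras and their division subalgebras\<close>

locale division_algebra = k_algebra scale
  for scale :: "'k::field \<Rightarrow> 'd::division_ring \<Rightarrow> 'd"  (infixr "*s" 75)
begin

lemma scale_out [simp]: "(c *s a) * b = c *s (a * b)" "a * (c *s b) = c *s (a * b)"
  by (simp_all flip: scale_mult_left scale_mult_right)

lemma inverse_scale: "inverse (c *s a) = inverse c *s inverse a"
proof (cases "c = 0 \<or> a = 0")
  case False
  then have "(c *s a) * (inverse c *s inverse a) = 1" by simp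
  then show ?thesis by (rule inverse_unique)
qed auto

text \<open>Multiples by small numerals are unfolded into sums so that like terms of noncommutative
  expressions cancel by rearrangement alone.\<close>

lemma scale_numeral:
  "2 *s t = t + t" "(2 * c) *s t = c *s t + c *s t" "(c * 2) *s t = c *s t + c *s t"
  "(c * (d * 2)) *s t = (c * d) *s t + (c * d) *s t"
  "(c * (d * (e * 2))) *s t = (c * (d * e)) *s t + (c * (d * e)) *s t"
  "3 *s t = t + t + t" "(c * 3) *s t = c *s t + c *s t + c *s t"
  "(c * (d * 3)) *s t = (c * d) *s t + (c * d) *s t + (c * d) *s t"
  "4 *s t = t + t + (t + t)" "(c * 4) *s t = c *s t + c *s t + (c *s t + c *s t)"
  "9 *s t = t + t + t + (t + t + t) + (t + t + t)"
proof -
  show 2: "2 *s t = t + t" for t using scale_left_distrib[of 1 1 t] by simp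
  show 3: "3 *s t = t + t + t" for t using scale_left_distrib[of 2 1 t] by (simp add: 2)
  show "9 *s t = t + t + t + (t + t + t) + (t + t + t)"
    using scale_scale[of 3 3 t] by (simp add: 3 scale_right_distrib)
  show 4: "4 *s t = t + t + (t + t)" for t using scale_left_distrib[of 2 2 t] by (simp add: 2)
  show "(c * 4) *s t = c *s t + c *s t + (c *s t + c *s t)"
    using 4[of "c *s t"] by (simp only: scale_scale mult.commute[of _ 4])
  show "(2 * c) *s t = c *s t + c *s t" "(c * 2) *s t = c *s t + c *s t"
    "(c * (d * 2)) *s t = (c * d) *s t + (c * d) *s t"
    "(c * (d * (e * 2))) *s t = (c * (d * e)) *s t + (c * (d * e)) *s t"
    using 2[of "c *s t"] 2[of "(c * d) *s t"] 2[of "(c * (d * e)) *s t"]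
      by (simp_all only: scale_scale mult.commute[of _ 2] mult.assoc mult.left_commute[of _ 2])
  show "(c * 3) *s t = c *s t + c *s t + c *s t"
    "(c * (d * 3)) *s t = (c * d) *s t + (c * d) *s t + (c * d) *s t"
    using 3[of "c *s t"] 3[of "(c * d) *s t"]
      by (simp_all only: scale_scale mult.commute[of _ 3] mult.assoc mult.left_commute[of _ 3])
qed

definition division_subalgebra :: "'d set \<Rightarrow> bool" where
  "division_subalgebra S \<longleftrightarrow> 1 \<in> S \<and> (\<forall>a\<in>S. \<forall>b\<in>S. a + b \<in> S \<and> a * b \<in> S) \<and>
     (\<forall>c. \<forall>a\<in>S. c *s a \<in> S) \<and> (\<forall>a\<in>S. inverse a \<in> S)"

inductive_set division_closure :: "'d set \<Rightarrow> 'd set" for X where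
  one: "1 \<in> division_closure X"
| base: "a \<in> X \<Longrightarrow> a \<in> division_closure X"
| add: "a \<in> division_closure X \<Longrightarrow> b \<in> division_closure X \<Longrightarrow> a + b \<in> division_closure X"
| mult: "a \<in> division_closure X \<Longrightarrow> b \<in> division_closure X \<Longrightarrow> a * b \<in> division_closure X"
| scale: "a \<in> division_closure X \<Longrightarrow> c *s a \<in> division_closure X"
| inverse: "a \<in> division_closure X \<Longrightarrow> inverse a \<in> division_closure X"

lemma division_subalgebra_closure: "division_subalgebra (division_closure X)"
  by (auto simp: division_subalgebra_def intro: division_closure.intros)

lemma division_closure_least:
  assumes "division_subalgebra S" "X \<subseteq> S"
  shows "division_closure X \<subseteq> S"
proof
  fix a assume "a \<in> division_closure X"
  then show "a \<in> S"
    by induction (use assms in \<open>auto simp: division_subalgebra_def\<close>)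
qed

lemma division_subalgebraD:
  assumes "division_subalgebra S"
  shows "1 \<in> S" "0 \<in> S" "a \<in> S \<Longrightarrow> b \<in> S \<Longrightarrow> a + b \<in> S" "a \<in> S \<Longrightarrow> b \<in> S \<Longrightarrow> a * b \<in> S"
    "a \<in> S \<Longrightarrow> c *s a \<in> S" "a \<in> S \<Longrightarrow> inverse a \<in> S" "a \<in> S \<Longrightarrow> - a \<in> S"
    "a \<in> S \<Longrightarrow> b \<in> S \<Longrightarrow> a - b \<in> S"
proof -
  show neg: "- a \<in> S" if "a \<in> S" for a
    using assms that scale_minus_left[of 1 a] by (metis division_subalgebra_def scale_one)
  show "0 \<in> S" using assms by (metis division_subalgebra_def scale_zero_left)
  show "a \<in> S \<Longrightarrow> b \<in> S \<Longrightarrow> a - b \<in> S"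
    using assms neg[of b] by (metis division_subalgebra_def diff_conv_add_uminus)
qed (use assms in \<open>auto simp: division_subalgebra_def\<close>)

lemma alg_hom_iff:
  "alg_hom (*s) (*s) f \<longleftrightarrow>
     (\<forall>a b. f (a + b) = f a + f b) \<and> (\<forall>c a. f (c *s a) = c *s f a) \<and>
     (\<forall>a b. f (a * b) = f a * f b) \<and> f 1 = 1"
  by (auto simp: alg_hom_def Vector_Spaces.linear_def module_hom_def module_hom_axioms_def
      vector_space_axioms module_axioms)

context
  fixes f assumes f: "alg_hom (*s) (*s) f"
begin

lemma alg_homD: "f (a + b) = f a + f b" "f (c *s a) = c *s f a" "f (a * b) = f a * f b" "f 1 = 1"
    "f 0 = 0" "f (- a) = - f a" "f (a - b) = f a - f b" "f (inverse a) = inverse (f a)"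
    "f a = 0 \<longleftrightarrow> a = 0"
proof -
  note h = f[unfolded alg_hom_iff]
  show 0: "f 0 = 0" using h by (metis scale_zero_left)
  show neg: "f (- a) = - f a" for a using h 0 by (metis add_eq_0_iff right_minus)
  show "f (a - b) = f a - f b" using h neg by (metis diff_conv_add_uminus)
  show i: "f (inverse a) = inverse (f a)" for a
  proof (cases "a = 0")
    case False
    then have "f a * f (inverse a) = 1" using h by (metis right_inverse)
    then show ?thesis by (metis inverse_unique)
  qed (simp add: 0)
  show "f a = 0 \<longleftrightarrow> a = 0"
    using i[of a] h 0 by (metis mult_zero_left right_inverse zero_neq_one)
qed (use f in \<open>auto simp: alg_hom_iff\<close>)

lemma alg_hom_inj: "inj f"
  by (rule injI) (metis alg_homD(7) alg_homD(9) eq_iff_diff_eq_0)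

lemma alg_hom_power_int: "f (a powi n) = f a powi n"
proof -
  have "f (a ^ n) = f a ^ n" for a n by (induction n) (simp_all add: alg_homD)
  then show ?thesis by (simp add: power_int_def alg_homD)
qed

lemma alg_hom_division_closure: "a \<in> division_closure X \<Longrightarrow> (\<And>a. a \<in> X \<Longrightarrow> f a \<in> S) \<Longrightarrow> division_subalgebra S \<Longrightarrow> f a \<in> S"
  by (induction rule: division_closure.induct) (auto simp: alg_homD division_subalgebraD)

lemma division_subalgebra_range: "division_subalgebra (range f)"
  unfolding division_subalgebra_def by (auto simp: alg_homD image_iff) (metis alg_homD)+

end

lemma alg_hom_eq_on_division_closure:
  assumes "alg_hom (*s) (*s) f" "alg_hom (*s) (*s) g" "\<And>a. a \<in> X \<Longrightarrow> f a = g a" "a \<in> division_closure X"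
  shows "f a = g a"
  using assms(4)
  by induction (use assms(3) in \<open>auto simp: alg_homD[OF assms(1)] alg_homD[OF assms(2)]\<close>)

lemma division_subalgebra_fixed:
  assumes "alg_hom (*s) (*s) f" shows "division_subalgebra {a. f a = a}"
  by (auto simp: division_subalgebra_def alg_homD[OF assms])

text \<open>The classical argument: applying \<open>t \<cdot> _ - l\<^sub>i (_ \<cdot> t)\<close> to a relation removes the \<open>i\<close>-th term
  and rescales the others by nonzero factors.\<close>

lemma eigenvectors_independent:
  assumes "finite J" "t \<noteq> 0" "inj_on l J"
    and "\<And>j. j \<in> J \<Longrightarrow> t * d j = l j *s (d j * t)" "(\<Sum>j\<in>J. d j) = 0" "j \<in> J"
  shows "d j = 0"
  using assms(1,3-)
proof (induction J arbitrary: d j rule: finite_induct)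
  case (insert i J)
  have "(\<Sum>j\<in>J. (l j - l i) *s d j) * t = (\<Sum>j\<in>insert i J. (l j - l i) *s d j) * t"
    using insert.hyps by simp
  also have "\<dots> = (\<Sum>j\<in>insert i J. l j *s (d j * t)) - l i *s ((\<Sum>j\<in>insert i J. d j) * t)"
    by (simp add: sum_distrib_right left_diff_distrib scale_left_diff_distrib sum_subtractf
        scale_sum_right del: sum.insert)
  also have "(\<Sum>j\<in>insert i J. l j *s (d j * t)) = t * (\<Sum>j\<in>insert i J. d j)"
    unfolding sum_distrib_left by (rule sum.cong) (use insert.prems in auto)
  finally have "(\<Sum>j\<in>J. (l j - l i) *s d j) = 0"
    using insert.prems(3) \<open>t \<noteq> 0\<close> by simp
  then have *: "(l j - l i) *s d j = 0" if "j \<in> J" for j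
  proof (rule insert.IH[rotated 2])
    show "inj_on l J" using insert.prems(1) by auto
    show "t * (l j - l i) *s d j = l j *s ((l j - l i) *s d j * t)" if "j \<in> J" for j
      using insert.prems(2)[of j] that by (simp add: mult.commute[of "l j - l i"])
    show "j \<in> J" by fact
  qed
  have d0: "d j = 0" if "j \<in> J" for j
    using *[OF that] that insert.prems(1) insert.hyps by (auto simp: inj_on_def)
  then have "d i = 0" using insert.prems(3) insert.hyps by simp
  with d0 show ?case using insert.prems(4) by auto
qed simp

end

section \<open>The universal property of the q-division ring\<close>

definition linear_extension :: "('k::field \<Rightarrow> 'a::ab_group_add \<Rightarrow> 'a) \<Rightarrow> ('i \<Rightarrow> 'a) \<Rightarrow> ('i \<Rightarrow>\<^sub>0 'k) \<Rightarrow> 'a" where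
  "linear_extension s g p = (\<Sum>w. s (Poly_Mapping.lookup p w) (g w))"

lemma poly_mapping_induct_single [case_names zero single add]:
  fixes p :: "'i \<Rightarrow>\<^sub>0 'k::comm_monoid_add"
  assumes "P 0" "\<And>w c. P (Poly_Mapping.single w c)" "\<And>p r. P p \<Longrightarrow> P r \<Longrightarrow> P (p + r)"
  shows "P p"
proof -
  have "P (\<Sum>w\<in>W. Poly_Mapping.single w (Poly_Mapping.lookup p w))" if "finite W" for W
    using that by induction (auto intro: assms)
  moreover have "(\<Sum>w\<in>Poly_Mapping.keys p. Poly_Mapping.single w (Poly_Mapping.lookup p w)) = p"
    by (rule poly_mapping_eqI) (auto simp: lookup_sum lookup_single when_def in_keys_iff)
  ultimately show ?thesis by (metis finite_keys)
qed

context vector_space begin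

lemma finite_support_linear_extension: "finite {w. scale (Poly_Mapping.lookup p w) (g w) \<noteq> 0}"
  by (rule finite_subset[OF _ finite_keys[of p]]) (auto simp: in_keys_iff)

lemma linear_extension_single [simp]: "linear_extension scale g (Poly_Mapping.single w c) = scale c (g w)"
proof -
  have "linear_extension scale g (Poly_Mapping.single w c) = (\<Sum>v. scale c (g w) when v = w)"
    unfolding linear_extension_def by (rule Sum_any.cong) (auto simp: lookup_single when_def)
  then show ?thesis by simp
qed

lemma linear_extension_zero [simp]: "linear_extension scale g 0 = 0"
  by (simp add: linear_extension_def)

lemma linear_extension_add [simp]:
  "linear_extension scale g (p + r) = linear_extension scale g p + linear_extension scale g r"
  unfolding linear_extension_def lookup_add scale_left_distrib
  by (rule Sum_any.distrib) (rule finite_support_linear_extension)+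

lemma linear_extension_eq_sum:
  "linear_extension scale g p = (\<Sum>w\<in>Poly_Mapping.keys p. scale (Poly_Mapping.lookup p w) (g w))"
  unfolding linear_extension_def
  by (rule Sum_any.expand_superset) (auto simp: in_keys_iff)

end

definition free_eval :: "('k::field \<Rightarrow> 'a::ring_1 \<Rightarrow> 'a) \<Rightarrow> (generator \<Rightarrow> 'a) \<Rightarrow> 'k free_algebra \<Rightarrow> 'a" where
  "free_eval s g = linear_extension s (\<lambda>w. prod_list (map g (letters w)))"

lemma alg_hom_free_eval:
  assumes "k_algebra s"
  shows "alg_hom free_scale s (free_eval s g)"
    and "free_eval s g free_X = g GX" "free_eval s g free_Y = g GY"
proof -
  interpret k_algebra s by fact
  interpret free: k_algebra "free_scale :: 'a \<Rightarrow> _" by (rule k_algebra_free_scale)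
  have add: "free_eval s g (p + r) = free_eval s g p + free_eval s g r" for p r
    by (simp add: free_eval_def)
  have zero: "free_eval s g 0 = 0" by (simp add: free_eval_def)
  have sc: "free_eval s g (free_scale c p) = s c (free_eval s g p)" for c p
  proof (induction p rule: poly_mapping_induct_single)
    case (single w b)
    then show ?case by (simp add: free_eval_def free_scale_eq mult_single)
  qed (simp_all add: zero add free.scale_right_distrib scale_right_distrib)
  have mult: "free_eval s g (p * r) = free_eval s g p * free_eval s g r" for p r
  proof (induction p rule: poly_mapping_induct_single)
    case (single w b)
    show ?case
    proof (induction r rule: poly_mapping_induct_single)
      case (single v c)
      show ?case
        by (simp add: free_eval_def mult_single plus_word_def flip: scale_mult_left scale_mult_right)
    qed (simp_all add: zero add distrib_left)
  qed (simp_all add: zero add distrib_right)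
  have one: "free_eval s g 1 = 1"
    unfolding single_one[symmetric] by (simp add: free_eval_def zero_word_def)
  show "alg_hom free_scale s (free_eval s g)"
    unfolding alg_hom_def Vector_Spaces.linear_def module_hom_def module_hom_axioms_def
    by (auto simp: add sc mult one vector_space_axioms free.vector_space_axioms
        module_axioms free.module_axioms)
  show "free_eval s g free_X = g GX" "free_eval s g free_Y = g GY"
    by (simp_all add: free_eval_def free_X_def free_Y_def)
qed

context division_algebra begin

text \<open>Two homomorphisms with the same kernel, one of which has all of \<open>D\<close> as the fractions of its image.
  The Ore condition needed to add and multiply fractions comes for free: writing
  \<open>(\<pi> b)\<^sup>-\<^sup>1 \<pi> a\<close> itself as a fraction \<open>\<pi> s (\<pi> t)\<^sup>-\<^sup>1\<close> gives \<open>\<pi> (b s) = \<pi> (a t)\<close>.\<close>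

lemma extend_hom_to_fractions:
  fixes \<pi> \<rho> :: "'a::ring_1 \<Rightarrow> 'd"
  assumes \<pi>: "\<And>a b. \<pi> (a + b) = \<pi> a + \<pi> b" "\<And>a b. \<pi> (a * b) = \<pi> a * \<pi> b" "\<pi> 1 = 1"
    and \<rho>: "\<And>a b. \<rho> (a + b) = \<rho> a + \<rho> b" "\<And>a b. \<rho> (a * b) = \<rho> a * \<rho> b" "\<rho> 1 = 1"
    and ker: "\<And>a b. \<pi> a = \<pi> b \<longleftrightarrow> \<rho> a = \<rho> b"
    and frac: "\<And>d. \<exists>a b. \<pi> b \<noteq> 0 \<and> d = \<pi> a * inverse (\<pi> b)"
  obtains f where "\<And>d e. f (d + e) = f d + f e" "\<And>d e. f (d * e) = f d * f e" "\<And>a. f (\<pi> a) = \<rho> a"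
proof -
  have zero: "\<pi> 0 = 0" "\<rho> 0 = 0" using \<pi>(1)[of 0 0] \<rho>(1)[of 0 0] by auto
  have ker0: "\<pi> a \<noteq> 0 \<longleftrightarrow> \<rho> a \<noteq> 0" for a using ker[of a 0] zero by simp
  have ore: "\<exists>s t. \<pi> t \<noteq> 0 \<and> \<pi> (b * s) = \<pi> (a * t)" if "\<pi> b \<noteq> 0" for a b
  proof -
    obtain s t where "\<pi> t \<noteq> 0" "inverse (\<pi> b) * \<pi> a = \<pi> s * inverse (\<pi> t)"
      using frac by blast
    then have "\<pi> a * \<pi> t = \<pi> b * \<pi> s"
      using that by (metis mult.assoc left_inverse right_inverse mult_1_left mult_1_right)
    then show ?thesis using \<open>\<pi> t \<noteq> 0\<close> \<pi>(2) by metis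
  qed
  define num where "num d = (SOME a. \<exists>b. \<pi> b \<noteq> 0 \<and> d = \<pi> a * inverse (\<pi> b))" for d
  define den where "den d = (SOME b. \<pi> b \<noteq> 0 \<and> d = \<pi> (num d) * inverse (\<pi> b))" for d
  have "\<exists>b. \<pi> b \<noteq> 0 \<and> d = \<pi> (num d) * inverse (\<pi> b)" for d
    unfolding num_def by (rule someI_ex) (rule frac)
  then have nd: "\<pi> (den d) \<noteq> 0 \<and> d = \<pi> (num d) * inverse (\<pi> (den d))" for d
    unfolding den_def by (rule someI_ex)
  define f where "f d = \<rho> (num d) * inverse (\<rho> (den d))" for d
  have f: "f d = \<rho> a * inverse (\<rho> b)" if b: "\<pi> b \<noteq> 0" and d: "d * \<pi> b = \<pi> a" for a b d
  proof -
    obtain s t where t: "\<pi> t \<noteq> 0" and st: "\<pi> (b * s) = \<pi> (den d * t)"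
      using ore[OF b, of "den d"] by blast
    have nd': "d * \<pi> (den d) = \<pi> (num d)" using nd[of d]
      by (metis mult.assoc left_inverse mult_1_right)
    have "\<pi> (a * s) = \<pi> (num d * t)"
      using d nd' st \<pi>(2) by (metis mult.assoc)
    then have 1: "\<rho> a * \<rho> s = \<rho> (num d) * \<rho> t" and 2: "\<rho> b * \<rho> s = \<rho> (den d) * \<rho> t"
      using st ker \<rho>(2) by metis+
    have nz: "\<rho> t \<noteq> 0" "\<rho> b \<noteq> 0" "\<rho> (den d) \<noteq> 0" using t b nd ker0 by auto
    then have nzs: "\<rho> s \<noteq> 0" using 2 by auto
    have "\<rho> a * inverse (\<rho> b) = (\<rho> a * \<rho> s) * inverse (\<rho> b * \<rho> s)"
      using nz nzs by (simp add: nonzero_inverse_mult_distrib mult.assoc)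
         (metis mult.assoc mult_1_left right_inverse)
    also have "\<dots> = (\<rho> (num d) * \<rho> t) * inverse (\<rho> (den d) * \<rho> t)" by (simp only: 1 2)
    also have "\<dots> = \<rho> (num d) * inverse (\<rho> (den d))"
      using nz by (simp add: nonzero_inverse_mult_distrib mult.assoc)
         (metis mult.assoc mult_1_left right_inverse)
    finally show ?thesis by (simp add: f_def)
  qed
  have f': "f d * \<rho> b = \<rho> a" if "\<pi> b \<noteq> 0" "d * \<pi> b = \<pi> a" for a b d
    using f[OF that] that(1) ker0 by (simp add: mult.assoc)
  have ex: "\<exists>a b. \<pi> b \<noteq> 0 \<and> d * \<pi> b = \<pi> a" for d
    using nd[of d] by (metis mult.assoc left_inverse mult_1_right)
  show ?thesis
  proof
    show "f (\<pi> a) = \<rho> a" for a using f[of 1 "\<pi> a" a] \<pi>(3) \<rho>(3) by simp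
    fix d e
    obtain a b where ab: "\<pi> b \<noteq> 0" "d * \<pi> b = \<pi> a" using ex by blast
    obtain a' b' where ab': "\<pi> b' \<noteq> 0" "e * \<pi> b' = \<pi> a'" using ex by blast
    obtain s t where t: "\<pi> t \<noteq> 0" and st: "\<pi> (b * s) = \<pi> (b' * t)" using ore[OF ab(1)] by blast
    have nz: "\<pi> (b' * t) \<noteq> 0" "\<rho> (b' * t) \<noteq> 0" using t ab' ker0 by (simp_all add: \<pi> \<rho>)
    have "(d + e) * \<pi> (b' * t) = \<pi> (a * s + a' * t)"
      using st ab ab' by (simp add: \<pi> distrib_right) (metis mult.assoc)
    then have "f (d + e) * \<rho> (b' * t) = \<rho> (a * s + a' * t)" using f' nz by blast
    also have "\<dots> = (f d + f e) * \<rho> (b' * t)"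
    proof -
      have "\<rho> (b * s) = \<rho> (b' * t)" using st ker by blast
      then show ?thesis
        using f'[OF ab] f'[OF ab'] by (simp add: \<rho> distrib_right) (metis mult.assoc)
    qed
    finally show "f (d + e) = f d + f e" using nz by simp
    obtain s t where t: "\<pi> t \<noteq> 0" and st: "\<pi> (b * s) = \<pi> (a' * t)" using ore[OF ab(1)] by blast
    have nz: "\<pi> (b' * t) \<noteq> 0" "\<rho> (b' * t) \<noteq> 0" using t ab' ker0 by (simp_all add: \<pi> \<rho>)
    have "(d * e) * \<pi> (b' * t) = \<pi> (a * s)"
      using st ab ab' by (simp add: \<pi>) (metis mult.assoc)
    then have "f (d * e) * \<rho> (b' * t) = \<rho> (a * s)" using f' nz by blast
    also have "\<dots> = (f d * f e) * \<rho> (b' * t)"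
    proof -
      have "\<rho> (b * s) = \<rho> (a' * t)" using st ker by blast
      then show ?thesis
        using f'[OF ab] f'[OF ab'] by (simp add: \<rho>) (metis mult.assoc)
    qed
    finally show "f (d * e) = f d * f e" using nz by simp
  qed
qed


definition q_commuting :: "'k \<Rightarrow> 'd \<Rightarrow> 'd \<Rightarrow> bool" where
  "q_commuting q x y \<longleftrightarrow> x \<noteq> 0 \<and> y \<noteq> 0 \<and> x * y = q *s (y * x)"

lemma q_commuting_power:
  assumes "x * y = q *s (y * x)"
  shows "x * y ^ i = q ^ i *s (y ^ i * x)"
proof (induction i)
  case (Suc i)
  have "x * y ^ Suc i = (x * y) * y ^ i" by (simp add: mult.assoc)
  also have "\<dots> = q ^ Suc i *s (y ^ Suc i * x)" by (simp add: assms mult.assoc Suc)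
  finally show ?case .
qed simp

lemma q_commuting_power2:
  assumes "x * y = q *s (y * x)"
  shows "x ^ i * y = q ^ i *s (y * x ^ i)"
proof (induction i)
  case (Suc i)
  have "x ^ Suc i * y = x * (x ^ i * y)" by (simp add: mult.assoc)
  also have "\<dots> = q ^ i *s ((x * y) * x ^ i)" by (simp only: Suc scale_out mult.assoc)
  also have "\<dots> = q ^ Suc i *s (y * x ^ Suc i)" by (simp add: assms mult.assoc mult.commute)
  finally show ?case .
qed simp

text \<open>Conjugation by \<open>x\<close> separates the exponents of \<open>y\<close>, then conjugation by \<open>y\<close> those of \<open>x\<close>.\<close>

lemma monomials_independent:
  assumes q: "q \<noteq> 0" "\<forall>n::nat. n > 0 \<longrightarrow> q ^ n \<noteq> 1" and qc: "q_commuting q x y"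
    and 0: "linear_extension (*s) (\<lambda>(i, j). y ^ i * x ^ j) c = 0"
  shows "c = 0"
proof (rule poly_mapping_eqI)
  fix k :: "nat \<times> nat" obtain i j where k: "k = (i, j)" by force
  have xy: "x \<noteq> 0" "y \<noteq> 0" and com: "x * y = q *s (y * x)" using qc by (auto simp: q_commuting_def)
  have inj: "inj (\<lambda>i::nat. q ^ i)"
  proof (rule linorder_injI)
    fix m n :: nat assume "m < n"
    then have "q ^ n = q ^ m * q ^ (n - m)" by (simp flip: power_add)
    then show "q ^ m \<noteq> q ^ n" using q(2)[rule_format, of "n - m"] \<open>m < n\<close> q(1) by auto
  qed
  define K where "K = Poly_Mapping.keys c"
  define d where "d i = (\<Sum>j | (i, j) \<in> K. Poly_Mapping.lookup c (i, j) *s (y ^ i * x ^ j))" for i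
  have K: "finite K" "K \<subseteq> fst ` K \<times> snd ` K" "finite {j. (i, j) \<in> K}" for i
    by (force simp: K_def intro: finite_subset[OF _ finite_imageI[of _ snd]])+
  have "(\<Sum>i\<in>fst ` K. d i) = (\<Sum>(i, j)\<in>Sigma (fst ` K) (\<lambda>i. {j. (i, j) \<in> K}).
      Poly_Mapping.lookup c (i, j) *s (y ^ i * x ^ j))"
    unfolding d_def by (rule sum.Sigma) (use K in auto)
  also have "Sigma (fst ` K) (\<lambda>i. {j. (i, j) \<in> K}) = K" by force
  also have "(\<Sum>(i, j)\<in>K. Poly_Mapping.lookup c (i, j) *s (y ^ i * x ^ j)) = 0"
    using 0 unfolding linear_extension_eq_sum K_def by (simp add: case_prod_unfold)
  finally have sum: "(\<Sum>i\<in>fst ` K. d i) = 0" .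
  have "x * d i = q ^ i *s (d i * x)" for i
    unfolding d_def sum_distrib_left sum_distrib_right scale_sum_right
  proof (rule sum.cong)
    fix j show "x * Poly_Mapping.lookup c (i, j) *s (y ^ i * x ^ j) =
      q ^ i *s ((Poly_Mapping.lookup c (i, j) *s (y ^ i * x ^ j)) * x)"
      using q_commuting_power[OF com, of i]
      by (simp add: mult.assoc[symmetric] mult.commute) (simp add: mult.assoc power_commutes)
  qed simp
  then have d0: "d i = 0"
  proof (cases "i \<in> fst ` K")
    case True
    then show ?thesis
      using eigenvectors_independent[OF _ xy(1), of "fst ` K" "\<lambda>i. q ^ i" d i] sum K
        inj_on_subset[OF inj] \<open>\<And>i. x * d i = q ^ i *s (d i * x)\<close> by auto
  next
    case False
    then have "{j. (i, j) \<in> K} = {}" by force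
    then show ?thesis unfolding d_def by (simp only: sum.empty)
  qed
  show "Poly_Mapping.lookup c k = Poly_Mapping.lookup 0 k"
  proof (cases "k \<in> K")
    case True
    have "Poly_Mapping.lookup c (i, j) *s (y ^ i * x ^ j) = 0"
    proof (rule eigenvectors_independent[OF _ xy(2), of "{j. (i, j) \<in> K}" "\<lambda>j. inverse q ^ j"])
      show "inj_on ((^) (inverse q)) {j. (i, j) \<in> K}"
        using inj by (auto simp: inj_def inj_on_def power_inverse)
      show "y * (Poly_Mapping.lookup c (i, j) *s (y ^ i * x ^ j)) =
          inverse q ^ j *s ((Poly_Mapping.lookup c (i, j) *s (y ^ i * x ^ j)) * y)" for j
        using q_commuting_power2[OF com, of j] q(1)
        by (simp add: mult.assoc) (simp add: mult.assoc[symmetric] power_commutes mult.commute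
           flip: power_mult_distrib)
    qed (use d0 K True k in \<open>auto simp: d_def\<close>)
    then show ?thesis using xy k by simp
  next
    case False
    then show ?thesis by (simp add: K_def in_keys_iff)
  qed
qed

text \<open>The image of the quantum plane lies in every subspace that contains \<open>1\<close> and is stable under
  left multiplication by \<open>x\<close> and \<open>y\<close>, so all fractions can be written over such a subspace.\<close>

lemma fractions_of_stable_subspace:
  assumes D: "is_q_division_ring (*s) q x y"
    and T: "1 \<in> T" "\<And>a b. a \<in> T \<Longrightarrow> b \<in> T \<Longrightarrow> a + b \<in> T" "\<And>c a. a \<in> T \<Longrightarrow> c *s a \<in> T"
      "\<And>a. a \<in> T \<Longrightarrow> x * a \<in> T" "\<And>a. a \<in> T \<Longrightarrow> y * a \<in> T"
  shows "\<exists>a\<in>T. \<exists>b\<in>T. b \<noteq> 0 \<and> d * b = a"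
proof -
  obtain \<pi> where hom: "alg_hom free_scale (*s) \<pi>" and X: "\<pi> free_X = x" and Y: "\<pi> free_Y = y"
    and frac: "\<And>d. \<exists>a b. \<pi> b \<noteq> 0 \<and> d = \<pi> a * inverse (\<pi> b)"
    using D unfolding is_q_division_ring_def by blast
  interpret \<pi>: Vector_Spaces.linear free_scale "(*s)" \<pi>
    using hom unfolding alg_hom_def by blast
  have \<pi>_mult: "\<pi> (a * b) = \<pi> a * \<pi> b" and \<pi>_one: "\<pi> 1 = 1" for a b
    using hom unfolding alg_hom_def by auto
  have word: "\<pi> (Poly_Mapping.single (Word []) 1) = 1"
    "\<pi> (Poly_Mapping.single (Word (GX # l)) 1) = x * \<pi> (Poly_Mapping.single (Word l) 1)"
    "\<pi> (Poly_Mapping.single (Word (GY # l)) 1) = y * \<pi> (Poly_Mapping.single (Word l) 1)" for l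
    using \<pi>_one by (simp_all add: zero_word_def[symmetric] X[symmetric] Y[symmetric] free_X_def free_Y_def
        mult_single plus_word_def flip: \<pi>_mult)
  have \<pi>_single: "\<pi> (Poly_Mapping.single w c) = c *s \<pi> (Poly_Mapping.single w 1)" for w c
    by (simp add: free_scale_eq mult_single flip: \<pi>.scale)
  have "\<pi> p \<in> T" for p
  proof (induction p rule: poly_mapping_induct_single)
    case zero show ?case using T(3)[OF T(1), of 0] by (simp add: \<pi>.zero)
  next
    case (single w c)
    obtain l where w: "w = Word l" by (cases w)
    have "\<pi> (Poly_Mapping.single (Word l) 1) \<in> T"
    proof (induction l)
      case (Cons g l) then show ?case by (cases g) (auto simp: word intro: T)
    qed (auto simp: word intro: T)
    then show ?case unfolding w by (subst \<pi>_single) (rule T(3))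
  qed (auto simp: \<pi>.add intro: T)
  moreover obtain a b where "\<pi> b \<noteq> 0" "d = \<pi> a * inverse (\<pi> b)" using frac by blast
  ultimately show ?thesis by (intro bexI[of _ "\<pi> a"] bexI[of _ "\<pi> b"]) (simp_all add: mult.assoc)
qed

text \<open>Let \<open>\<rho>\<close> be the evaluation of the free algebra at \<open>u, v\<close>. Reordering letters gives the same normal
  form \<open>\<Sum> c\<^sub>i\<^sub>j y\<^sup>i x\<^sup>j\<close> and \<open>\<Sum> c\<^sub>i\<^sub>j v\<^sup>i u\<^sup>j\<close> on both sides, and both vanish only for \<open>c = 0\<close>. So \<open>\<rho>\<close> and
  the projection to the quantum plane have the same kernel. That \<open>x\<close> and \<open>y\<close> are nonzero is seen from
  the characters \<open>X \<mapsto> 1, Y \<mapsto> 0\<close> and \<open>X \<mapsto> 0, Y \<mapsto> 1\<close>, which kill the defining ideal.\<close>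

theorem universal_property:
  assumes D: "is_q_division_ring (*s) q x y" and q: "q \<noteq> 0" "\<forall>n::nat. n > 0 \<longrightarrow> q ^ n \<noteq> 1"
  shows "q_commuting q x y" "division_closure {x, y} = UNIV"
    and "q_commuting q u v \<Longrightarrow> \<exists>f. alg_hom (*s) (*s) f \<and> f x = u \<and> f y = v \<and> range f = division_closure {u, v}"
proof -
  obtain \<pi> where hom: "alg_hom free_scale (*s) \<pi>" and X: "\<pi> free_X = x" and Y: "\<pi> free_Y = y"
    and ker: "{p. \<pi> p = 0} = quantum_plane_ideal q"
    and frac: "\<And>d. \<exists>a b. \<pi> b \<noteq> 0 \<and> d = \<pi> a * inverse (\<pi> b)"
    using D unfolding is_q_division_ring_def by blast
  interpret \<pi>: Vector_Spaces.linear free_scale "(*s)" \<pi>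
    using hom unfolding alg_hom_def by blast
  have \<pi>_mult: "\<pi> (a * b) = \<pi> a * \<pi> b" and \<pi>_one: "\<pi> 1 = 1" for a b
    using hom unfolding alg_hom_def by auto
  have nz: "free_eval s g p = 0"
    if "k_algebra s" "p \<in> quantum_plane_ideal q" "g GX * g GY = s q (g GY * g GX)"
    for s :: "'k \<Rightarrow> 'k \<Rightarrow> 'k" and g p
  proof -
    note ev = alg_hom_free_eval[OF that(1), of g]
    interpret e: Vector_Spaces.linear free_scale s "free_eval s g"
      using ev(1) unfolding alg_hom_def by blast
    have ev_mult: "free_eval s g (a * b) = free_eval s g a * free_eval s g b" for a b
      using ev(1) unfolding alg_hom_def by blast
    show ?thesis
      using that(2) unfolding quantum_plane_ideal_def
      by induction (auto simp: ev_mult ev e.add e.diff e.scale that(3))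
  qed
  have k_alg: "k_algebra ((*) :: 'k \<Rightarrow> 'k \<Rightarrow> 'k)"
    by standard (auto simp: algebra_simps)
  have "x \<noteq> 0"
  proof
    assume "x = 0"
    then have "free_X \<in> quantum_plane_ideal q" using X ker by auto
    from nz[OF k_alg this, of "case_generator 1 0"] show False
      using alg_hom_free_eval[OF k_alg, of "case_generator 1 0"] by simp
  qed
  moreover have "y \<noteq> 0"
  proof
    assume "y = 0"
    then have "free_Y \<in> quantum_plane_ideal q" using Y ker by auto
    from nz[OF k_alg this, of "case_generator 0 1"] show False
      using alg_hom_free_eval[OF k_alg, of "case_generator 0 1"] by simp
  qed
  ultimately show qc: "q_commuting q x y"
    using q_division_ring_commutation[OF D] by (simp add: q_commuting_def)
  have word: "\<pi> (Poly_Mapping.single (Word []) 1) = 1"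
    "\<pi> (Poly_Mapping.single (Word (GX # l)) 1) = x * \<pi> (Poly_Mapping.single (Word l) 1)"
    "\<pi> (Poly_Mapping.single (Word (GY # l)) 1) = y * \<pi> (Poly_Mapping.single (Word l) 1)" for l
    using \<pi>_one by (simp_all add: zero_word_def[symmetric] X[symmetric] Y[symmetric] free_X_def free_Y_def
        mult_single plus_word_def flip: \<pi>_mult)
  have \<pi>_single: "\<pi> (Poly_Mapping.single w c) = c *s \<pi> (Poly_Mapping.single w 1)" for w c
    by (simp add: free_scale_eq mult_single flip: \<pi>.scale)
  show gen: "division_closure {x, y} = UNIV"
  proof -
    have "d \<in> division_closure {x, y}" for d
    proof -
      obtain a b where "a \<in> division_closure {x, y}" "b \<in> division_closure {x, y}" "b \<noteq> 0" "d * b = a"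
        using fractions_of_stable_subspace[OF D, of "division_closure {x, y}" d]
          by (auto intro: division_closure.intros)
      moreover from this have "d = a * inverse b" by (auto simp: mult.assoc)
      ultimately show ?thesis by (auto intro: division_closure.intros)
    qed
    then show ?thesis by auto
  qed
  assume uv: "q_commuting q u v"
  define \<rho> where "\<rho> = free_eval (*s) (case_generator u v)"
  note \<rho> = alg_hom_free_eval[OF k_algebra_axioms, of "case_generator u v", folded \<rho>_def, simplified]
  interpret \<rho>: Vector_Spaces.linear free_scale "(*s)" \<rho>
    using \<rho>(1) unfolding alg_hom_def by blast
  have \<rho>_mult: "\<rho> (a * b) = \<rho> a * \<rho> b" and \<rho>_one: "\<rho> 1 = 1" for a b
    using \<rho>(1) unfolding alg_hom_def by auto
  have word': "\<rho> (Poly_Mapping.single (Word []) 1) = 1"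
    "\<rho> (Poly_Mapping.single (Word (GX # l)) 1) = u * \<rho> (Poly_Mapping.single (Word l) 1)"
    "\<rho> (Poly_Mapping.single (Word (GY # l)) 1) = v * \<rho> (Poly_Mapping.single (Word l) 1)" for l
    using \<rho>_one by (simp_all add: zero_word_def[symmetric] \<rho>(2,3)[symmetric] free_X_def free_Y_def
        mult_single plus_word_def flip: \<rho>_mult)
  have \<rho>_single: "\<rho> (Poly_Mapping.single w c) = c *s \<rho> (Poly_Mapping.single w 1)" for w c
    by (simp add: free_scale_eq mult_single flip: \<rho>.scale)
  let ?L = "\<lambda>x y. linear_extension (*s) (\<lambda>(i::nat, j::nat). y ^ i * x ^ j)"
  have left_x: "x * (y ^ i * x ^ j) = q ^ i *s (y ^ i * x ^ Suc j)"
    if "q_commuting q x y" for x y and i j :: nat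
    using q_commuting_power[of x y q i] that
    by (simp add: q_commuting_def mult.assoc[symmetric])
  have nf: "\<exists>c. \<pi> p = ?L x y c \<and> \<rho> p = ?L u v c" for p
  proof (induction p rule: poly_mapping_induct_single)
    case zero show ?case by (rule exI[of _ 0]) (simp add: \<pi>.zero \<rho>.zero)
  next
    case (add p r)
    then obtain c d where "\<pi> p = ?L x y c \<and> \<rho> p = ?L u v c" "\<pi> r = ?L x y d \<and> \<rho> r = ?L u v d"
      by blast
    then show ?case by (intro exI[of _ "c + d"]) (simp add: \<pi>.add \<rho>.add)
  next
    case (single w b)
    obtain l where w: "w = Word l" by (cases w)
    have "\<exists>c i j. \<pi> (Poly_Mapping.single (Word l) 1) = c *s (y ^ i * x ^ j) \<and>
        \<rho> (Poly_Mapping.single (Word l) 1) = c *s (v ^ i * u ^ j)"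
    proof (induction l)
      case Nil show ?case by (rule exI[of _ 1], rule exI[of _ 0], rule exI[of _ 0])
        (simp add: word word')
    next
      case (Cons g l)
      then obtain c i j where *: "\<pi> (Poly_Mapping.single (Word l) 1) = c *s (y ^ i * x ^ j)"
        "\<rho> (Poly_Mapping.single (Word l) 1) = c *s (v ^ i * u ^ j)" by blast
      show ?case
      proof (cases g)
        case GX
        show ?thesis unfolding GX word word' *
          by (rule exI[of _ "c * q ^ i"], rule exI[of _ i], rule exI[of _ "Suc j"])
             (simp add: left_x[OF qc] left_x[OF uv] del: power_Suc)
      next
        case GY
        show ?thesis unfolding GY word word' *
          by (rule exI[of _ c], rule exI[of _ "Suc i"], rule exI[of _ j]) (simp add: mult.assoc)
      qed
    qed
    then obtain c i j where "\<pi> (Poly_Mapping.single (Word l) 1) = c *s (y ^ i * x ^ j)"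
        "\<rho> (Poly_Mapping.single (Word l) 1) = c *s (v ^ i * u ^ j)" by blast
    then show ?case unfolding w
      by (subst \<pi>_single, subst \<rho>_single)
        (auto intro!: exI[of _ "Poly_Mapping.single (i, j) (b * c)"])
  qed
  have ker_eq: "\<pi> p = 0 \<longleftrightarrow> \<rho> p = 0" for p
    using nf[of p] monomials_independent[OF q qc] monomials_independent[OF q uv]
    by (metis linear_extension_zero)
  obtain f where f: "\<And>d e. f (d + e) = f d + f e" "\<And>d e. f (d * e) = f d * f e"
      "\<And>a. f (\<pi> a) = \<rho> a"
  proof (rule extend_hom_to_fractions[of \<pi> \<rho>])
    show "\<pi> a = \<pi> b \<longleftrightarrow> \<rho> a = \<rho> b" for a b
      using ker_eq[of "a - b"] by (simp add: \<pi>.diff \<rho>.diff)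
  qed (use frac in \<open>auto simp: \<pi>.add \<rho>.add \<pi>_mult \<pi>_one \<rho>_mult \<rho>_one\<close>)
  have "f (c *s d) = c *s f d" for c d
  proof -
    have "f (c *s 1) = c *s 1"
      using f(3)[of "Poly_Mapping.single 0 c"] \<pi>_single[of 0 c] \<rho>_single[of 0 c] \<pi>_one \<rho>_one
      by simp
    then show ?thesis using f(2)[of "c *s 1" d] by simp
  qed
  moreover have "f 1 = 1" using f(3)[of 1] by (simp add: \<pi>_one \<rho>_one)
  ultimately have hom: "alg_hom (*s) (*s) f" using f by (simp add: alg_hom_iff)
  have fxy: "f x = u" "f y = v" using f(3)[of free_X] f(3)[of free_Y] X Y \<rho> by auto
  moreover have "range f = division_closure {u, v}"
  proof
    show "range f \<subseteq> division_closure {u, v}"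
    proof
      fix b assume "b \<in> range f"
      then obtain a where "b = f a" "a \<in> division_closure {x, y}" using gen by auto
      then show "b \<in> division_closure {u, v}"
        using alg_hom_division_closure[OF hom _ _ division_subalgebra_closure, of a "{x, y}" "{u, v}"] fxy
        by (auto intro: division_closure.base)
    qed
    show "division_closure {u, v} \<subseteq> range f"
      by (rule division_closure_least[OF division_subalgebra_range[OF hom]]) (use fxy in auto)
  qed
  ultimately show "\<exists>f. alg_hom (*s) (*s) f \<and> f x = u \<and> f y = v \<and> range f = division_closure {u, v}"
    using hom by blast
qed


section \<open>A criterion for generating a division algebra\<close>

definition right_span :: "'d set \<Rightarrow> nat \<Rightarrow> (nat \<Rightarrow> 'd) \<Rightarrow> 'd set" where
  "right_span K n e = {\<Sum>i<n. e i * a i | a. \<forall>i<n. a i \<in> K}"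

text \<open>Steinitz exchange over a noncommutative \<open>K\<close>: a vector with nonzero last coordinate is used to
  clear that coordinate from the others.\<close>

lemma right_dependence:
  assumes K: "division_subalgebra K"
  shows "finite J \<Longrightarrow> n < card J \<Longrightarrow> \<forall>j\<in>J. v j \<in> right_span K n e \<Longrightarrow>
    \<exists>c. (\<forall>j\<in>J. c j \<in> K) \<and> (\<exists>j\<in>J. c j \<noteq> 0) \<and> (\<Sum>j\<in>J. v j * c j) = 0"
proof (induction n arbitrary: J v)
  case 0
  then obtain j where "j \<in> J" by (metis card.empty equals0I less_irrefl)
  moreover have "v j = 0" if "j \<in> J" for j using 0 that by (auto simp: right_span_def)
  ultimately show ?case
    by (intro exI[of _ "\<lambda>_. 1"]) (auto simp: division_subalgebraD[OF K])
next
  case (Suc n)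
  have "\<forall>j\<in>J. \<exists>a. (\<forall>i<Suc n. a i \<in> K) \<and> v j = (\<Sum>i<Suc n. e i * a i)"
    using Suc.prems(3) by (auto simp: right_span_def)
  then obtain a where a: "\<And>j i. j \<in> J \<Longrightarrow> i \<le> n \<Longrightarrow> a j i \<in> K"
    "\<And>j. j \<in> J \<Longrightarrow> v j = (\<Sum>i<Suc n. e i * a j i)"
    unfolding bchoice_iff by (metis less_Suc_eq_le)
  show ?case
  proof (cases "\<forall>j\<in>J. a j n = 0")
    case True
    then have "\<forall>j\<in>J. v j \<in> right_span K n e"
      using a by (force simp: right_span_def)
    with Suc show ?thesis by auto
  next
    case False
    then obtain m where m: "m \<in> J" "a m n \<noteq> 0" by auto
    define b where "b j = inverse (a m n) * a j n" for j
    have b: "b j \<in> K" if "j \<in> J" for j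
      unfolding b_def using a(1) m that by (intro division_subalgebraD(4,6)[OF K]) auto
    have ab: "a m n * b j = a j n" for j
      unfolding b_def using m(2) by (metis mult.assoc mult_1_left right_inverse)
    define w where "w j = v j - v m * b j" for j
    have "w j \<in> right_span K n e" if j: "j \<in> J - {m}" for j
    proof -
      have "w j = (\<Sum>i<Suc n. e i * (a j i - a m i * b j))"
        unfolding w_def using j m a(2)
        by (simp add: sum_subtractf algebra_simps sum_distrib_right sum_distrib_left mult.assoc)
      also have "\<dots> = (\<Sum>i<n. e i * (a j i - a m i * b j))"
        using ab[of j] by simp
      finally show ?thesis
        unfolding right_span_def using a(1) b j m
        by (auto intro!: exI[of _ "\<lambda>i. a j i - a m i * b j"] division_subalgebraD(4,8)[OF K])
    qed
    moreover have "n < card (J - {m})" "finite (J - {m})" using Suc.prems m by auto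
    ultimately obtain c where c: "\<forall>j\<in>J - {m}. c j \<in> K" "\<exists>j\<in>J - {m}. c j \<noteq> 0"
        "(\<Sum>j\<in>J - {m}. w j * c j) = 0"
      using Suc.IH[of "J - {m}" w] by blast
    define c' where "c' j = (if j = m then - (\<Sum>j\<in>J - {m}. b j * c j) else c j)" for j
    have sumK: "(\<Sum>j\<in>I. g j) \<in> K" if "\<And>j. j \<in> I \<Longrightarrow> g j \<in> K" for I :: "'b set" and g
      using that by (induction I rule: infinite_finite_induct)
        (auto simp: division_subalgebraD[OF K])
    have "(\<Sum>j\<in>J. v j * c' j) = v m * c' m + (\<Sum>j\<in>J - {m}. v j * c' j)"
      by (rule sum.remove) (use Suc.prems m in auto)
    also have "(\<Sum>j\<in>J - {m}. v j * c' j) = (\<Sum>j\<in>J - {m}. w j * c j + v m * (b j * c j))"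
      by (rule sum.cong) (auto simp: c'_def w_def algebra_simps)
    also have "\<dots> = v m * (\<Sum>j\<in>J - {m}. b j * c j)"
      using c(3) by (simp add: sum.distrib sum_distrib_left)
    finally have "(\<Sum>j\<in>J. v j * c' j) = 0" by (simp add: c'_def)
    moreover have "\<forall>j\<in>J. c' j \<in> K"
      using c(1) b by (auto simp: c'_def intro!: division_subalgebraD(4,7)[OF K] sumK)
    moreover have "\<exists>j\<in>J. c' j \<noteq> 0" using c(2) by (auto simp: c'_def)
    ultimately show ?thesis by blast
  qed
qed

lemma right_span_closed:
  assumes K: "division_subalgebra K" and "a \<in> right_span K n e"
  shows "b \<in> right_span K n e \<Longrightarrow> a + b \<in> right_span K n e"
    and "k \<in> K \<Longrightarrow> a * k \<in> right_span K n e" and "c *s a \<in> right_span K n e"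
proof -
  obtain f where f: "\<forall>i<n. f i \<in> K" "a = (\<Sum>i<n. e i * f i)"
    using assms(2) by (auto simp: right_span_def)
  show "a + b \<in> right_span K n e" if b: "b \<in> right_span K n e"
  proof -
    obtain g where g: "\<forall>i<n. g i \<in> K" "b = (\<Sum>i<n. e i * g i)"
      using b by (auto simp: right_span_def)
    show ?thesis using f g unfolding right_span_def
      by (auto intro!: exI[of _ "\<lambda>i. f i + g i"] division_subalgebraD[OF K]
          simp: distrib_left sum.distrib)
  qed
  show "a * k \<in> right_span K n e" if "k \<in> K"
    using f that unfolding right_span_def
    by (auto intro!: exI[of _ "\<lambda>i. f i * k"] division_subalgebraD[OF K]
        simp: sum_distrib_right mult.assoc)
  show "c *s a \<in> right_span K n e"
    using f unfolding right_span_def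
    by (auto intro!: exI[of _ "\<lambda>i. c *s f i"] division_subalgebraD[OF K] simp: scale_sum_right)
qed

text \<open>Only inverses need an argument. If \<open>d\<close> maps \<open>T = \<Sum> e\<^sub>i K\<close> into itself and \<open>t \<in> T\<close>, then
  \<open>t, d t, \<dots>, d\<^sup>n t\<close> are dependent over \<open>K\<close>; cancelling the lowest power of \<open>d\<close> that occurs shows
  \<open>t \<in> d T\<close>, so \<open>d\<^sup>-\<^sup>1 t \<in> T\<close>.\<close>

lemma division_subalgebra_stabilizer:
  assumes K: "division_subalgebra K"
  shows "division_subalgebra {d. \<forall>t\<in>right_span K n e. d * t \<in> right_span K n e}" (is "division_subalgebra ?N")
proof -
  let ?T = "right_span K n e"
  note T = right_span_closed[OF K, of _ n e]
  have sumT: "(\<Sum>j\<in>I. g j) \<in> ?T"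
    if "finite I" "I \<noteq> {}" "\<And>j. j \<in> I \<Longrightarrow> g j \<in> ?T" for I :: "nat set" and g
    using that by (induction I rule: finite_ne_induct) (auto intro: T)
  have "inverse d \<in> ?N" if d: "d \<in> ?N" for d
  proof (cases "d = 0")
    case False
    have pow: "d ^ i * t \<in> ?T" if "t \<in> ?T" for i t
      using that d by (induction i) (auto simp: mult.assoc)
    have div: "\<exists>s\<in>?T. t = d * s" if t: "t \<in> ?T" for t
    proof -
      obtain c where c: "\<forall>j\<in>{..n}. c j \<in> K" "\<exists>j\<in>{..n}. c j \<noteq> 0" "(\<Sum>j\<in>{..n}. (d ^ j * t) * c j) = 0"
        using right_dependence[OF K, of "{..n}" n "\<lambda>j. d ^ j * t" e] pow[OF t] by auto
      define m where "m = (LEAST j. j \<le> n \<and> c j \<noteq> 0)"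
      have m: "m \<le> n \<and> c m \<noteq> 0" unfolding m_def by (rule LeastI_ex) (use c(2) in auto)
      have below: "c j = 0" if "j < m" for j
        using not_less_Least[of j "\<lambda>j. j \<le> n \<and> c j \<noteq> 0"] that m unfolding m_def by auto
      define s where "s = (\<Sum>j\<in>{m<..n}. (d ^ (j - m - 1) * t) * c j)"
      have "0 = (\<Sum>j\<in>{m..n}. (d ^ j * t) * c j)"
        unfolding c(3)[symmetric] by (rule sum.mono_neutral_right) (auto simp: below)
      also have "\<dots> = (d ^ m * t) * c m + (\<Sum>j\<in>{m<..n}. (d ^ j * t) * c j)"
        using m by (subst sum.head) auto
      also have "(\<Sum>j\<in>{m<..n}. (d ^ j * t) * c j) = d ^ m * d * s"
        unfolding s_def sum_distrib_left
      proof (rule sum.cong)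
        fix j assume "j \<in> {m<..n}"
        then have "d ^ j = d ^ m * d * d ^ (j - m - 1)"
          by (metis Suc_diff_Suc add_diff_inverse_nat diff_Suc_1 diff_diff_left greaterThanAtMost_iff
              less_imp_not_less mult.assoc plus_1_eq_Suc power_Suc power_add)
        then show "d ^ j * t * c j = d ^ m * d * (d ^ (j - m - 1) * t * c j)"
          by (simp add: mult.assoc)
      qed simp
      finally have "d ^ m * (t * c m + d * s) = 0" by (simp add: algebra_simps)
      then have "t * c m + d * s = 0" using False by simp
      then have "t * c m = d * (- s)" by (simp add: add_eq_0_iff2)
      then have "t = d * (- s * inverse (c m))"
        using m by (metis mult.assoc mult_1_right right_inverse)
      moreover have "- s * inverse (c m) \<in> ?T"
      proof (cases "m = n")
        case True
        then have "- s * inverse (c m) = 0 *s t" by (simp add: s_def)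
        then show ?thesis using T(3)[OF t] by metis
      next
        case False
        then have "s \<in> ?T"
            unfolding s_def using m c(1) by (intro sumT T(2)[OF pow[OF t]]) auto
        then have "- s \<in> ?T" using T(3)[of s "-1"] by simp
        then show ?thesis using m c(1) by (intro T(2) division_subalgebraD(6)[OF K]) auto
      qed
      ultimately show ?thesis by blast
    qed
    have "inverse d * t \<in> ?T" if "t \<in> ?T" for t
    proof -
      obtain s where "s \<in> ?T" "t = d * s" using div[OF \<open>t \<in> ?T\<close>] by blast
      then show ?thesis using False by (simp flip: mult.assoc)
    qed
    then show ?thesis by simp
  qed (use d in simp)
  then show ?thesis
    unfolding division_subalgebra_def by (auto simp: distrib_right mult.assoc intro: T)
qed

lemma division_closure_subset_right_span:
  assumes K: "division_subalgebra K" and one: "1 \<in> right_span K n e"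
    and X: "\<And>a i. a \<in> X \<Longrightarrow> i < n \<Longrightarrow> a * e i \<in> right_span K n e"
  shows "division_closure X \<subseteq> right_span K n e"
proof -
  let ?T = "right_span K n e"
  note T = right_span_closed[OF K, of _ n e]
  have zero: "0 \<in> ?T" using T(3)[OF one, of 0] by simp
  have "division_closure X \<subseteq> {d. \<forall>t\<in>?T. d * t \<in> ?T}"
  proof (rule division_closure_least[OF division_subalgebra_stabilizer[OF K]], clarify)
    fix a t assume a: "a \<in> X" and "t \<in> ?T"
    then obtain f where f: "\<forall>i<n. f i \<in> K" "t = (\<Sum>i<n. e i * f i)"
      by (auto simp: right_span_def)
    have "(\<Sum>i\<in>I. a * e i * f i) \<in> ?T" if "I \<subseteq> {..<n}" for I
      using finite_subset[OF that finite_lessThan] that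
    proof (induction I)
      case (insert i I)
      then have "a * e i * f i \<in> ?T" using f(1) X[OF a, of i] by (intro T(2)[of "a * e i"]) auto
      then show ?case using insert by (auto intro: T(1))
    qed (simp add: zero)
    from this[of "{..<n}"] show "a * t \<in> ?T"
      by (simp add: f(2) sum_distrib_left mult.assoc)
  qed
  then show ?thesis using one by force
qed

end

section \<open>Involutions inverting one generator\<close>

locale division_algebra_char_0 = division_algebra scale
  for scale :: "'k::field_char_0 \<Rightarrow> 'd::division_ring \<Rightarrow> 'd"  (infixr "*s" 75)
begin

lemma q_commuting_inverse:
  assumes "q_commuting q x y" "q \<noteq> 0"
  shows "x * inverse y = inverse q *s (inverse y * x)" "inverse x * y = inverse q *s (y * inverse x)"
    "inverse x * inverse y = q *s (inverse y * inverse x)"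
proof -
  have xy: "x \<noteq> 0" "y \<noteq> 0" "x * y = q *s (y * x)" using assms by (auto simp: q_commuting_def)
  show 1: "x * inverse y = inverse q *s (inverse y * x)"
  proof -
    have "x * inverse y = inverse q *s (inverse y * (q *s (y * x)) * inverse y)"
      using xy assms(2) by (simp flip: mult.assoc)
    also have "\<dots> = inverse q *s (inverse y * (x * y) * inverse y)" by (simp only: xy(3))
    also have "\<dots> = inverse q *s (inverse y * x)" using xy(2) by (simp add: mult.assoc)
    finally show ?thesis .
  qed
  show 2: "inverse x * y = inverse q *s (y * inverse x)"
  proof -
    have "inverse x * y = inverse x * (y * x) * inverse x" using xy(1) by (simp add: mult.assoc)
    also have "y * x = inverse q *s (x * y)" using xy(3) assms(2) by simp
    also have "inverse x * (inverse q *s (x * y)) * inverse x = inverse q *s (y * inverse x)"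
      using xy(1) by (simp flip: mult.assoc)
    finally show ?thesis .
  qed
  show "inverse x * inverse y = q *s (inverse y * inverse x)"
  proof -
    have "inverse x * inverse y = inverse (y * x)" using xy
      by (simp add: nonzero_inverse_mult_distrib)
    also have "y * x = inverse q *s (x * y)" using xy(3) assms(2) by simp
    finally show ?thesis using xy(1,2) by (simp add: inverse_scale nonzero_inverse_mult_distrib)
  qed
qed

text \<open>The form in which independence is used to see that explicit elements do not vanish: the three
  summands are components for conjugation by \<open>t\<close>.\<close>

lemma three_eigenvectors:
  assumes "t \<noteq> 0" "a + b + c = 0" "t * a = l *s (a * t)" "t * b = m *s (b * t)" "t * c = n *s (c * t)"
    "l \<noteq> m" "l \<noteq> n" "m \<noteq> n"
  shows "a = 0"
proof -
  have "(\<lambda>j::nat. if j = 0 then a else if j = 1 then b else c) 0 = 0"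
    by (rule eigenvectors_independent[where J = "{0,1,2}" and t = t
          and l = "\<lambda>j. if j = 0 then l else if j = 1 then m else n"])
      (use assms in \<open>auto simp: inj_on_def add.assoc\<close>)
  then show ?thesis by simp
qed

text \<open>Write \<open>x' = \<phi> x\<close>, \<open>E = y - \<epsilon> y\<^sup>-\<^sup>1\<close> and \<open>C = y + \<epsilon> y\<^sup>-\<^sup>1\<close>. Since \<open>\<phi> E = -E\<close>, the elements
  \<open>b, p, r\<close> are invariant, and \<open>r = C b - \<epsilon> p\<close>. Moving \<open>x\<close> and \<open>x'\<close> past \<open>E\<^sup>-\<^sup>1\<close> multiplies \<open>y\<close> by \<open>q\<close> or
  \<open>q\<^sup>-\<^sup>1\<close>, and the special form of \<open>\<phi> x\<close> makes all denominators cancel in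
  \<open>p b - q b p = \<epsilon> q (q - 1) \<alpha>\<close> and in the formula for \<open>r p\<close>. The first relation says \<open>w b = q b w\<close>.
  Substituting \<open>r = C b - \<epsilon> p\<close> in the second gives \<open>C w\<close> as a polynomial in \<open>b\<close> and \<open>p\<close>, so the
  generated division subalgebra \<open>K\<close> contains \<open>C\<close>, hence \<open>x + x' = C b - 2 \<epsilon> p\<close> and all other
  invariants that are needed to see that \<open>K + E K\<close> is stable under \<open>x\<close> and \<open>y\<close>.\<close>

theorem fixed_subalgebra_of_involution:
  fixes q \<alpha> \<beta> \<epsilon> :: 'k and x y :: 'd
  assumes q: "q \<noteq> 0" "\<forall>n::nat. n > 0 \<longrightarrow> q ^ n \<noteq> 1" and qc: "q_commuting q x y"
    and \<epsilon>: "\<epsilon> = 1 \<or> \<epsilon> = -1"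
    and \<phi>: "alg_hom (*s) (*s) \<phi>"
    and \<phi>y: "\<phi> y = \<epsilon> *s inverse y"
    and \<phi>x: "\<phi> x = (\<alpha> *s (y + (\<epsilon> * q) *s inverse y) + \<beta> *s 1) * inverse x"
  defines "e \<equiv> inverse (y - \<epsilon> *s inverse y)"
  defines "b \<equiv> e * (x - \<phi> x)" and "p \<equiv> e * (inverse y * x - \<epsilon> *s (y * \<phi> x))"
    and "r \<equiv> e * (y * x - \<epsilon> *s (inverse y * \<phi> x))"
  defines "w \<equiv> b * p + (\<epsilon> * q * \<alpha>) *s 1"
  shows "q_commuting q w b" "division_closure {w, b} = {r \<in> division_closure {x, y}. \<phi> r = r}"
    "r * p = inverse q *s (b * b) - (\<epsilon> * \<alpha> * q) *s (y + \<epsilon> *s inverse y) - (\<epsilon> * \<beta>) *s 1"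
proof -
  have x0: "x \<noteq> 0" and y0: "y \<noteq> 0" and xy: "x * y = q *s (y * x)"
    using qc by (auto simp: q_commuting_def)
  have ee: "\<epsilon> * \<epsilon> = 1" "\<epsilon> * (\<epsilon> * c) = c" for c using \<epsilon> by auto
  have e0: "\<epsilon> \<noteq> 0" "inverse \<epsilon> = \<epsilon>" using \<epsilon> by auto
  have qq: "q * q \<noteq> 1" "q \<noteq> 1" "q * q * (q * q) \<noteq> 1"
    using q(2)[rule_format, of 2] q(2)[rule_format, of 1] q(2)[rule_format, of 4]
    by (auto simp: power2_eq_square power4_eq_xxxx mult.assoc)
  have qi: "q * inverse q = 1" "inverse q * q = 1" "q * (inverse q * c) = c" "inverse q * (q * c) = c" for c
    using q(1) by auto
  define Y where "Y = inverse y"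
  define X where "X = inverse x"
  define f where "f = \<alpha> *s (y + (\<epsilon> * q) *s Y) + \<beta> *s 1"
  define x' where "x' = f * X"
  have yY: "y * Y = 1" "Y * y = 1" "y * (Y * c) = c" "Y * (y * c) = c"
    and xX: "x * X = 1" "X * x = 1" "x * (X * c) = c" "X * (x * c) = c" for c
    using x0 y0 by (simp_all add: X_def Y_def flip: mult.assoc)
  have com: "x * y = q *s (y * x)" "x * Y = inverse q *s (Y * x)" "X * y = inverse q *s (y * X)"
      "X * Y = q *s (Y * X)"
    using xy q_commuting_inverse[OF qc q(1)] by (simp_all add: X_def Y_def)
  have com': "x * (y * c) = q *s (y * (x * c))" "x * (Y * c) = inverse q *s (Y * (x * c))"
      "X * (y * c) = inverse q *s (y * (X * c))" "X * (Y * c) = q *s (Y * (X * c))" for c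
    using arg_cong[OF com(1), of "\<lambda>t. t * c"] arg_cong[OF com(2), of "\<lambda>t. t * c"]
      arg_cong[OF com(3), of "\<lambda>t. t * c"] arg_cong[OF com(4), of "\<lambda>t. t * c"]
    by (simp_all add: mult.assoc)
  have fy: "f * y = y * f" "f * Y = Y * f"
    by (simp_all add: f_def algebra_simps yY)
  have fyc: "f * (y * c) = y * (f * c)" "f * (Y * c) = Y * (f * c)" for c
    using fy by (simp_all flip: mult.assoc)
  have x'com: "x' * y = inverse q *s (y * x')" "x' * Y = q *s (Y * x')"
    unfolding x'_def by (simp_all add: mult.assoc com fyc)
  have x'com': "x' * (y * c) = inverse q *s (y * (x' * c))" "x' * (Y * c) = q *s (Y * (x' * c))" for c
    using arg_cong[OF x'com(1), of "\<lambda>t. t * c"] arg_cong[OF x'com(2), of "\<lambda>t. t * c"]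
    by (simp_all add: mult.assoc)
  have x'x: "x' * x = \<alpha> *s y + (\<alpha> * \<epsilon> * q) *s Y + \<beta> *s 1"
    by (simp add: x'_def mult.assoc xX) (simp add: f_def algebra_simps)
  have xx': "x * x' = (\<alpha> * q) *s y + (\<alpha> * \<epsilon>) *s Y + \<beta> *s 1"
    by (simp add: x'_def f_def algebra_simps com com' xX qi)
  note nf = scale_numeral algebra_simps com com' x'com x'com' yY xX qi ee scale_left_distrib scale_left_diff_distrib
  define E where "E = y - \<epsilon> *s Y"
  define C where "C = y + \<epsilon> *s Y"
  have E0: "E \<noteq> 0"
  proof
    assume "E = 0"
    then have "y * y = \<epsilon> *s 1" by (metis E_def yY(2) eq_iff_diff_eq_0 scale_out(1))
    moreover have "x * (y * y) = (q * q) *s ((y * y) * x)" by (simp add: nf)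
    ultimately have "\<epsilon> *s x = (q * q) *s (\<epsilon> *s x)" by simp
    then have "(1 - q * q) *s (\<epsilon> *s x) = 0" unfolding scale_left_diff_distrib by simp
    then show False using x0 qq e0 by simp
  qed
  define Ei where "Ei = inverse E"
  have EEi: "E * Ei = 1" "Ei * E = 1" "E * (Ei * c) = c" "Ei * (E * c) = c" for c
    using E0 by (simp_all add: Ei_def flip: mult.assoc)
  have yEi: "y * Ei = Ei * y" "Y * Ei = Ei * Y" "C * Ei = Ei * C" "f * Ei = Ei * f"
    unfolding Ei_def
    by - (rule mult_commute_imp_mult_inverse_commute[symmetric], simp add: nf E_def C_def f_def)+
  have yEic: "y * (Ei * c) = Ei * (y * c)" "Y * (Ei * c) = Ei * (Y * c)" "C * (Ei * c) = Ei * (C * c)"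
     "f * (Ei * c) = Ei * (f * c)" for c
    using yEi by (simp_all flip: mult.assoc)
  \<comment> \<open>\<open>Ep\<close> and \<open>Em\<close> are \<open>E\<^sup>-\<^sup>1\<close> with \<open>q y\<close> and \<open>q\<^sup>-\<^sup>1 y\<close> in place of \<open>y\<close>.\<close>
  define Ep where "Ep = x * Ei * X"
  define Em where "Em = X * Ei * x"
  have xEi: "x * Ei = Ep * x" "x * (Ei * c) = Ep * (x * c)" for c
    by (simp_all add: Ep_def mult.assoc xX)
  have Ep1: "Ep * (q *s y - (\<epsilon> * inverse q) *s Y) = 1"
  proof -
    have "q *s y - (\<epsilon> * inverse q) *s Y = x * E * X" by (simp add: E_def nf)
    then show ?thesis by (simp add: Ep_def mult.assoc xX EEi)
  qed
  have Em1: "Em * (inverse q *s y - (\<epsilon> * q) *s Y) = 1"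
  proof -
    have "inverse q *s y - (\<epsilon> * q) *s Y = X * E * x" by (simp add: E_def nf)
    then show ?thesis by (simp add: Em_def mult.assoc xX EEi)
  qed
  have G: "Ep = inverse (q *s y - (\<epsilon> * inverse q) *s Y)" "Em = inverse (inverse q *s y - (\<epsilon> * q) *s Y)"
    using inverse_unique[OF Ep1] inverse_unique[OF Em1] by (metis inverse_inverse_eq)+
  have yEp: "y * Ep = Ep * y" "Y * Ep = Ep * Y" and yEm: "y * Em = Em * y" "Y * Em = Em * Y" "f * Em = Em * f"
    unfolding G by - (rule mult_commute_imp_mult_inverse_commute[symmetric], simp add: nf f_def)+
  have yEpc: "y * (Ep * c) = Ep * (y * c)" "Y * (Ep * c) = Ep * (Y * c)" for c
    using yEp by (simp_all flip: mult.assoc)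
  have yEmc: "y * (Em * c) = Em * (y * c)" "Y * (Em * c) = Em * (Y * c)" for c
    using yEm by (simp_all flip: mult.assoc)
  have x'Ei: "x' * Ei = Em * x'" "x' * (Ei * c) = Em * (x' * c)" for c
  proof -
    show 1: "x' * Ei = Em * x'"
    proof -
      have "Em * x' = f * (Em * X)" using yEm(3) by (simp add: x'_def flip: mult.assoc)
      then show ?thesis by (simp add: x'_def Em_def mult.assoc xX)
    qed
    show "x' * (Ei * c) = Em * (x' * c)" using arg_cong[OF 1, of "\<lambda>t. t * c"]
      by (simp add: mult.assoc)
  qed
  define b0 where "b0 = x - x'"
  define p0 where "p0 = Y * x - \<epsilon> *s (y * x')"
  define r0 where "r0 = y * x - \<epsilon> *s (Y * x')"
  define B where "B = Ei * b0"
  define P where "P = Ei * p0"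
  define R where "R = Ei * r0"
  define A where "A = x + x'"
  have Ep_b: "x * B = Ep * (x * b0)" "x' * B = Em * (x' * b0)" "x * P = Ep * (x * p0)" "x' * P = Em * (x' * p0)"
    by (simp_all add: B_def P_def xEi x'Ei)
  \<comment> \<open>After multiplication by \<open>E\<close> the terms in \<open>x\<^sup>2\<close> and \<open>x'\<^sup>2\<close> cancel, and the coefficients of \<open>x x'\<close> and \<open>x' x\<close> are multiples of
    \<open>Ep\<^sup>-\<^sup>1\<close> and \<open>Em\<^sup>-\<^sup>1\<close>.\<close>
  have F1: "P * B - q *s (B * P) = (\<epsilon> * q * (q - 1) * \<alpha>) *s 1"
  proof -
    have "p0 * B - q *s (b0 * P) = Ep * ((\<epsilon> * q * q) *s y - Y) * (x * x') + Em * ((q * q) *s Y - \<epsilon> *s y) * (x' * x)"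
      unfolding p0_def b0_def
      by (simp add: left_diff_distrib right_diff_distrib mult.assoc Ep_b)
        (simp add: p0_def b0_def nf yEp yEm yEpc yEmc)
    also have "(\<epsilon> * q * q) *s y - Y = (\<epsilon> * q) *s (q *s y - (\<epsilon> * inverse q) *s Y)"
      by (simp add: nf)
    also have "(q * q) *s Y - \<epsilon> *s y = (- \<epsilon> * q) *s (inverse q *s y - (\<epsilon> * q) *s Y)"
      by (simp add: nf)
    also have "Ep * ((\<epsilon> * q) *s (q *s y - (\<epsilon> * inverse q) *s Y)) * (x * x') +
        Em * ((- \<epsilon> * q) *s (inverse q *s y - (\<epsilon> * q) *s Y)) * (x' * x) =
        (\<epsilon> * q) *s (x * x' - x' * x)"
      unfolding scale_out Ep1 Em1 by (simp add: nf)
    also have "\<dots> = (\<epsilon> * q * (q - 1) * \<alpha>) *s E"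
      by (simp add: xx' x'x E_def nf)
    finally have "Ei * (p0 * B - q *s (b0 * P)) = (\<epsilon> * q * (q - 1) * \<alpha>) *s 1" by (simp add: EEi)
    then show ?thesis unfolding B_def P_def by (simp add: right_diff_distrib mult.assoc)
  qed
  have F2: "R * P - inverse q *s (B * B) = - ((\<epsilon> * \<alpha> * q) *s C) - (\<epsilon> * \<beta>) *s 1"
  proof -
    have "r0 * P - inverse q *s (b0 * B) =
       Ep * (inverse q *s 1 - (\<epsilon> * q) *s (y * y)) * (x * x') + Em * (inverse q *s 1 - (\<epsilon> * q) *s (Y * Y)) * (x' * x)"
      unfolding r0_def b0_def
      by (simp add: left_diff_distrib right_diff_distrib mult.assoc Ep_b)
        (simp add: p0_def b0_def nf yEp yEm yEpc yEmc)
    also have "inverse q *s 1 - (\<epsilon> * q) *s (y * y) = (q *s y - (\<epsilon> * inverse q) *s Y) * (- \<epsilon> *s y)"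
      by (simp add: nf)
    also have "inverse q *s 1 - (\<epsilon> * q) *s (Y * Y) = (inverse q *s y - (\<epsilon> * q) *s Y) * Y"
      by (simp add: nf)
    also have "Ep * ((q *s y - (\<epsilon> * inverse q) *s Y) * (- \<epsilon> *s y)) * (x * x') +
        Em * ((inverse q *s y - (\<epsilon> * q) *s Y) * Y) * (x' * x) = - (\<epsilon> *s (y * (x * x'))) + Y * (x' * x)"
      using arg_cong[OF Ep1, of "\<lambda>t. t * ((- \<epsilon> *s y) * (x * x'))"] arg_cong[OF Em1, of "\<lambda>t. t * (Y * (x' * x))"]
      by (simp add: mult.assoc)
    also have "\<dots> = E * (- ((\<epsilon> * \<alpha> * q) *s C) - (\<epsilon> * \<beta>) *s 1)"
      by (simp add: xx' x'x E_def C_def nf)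
    finally have "Ei * (r0 * P - inverse q *s (b0 * B)) = - ((\<epsilon> * \<alpha> * q) *s C) - (\<epsilon> * \<beta>) *s 1"
      by (simp add: EEi)
    then show ?thesis unfolding R_def B_def by (simp add: right_diff_distrib mult.assoc)
  qed
  have RC: "R = C * B - \<epsilon> *s P"
    by (simp add: B_def P_def R_def yEic) (simp add: r0_def p0_def b0_def C_def nf)
  have AC: "A = C * B - (2 * \<epsilon>) *s P"
  proof -
    have "C * B - (2 * \<epsilon>) *s P = Ei * (C * b0 - (2 * \<epsilon>) *s p0)"
      by (simp add: B_def P_def yEic right_diff_distrib)
    also have "C * b0 - (2 * \<epsilon>) *s p0 = E * A"
      by (simp add: C_def b0_def p0_def E_def A_def nf mult_2)
    finally show ?thesis by (simp add: EEi)
  qed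
  \<comment> \<open>The last two invariants that occur when \<open>x\<close> is multiplied by \<open>E\<close>.\<close>
  have F3: "A * E = E * (q *s R - (\<epsilon> * inverse q) *s P)"
  proof -
    have "E * (q *s R - (\<epsilon> * inverse q) *s P) = q *s r0 - (\<epsilon> * inverse q) *s p0"
      by (simp add: R_def P_def right_diff_distrib EEi)
    then show ?thesis by (simp add: A_def E_def r0_def p0_def nf)
  qed
  have F4: "2 *s (b0 * E) = (q - inverse q) *s (C * A) + (q + inverse q) *s (E * b0)"
    by (simp add: b0_def A_def E_def C_def nf)
  have B0: "B \<noteq> 0"
  proof
    assume "B = 0"
    then have "x + - x' + 0 = 0" using E0 by (simp add: B_def Ei_def b0_def)
    then have "x = 0"
      by (rule three_eigenvectors[OF y0, where l = "inverse q" and m = q and n = 0])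
         (use q(1) qq in \<open>auto simp: nf field_simps\<close>)
    then show False using x0 by simp
  qed
  have "e = Ei" "b = B" "p = P" "r = R"
    by (simp_all add: e_def b_def p_def r_def B_def P_def R_def Ei_def E_def b0_def p0_def r0_def Y_def
        \<phi>x x'_def f_def X_def)
  then have wb: "b = B" "p = P" "r = R" "w = B * P + (\<epsilon> * q * \<alpha>) *s 1" by (simp_all add: w_def)
  note w_def = wb(4)
  \<comment> \<open>The component of \<open>w\<close> that is quadratic in \<open>x\<close> is a product of nonzero factors.\<close>
  have w0: "w \<noteq> 0"
  proof
    assume "w = 0"
    moreover have "B * P = Ei * (Ep * (x * p0)) - Ei * (Em * (x' * p0))"
      unfolding B_def b0_def using Ep_b
        by (simp add: left_diff_distrib right_diff_distrib mult.assoc)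
    ultimately have "Ei * (Ep * (x * (Y * x))) +
        ((\<epsilon> * q * \<alpha>) *s 1 - \<epsilon> *s (Ei * (Ep * (x * (y * x')))) - Ei * (Em * (x' * (Y * x)))) +
        \<epsilon> *s (Ei * (Em * (x' * (y * x')))) = 0"
      unfolding w_def p0_def by (simp add: algebra_simps)
    then have "Ei * (Ep * (x * (Y * x))) = 0"
      by (rule three_eigenvectors[OF y0, where l = "inverse q * inverse q" and m = 1 and n = "q * q"])
         (use q(1) qq in \<open>auto simp: nf yEp yEm yEpc yEmc yEi yEic field_simps\<close>)
    moreover have "Ei \<noteq> 0" "Ep \<noteq> 0" "Y \<noteq> 0" using EEi(1) Ep1 yY(1) by auto
    ultimately show False using x0 by simp
  qed
  have wB: "w * B = q *s (B * w)"
  proof -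
    have "w * B = B * (P * B) + (\<epsilon> * q * \<alpha>) *s B" by (simp add: w_def distrib_right mult.assoc)
    also have "P * B = q *s (B * P) + (\<epsilon> * q * (q - 1) * \<alpha>) *s 1" using F1
      by (simp add: algebra_simps)
    finally show ?thesis by (simp add: w_def nf)
  qed
  define K where "K = division_closure {w, B}"
  have K: "division_subalgebra K" unfolding K_def by (rule division_subalgebra_closure)
  note Kin = division_subalgebraD(3-8)[OF K]
  have wK: "w \<in> K" and BK: "B \<in> K" and oneK: "1 \<in> K"
    by (auto simp: K_def intro: division_closure.intros)
  have "P = inverse B * (w - (\<epsilon> * q * \<alpha>) *s 1)" using B0 by (simp add: w_def flip: mult.assoc)
  then have PK: "P \<in> K" by (simp add: Kin wK BK oneK)
  have "C * w = \<epsilon> *s (P * P) + inverse q *s (B * B) - (\<epsilon> * \<beta>) *s 1"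
  proof -
    have "C * w = R * P + \<epsilon> *s (P * P) + (\<epsilon> * q * \<alpha>) *s C" unfolding RC w_def by (simp add: nf)
    also have "R * P = inverse q *s (B * B) + (- ((\<epsilon> * \<alpha> * q) *s C) - (\<epsilon> * \<beta>) *s 1)" using F2
      by (simp add: algebra_simps)
    finally show ?thesis by (simp add: algebra_simps)
  qed
  then have "C = (\<epsilon> *s (P * P) + inverse q *s (B * B) - (\<epsilon> * \<beta>) *s 1) * inverse w"
    using w0 by (metis mult.assoc mult_1_right right_inverse)
  then have CK: "C \<in> K" by (simp add: Kin wK BK PK oneK)
  have RK: "R \<in> K" and AK: "A \<in> K" unfolding RC AC by (simp_all add: Kin CK BK PK)
  have "E * E = C * C - (4 * \<epsilon>) *s 1"
    by (simp add: E_def C_def nf)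
  then have EEK: "E * E \<in> K" by (simp add: Kin CK oneK)
  have "E * b0 = (E * E) * B" by (simp add: B_def mult.assoc EEi)
  then have "E * b0 \<in> K" by (simp only: Kin EEK BK)
  moreover have "b0 * E = inverse 2 *s (2 *s (b0 * E))" by simp
  ultimately have bEK: "b0 * E \<in> K" unfolding F4 by (simp only: Kin CK AK)
  define v where "v i = (if i = 0 then 1 else E)" for i :: nat
  have span: "k + E * l \<in> right_span K 2 v" if "k \<in> K" "l \<in> K" for k l
    unfolding right_span_def
    by (rule CollectI, rule exI[of _ "\<lambda>i. if i = 0 then k else l"])
       (use that in \<open>auto simp: v_def numeral_2_eq_2\<close>)
  have half: "2 *s t = s \<Longrightarrow> t = inverse 2 *s s" for s t by auto
  have "division_closure {x, y} \<subseteq> right_span K 2 v"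
  proof (rule division_closure_subset_right_span[OF K])
    show "1 \<in> right_span K 2 v" using span[of 1 0] by (simp add: oneK division_subalgebraD(2)[OF K])
    fix a and i :: nat assume "a \<in> {x, y}" "i < 2"
    then consider "a = x" "v i = 1" | "a = y" "v i = 1" | "a = x" "v i = E" | "a = y" "v i = E"
      by (cases "i = 0") (auto simp: v_def)
    then show "a * v i \<in> right_span K 2 v"
    proof cases
      case 1
      have "x = inverse 2 *s A + E * (inverse 2 *s B)"
        by (simp add: B_def EEi A_def b0_def flip: scale_right_distrib scale_numeral(1))
      then show ?thesis using 1 span[of "inverse 2 *s A" "inverse 2 *s B"] by (simp add: Kin AK BK)
    next
      case 2
      have "y = inverse 2 *s C + E * (inverse 2 *s 1)"
        by (simp add: C_def E_def flip: scale_right_distrib scale_numeral(1))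
      then show ?thesis using 2 span[of "inverse 2 *s C" "inverse 2 *s 1"]
        by (simp add: Kin CK oneK)
    next
      case 3
      let ?k = "q *s R - (\<epsilon> * inverse q) *s P"
      have "2 *s (x * E) = b0 * E + A * E"
        by (simp add: b0_def A_def algebra_simps scale_numeral(1))
      then have "x * E = inverse 2 *s (b0 * E + A * E)" by (rule half)
      then have "x * E = inverse 2 *s (b0 * E) + E * (inverse 2 *s ?k)" unfolding F3
        by (simp add: scale_right_distrib)
      then show ?thesis using 3 span[of "inverse 2 *s (b0 * E)" "inverse 2 *s ?k"]
        by (simp add: Kin bEK RK PK)
    next
      case 4
      have "2 *s (y * E) = E * E + E * C"
        by (simp add: C_def E_def nf)
      then have "y * E = inverse 2 *s (E * E + E * C)" by (rule half)
      then have "y * E = inverse 2 *s (E * E) + E * (inverse 2 *s C)"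
        by (simp add: scale_right_distrib)
      then show ?thesis using 4 span[of "inverse 2 *s (E * E)" "inverse 2 *s C"]
        by (simp add: Kin EEK CK)
    qed
  qed
  note \<phi>s = alg_homD[OF \<phi>]
  have \<phi>x': "\<phi> x = x'" unfolding \<phi>x x'_def f_def X_def Y_def ..
  have \<phi>Y: "\<phi> Y = \<epsilon> *s y" unfolding Y_def by (simp add: \<phi>s \<phi>y inverse_scale e0)
  have x'0: "x' \<noteq> 0" using \<phi>s(9)[of x] x0 \<phi>x' by simp
  have \<phi>\<phi>x: "\<phi> x' = x"
  proof -
    have "\<phi> x' = \<phi> f * inverse x'" by (simp add: x'_def X_def \<phi>s \<phi>x'[unfolded x'_def X_def])
    also have "\<phi> f = x * x'" unfolding xx' by (simp add: f_def \<phi>s \<phi>y \<phi>Y Y_def[symmetric] nf)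
    finally show ?thesis using x'0 by (simp add: mult.assoc)
  qed
  have \<phi>E: "\<phi> E = - E" by (simp add: E_def \<phi>s \<phi>y \<phi>Y Y_def[symmetric] ee)
  have \<phi>Ei: "\<phi> Ei = - Ei" by (simp add: Ei_def \<phi>s \<phi>E)
  have \<phi>B: "\<phi> B = B" by (simp add: B_def b0_def \<phi>s \<phi>Ei \<phi>x' \<phi>\<phi>x algebra_simps)
  have \<phi>P: "\<phi> P = P"
    by (simp add: P_def p0_def \<phi>s \<phi>Ei \<phi>x' \<phi>\<phi>x \<phi>y \<phi>Y Y_def[symmetric] algebra_simps ee)
  have \<phi>w: "\<phi> w = w" by (simp add: w_def \<phi>s \<phi>B \<phi>P)
  have \<phi>K: "\<phi> k = k" if "k \<in> K" for k
    using division_closure_least[OF division_subalgebra_fixed[OF \<phi>], of "{w, B}"] that \<phi>w \<phi>B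
    by (auto simp: K_def)
  have "K = {r \<in> division_closure {x, y}. \<phi> r = r}"
  proof (intro equalityI subsetI)
    fix r assume r: "r \<in> K"
    note D = division_subalgebraD[OF division_subalgebra_closure[of "{x, y}"]]
    have x: "x \<in> division_closure {x, y}" and y: "y \<in> division_closure {x, y}"
      by (auto intro: division_closure.intros)
    have x': "x' \<in> division_closure {x, y}" unfolding x'_def f_def X_def Y_def by (intro D x y)
    have B: "B \<in> division_closure {x, y}" unfolding B_def b0_def Ei_def E_def Y_def
      by (intro D x y x')
    have "P \<in> division_closure {x, y}" unfolding P_def p0_def Ei_def E_def Y_def by (intro D x y x')
    then have "w \<in> division_closure {x, y}" unfolding w_def by (intro D B)
    then have "K \<subseteq> division_closure {x, y}" unfolding K_def using B
      by (intro division_closure_least division_subalgebra_closure) auto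
    then show "r \<in> {r \<in> division_closure {x, y}. \<phi> r = r}" using r \<phi>K by auto
  next
    fix r assume r: "r \<in> {r \<in> division_closure {x, y}. \<phi> r = r}"
    then have "r \<in> right_span K 2 v" using \<open>division_closure {x, y} \<subseteq> right_span K 2 v\<close> by auto
    then obtain a where a: "\<forall>i<2. a i \<in> K" "r = (\<Sum>i<2. v i * a i)"
      by (auto simp: right_span_def)
    then have rr: "r = a 0 + E * a 1" by (simp add: v_def numeral_2_eq_2)
    have "\<phi> r = a 0 - E * a 1" unfolding rr using a(1) by (simp add: \<phi>s \<phi>E \<phi>K)
    then have "E * a 1 = - (E * a 1)" using r rr by simp
    then have "2 *s (E * a 1) = 0" by (metis add_eq_0_iff2 one_add_one scale_left_distrib scale_one)
    then have "r = a 0" using rr by simp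
    then show "r \<in> K" using a(1) by simp
  qed
  moreover have "q_commuting q w B" using w0 B0 wB by (simp add: q_commuting_def)
  ultimately show "q_commuting q w b" "division_closure {w, b} = {r \<in> division_closure {x, y}. \<phi> r = r}"
    by (simp_all add: K_def wb)
  show "r * p = inverse q *s (b * b) - (\<epsilon> * \<alpha> * q) *s (y + \<epsilon> *s inverse y) - (\<epsilon> * \<beta>) *s 1"
    using F2 by (simp add: wb C_def Y_def algebra_simps)
qed


section \<open>Quantum tori and degrees\<close>

text \<open>The symmetric monomials \<open>m i j = h\<^sup>i\<^sup>j y\<^sup>i x\<^sup>j\<close> with \<open>h\<^sup>2 = q\<close>, for which \<open>SL\<^sub>2(\<int>)\<close> acts simply by acting on
  exponents. The last clause says that \<open>D\<close> consists of the fractions of the span of all monomials;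
  it is phrased through that span in order to be independent of the basis of \<open>\<int>\<^sup>2\<close>.\<close>

definition quantum_torus :: "'k \<Rightarrow> (int \<Rightarrow> int \<Rightarrow> 'd) \<Rightarrow> bool" where
  "quantum_torus h m \<longleftrightarrow> h \<noteq> 0 \<and> m 0 0 = 1 \<and>
     (\<forall>i j k l. m i j * m k l = h powi (j * k - i * l) *s m (i + k) (j + l)) \<and>
     (\<forall>d. \<exists>a\<in>span (range (case_prod m)). \<exists>b\<in>span (range (case_prod m)). b \<noteq> 0 \<and> d * b = a)"

text \<open>For \<open>x y = q y x\<close>, degree \<open>n\<close> in this sense means degree \<open>n\<close> in \<open>x\<close>.\<close>

definition homogeneous :: "'k \<Rightarrow> 'd \<Rightarrow> int \<Rightarrow> 'd \<Rightarrow> bool" where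
  "homogeneous q y n d \<longleftrightarrow> y * d = q powi (- n) *s (d * y)"

lemma homogeneous_add: "homogeneous q y n a \<Longrightarrow> homogeneous q y n b \<Longrightarrow> homogeneous q y n (a + b)"
  by (simp add: homogeneous_def distrib_left distrib_right scale_right_distrib)

lemma homogeneous_scale: "homogeneous q y n a \<Longrightarrow> homogeneous q y n (c *s a)"
  by (simp add: homogeneous_def mult.commute)

lemma homogeneous_zero: "homogeneous q y n 0"
  by (simp add: homogeneous_def)

lemma homogeneous_mult:
  assumes "q \<noteq> 0" "homogeneous q y n a" "homogeneous q y k b"
  shows "homogeneous q y (n + k) (a * b)"
proof -
  have "y * (a * b) = (q powi (- n) *s (a * y)) * b" using assms(2)
    by (simp add: homogeneous_def flip: mult.assoc)
  also have "\<dots> = q powi (- n) *s (a * (q powi (- k) *s (b * y)))"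
    using assms(3) by (simp add: homogeneous_def mult.assoc)
  also have "\<dots> = q powi (- (n + k)) *s (a * b * y)"
    using assms(1) power_int_add[of q "- n" "- k"] by (simp add: mult.assoc)
  finally show ?thesis unfolding homogeneous_def .
qed

lemma inj_power_int:
  assumes "(q::'k) \<noteq> 0" "\<forall>n::nat. n > 0 \<longrightarrow> q ^ n \<noteq> 1" shows "inj (\<lambda>n. q powi n)"
proof (rule linorder_injI)
  fix m n :: int assume "m < n"
  then have "q powi n = q powi m * q ^ nat (n - m)"
    using power_int_add[of q m "n - m"] assms(1) by (simp add: power_int_def)
  then show "q powi m \<noteq> q powi n" using assms(2)[rule_format, of "nat (n - m)"] \<open>m < n\<close> assms(1)
    by auto
qed

lemma homogeneous_components_unique:
  assumes q: "q \<noteq> 0" "\<forall>n::nat. n > 0 \<longrightarrow> q ^ n \<noteq> 1" and y: "y \<noteq> 0"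
    and F: "finite {n. F n \<noteq> 0}" "\<And>n. homogeneous q y n (F n)"
    and G: "finite {n. G n \<noteq> 0}" "\<And>n. homogeneous q y n (G n)"
    and eq: "Sum_any F = Sum_any G"
  shows "F n = G n"
proof -
  let ?J = "insert n ({n. F n \<noteq> 0} \<union> {n. G n \<noteq> 0})"
  have "F n - G n = 0"
  proof (rule eigenvectors_independent[where J = ?J and t = y and l = "\<lambda>n. q powi (- n)"])
    show "inj_on (\<lambda>n. q powi (- n)) ?J"
    proof (rule inj_onI)
      fix i j assume "q powi (- i) = q powi (- j)"
      from injD[OF inj_power_int[OF q] this] show "i = j" by simp
    qed
    show "y * (F j - G j) = q powi (- j) *s ((F j - G j) * y)" for j
      using F(2)[of j] G(2)[of j]
      by (simp add: homogeneous_def left_diff_distrib right_diff_distrib scale_right_diff_distrib)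
    have "Sum_any F = (\<Sum>j\<in>?J. F j)" "Sum_any G = (\<Sum>j\<in>?J. G j)"
      by (rule Sum_any.expand_superset; use F G in auto)+
    then show "(\<Sum>j\<in>?J. F j - G j) = 0" using eq by (simp only: sum_subtractf) simp
  qed (use F G y in auto)
  then show ?thesis by simp
qed

lemma three_term_product:
  fixes F :: "int \<Rightarrow> 'd"
  assumes F: "finite {n. F n \<noteq> 0}"
  shows "finite {n. a * F (n - 1) + b * F n + c * F (n + 1) \<noteq> 0}"
    "(a + b + c) * Sum_any F = (\<Sum>n. a * F (n - 1) + b * F n + c * F (n + 1))"
proof -
  have fin: "finite {n. d * F (n + k) \<noteq> 0}" for d k
  proof (rule finite_subset)
    show "finite ((\<lambda>n. n - k) ` {n. F n \<noteq> 0})" using F by simp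
    show "{n. d * F (n + k) \<noteq> 0} \<subseteq> (\<lambda>n. n - k) ` {n. F n \<noteq> 0}"
      by (auto simp: image_iff) (metis add_diff_cancel_right')
  qed
  note fin3 = fin[of a "- 1", simplified] fin[of b 0, simplified] fin[of c 1]
  have shift: "(\<Sum>n. d * F (n + k)) = d * Sum_any F" for d k
  proof -
    have "(\<Sum>n. d * F (n + k)) = (\<Sum>n. d * F n)"
      by (rule Sum_any.reindex_cong[of "\<lambda>n. n + k", symmetric])
        (auto simp: bij_betw_def inj_on_def surj_def o_def intro: exI[of _ "_ - k"])
    then show ?thesis using F by (simp add: Sum_any_right_distrib)
  qed
  note shift3 = shift[of a "- 1", simplified] shift[of b 0, simplified] shift[of c 1]
  have fin2: "finite {n. a * F (n - 1) + b * F n \<noteq> 0}"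
    by (rule finite_subset[OF _ finite_UnI[OF fin3(1,2)]]) auto
  show "finite {n. a * F (n - 1) + b * F n + c * F (n + 1) \<noteq> 0}"
    by (rule finite_subset[OF _ finite_UnI[OF fin2 fin3(3)]]) auto
  show "(a + b + c) * Sum_any F = (\<Sum>n. a * F (n - 1) + b * F n + c * F (n + 1))"
    using fin3 fin2 shift3 by (simp add: Sum_any.distrib distrib_right)
qed

lemma quantum_torusD:
  assumes "quantum_torus h m"
  shows "m i j * m k l = h powi (j * k - i * l) *s m (i + k) (j + l)" "m 0 0 = 1" "h \<noteq> 0"
    "m i j \<noteq> 0" "inverse (m i j) = m (- i) (- j)" "homogeneous (h * h) (m 1 0) j (m i j)"
proof -
  show mult: "m i j * m k l = h powi (j * k - i * l) *s m (i + k) (j + l)"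
    and "m 0 0 = 1" and h: "h \<noteq> 0" for i j k l
    using assms unfolding quantum_torus_def by blast+
  then have 1: "m i j * m (- i) (- j) = 1" by (simp add: mult.commute)
  then show "m i j \<noteq> 0" by auto
  show "inverse (m i j) = m (- i) (- j)" using 1 by (rule inverse_unique)
  show "homogeneous (h * h) (m 1 0) j (m i j)"
    unfolding homogeneous_def mult using h
    by (simp add: add.commute power_int_mult_distrib power_int_minus field_simps)
qed

lemma homogeneous_decomposition:
  assumes "quantum_torus h m" "f \<in> span (range (case_prod m))"
  obtains F where "finite {n. F n \<noteq> 0}" "\<And>n. homogeneous (h * h) (m 1 0) n (F n)" "f = Sum_any F"
proof -
  from assms(2) have "\<exists>F. finite {n. F n \<noteq> 0} \<and> (\<forall>n. homogeneous (h * h) (m 1 0) n (F n)) \<and> f = Sum_any F"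
  proof (induction rule: span_induct_alt)
    case base show ?case by (rule exI[of _ "\<lambda>_. 0"]) (simp add: homogeneous_zero)
  next
    case (step c a f)
    then obtain i j F where a: "a = m i j" and F: "finite {n. F n \<noteq> 0}"
      "\<And>n. homogeneous (h * h) (m 1 0) n (F n)" "f = Sum_any F" by auto
    let ?A = "\<lambda>n. c *s m i j when n = j"
    have fA: "finite {n. ?A n \<noteq> 0}" by (rule finite_subset[of _ "{j}"]) (auto simp: when_def)
    show ?case
    proof (intro exI conjI allI)
      show "finite {n. ?A n + F n \<noteq> 0}"
        by (rule finite_subset[OF _ finite_UnI[OF fA F(1)]]) auto
      show "homogeneous (h * h) (m 1 0) n (?A n + F n)" for n
        using quantum_torusD(6)[OF assms(1)] F(2)
        by (auto simp: when_def intro!: homogeneous_add homogeneous_scale homogeneous_zero)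
      show "c *s a + f = (\<Sum>n. ?A n + F n)"
        using fA F by (simp add: Sum_any.distrib a)
    qed
  qed
  then show ?thesis using that by blast
qed

text \<open>Used to show that two invariants are not proportional. Write \<open>u = f g\<^sup>-\<^sup>1\<close> with \<open>f\<close> and \<open>g\<close> in the span
  of the monomials and compare components in both equations: the highest degree forces
  \<open>\<zeta> \<omega> = 1\<close>, the lowest forces \<open>\<zeta> = \<omega>\<close>, and \<open>\<omega>\<^sup>2 \<noteq> 1\<close>.\<close>

lemma no_common_quotient:
  assumes m: "quantum_torus h m" and q: "\<forall>n::nat. n > 0 \<longrightarrow> (h * h) ^ n \<noteq> 1"
    and \<omega>: "\<omega> ^ 3 = 1" "\<omega> \<noteq> 1"
    and 1: "(\<omega> *s m 0 1 + m 1 0 + \<omega>^2 *s m (-1) (-1)) * u = \<omega>^2 *s m 1 1 + m (-1) 0 + \<omega> *s m 0 (-1)"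
    and 2: "(\<omega>^2 *s m 0 1 + m 1 0 + \<omega> *s m (-1) (-1)) * u =
       (\<zeta> * \<omega>) *s m 1 1 + \<zeta> *s m (-1) 0 + (\<zeta> * \<omega>^2) *s m 0 (-1)"
  shows False
proof -
  note mD = quantum_torusD[OF m]
  have q0: "h * h \<noteq> 0" using mD(3) by simp
  let ?hom = "homogeneous (h * h) (m 1 0)"
  obtain f g where fg: "f \<in> span (range (case_prod m))" "g \<in> span (range (case_prod m))" "g \<noteq> 0" "u * g = f"
    using m unfolding quantum_torus_def by blast
  obtain F where F: "finite {n. F n \<noteq> 0}" "\<And>n. ?hom n (F n)" "f = Sum_any F"
    using homogeneous_decomposition[OF m fg(1)] by blast
  obtain G where G: "finite {n. G n \<noteq> 0}" "\<And>n. ?hom n (G n)" "g = Sum_any G"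
    using homogeneous_decomposition[OF m fg(2)] by blast
  have hom3: "?hom n (a1 *s m i1 1 * H (n - 1) + a2 *s m i2 0 * H n + a3 *s m i3 (-1) * H (n + 1))"
    if "\<And>n. ?hom n (H n)" for a1 i1 a2 i2 a3 i3 H n
    using homogeneous_mult[OF q0 mD(6)[of 1 i1] that[of "n - 1"]] homogeneous_mult[OF q0 mD(6)[of 0 i2] that[of n]]
      homogeneous_mult[OF q0 mD(6)[of "-1" i3] that[of "n + 1"]]
    by (auto intro!: homogeneous_add homogeneous_scale)
  have comp: "a1 *s m 0 1 * F (n - 1) + 1 *s m 1 0 * F n + a3 *s m (-1) (-1) * F (n + 1) =
      b1 *s m 1 1 * G (n - 1) + b2 *s m (-1) 0 * G n + b3 *s m 0 (-1) * G (n + 1)"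
    if "(a1 *s m 0 1 + 1 *s m 1 0 + a3 *s m (-1) (-1)) * u = b1 *s m 1 1 + b2 *s m (-1) 0 + b3 *s m 0 (-1)"
    for a1 a3 b1 b2 b3 n
  proof (rule homogeneous_components_unique[OF q0 q mD(4)[of 1 0], where n = n
        and F = "\<lambda>n. a1 *s m 0 1 * F (n - 1) + 1 *s m 1 0 * F n + a3 *s m (-1) (-1) * F (n + 1)"
        and G = "\<lambda>n. b1 *s m 1 1 * G (n - 1) + b2 *s m (-1) 0 * G n + b3 *s m 0 (-1) * G (n + 1)"])
    show "(\<Sum>n. a1 *s m 0 1 * F (n - 1) + 1 *s m 1 0 * F n + a3 *s m (-1) (-1) * F (n + 1)) =
      (\<Sum>n. b1 *s m 1 1 * G (n - 1) + b2 *s m (-1) 0 * G n + b3 *s m 0 (-1) * G (n + 1))"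
      using arg_cong[OF that, of "\<lambda>t. t * g"] fg(4) three_term_product(2)[OF F(1)] three_term_product(2)[OF G(1)]
      by (simp add: F(3) G(3) mult.assoc del: scale_out)
  qed (rule three_term_product(1)[OF F(1)] three_term_product(1)[OF G(1)] hom3[OF F(2)] hom3[OF G(2)])+
  define S where "S = {n. F n \<noteq> 0} \<union> {n. G n \<noteq> 0}"
  have S: "finite S" "S \<noteq> {}" using F G fg(3) by (auto simp: S_def)
  have out: "F n = 0" "G n = 0" if "n \<notin> S" for n using that by (auto simp: S_def)
  have \<omega>s: "\<omega> * \<omega>^2 = 1" using \<omega> by (simp add: power2_eq_square power3_eq_cube mult.assoc)
  have cube: "\<omega>^2 * \<omega>^2 = \<omega>" "\<omega>^2 \<noteq> 0" "\<omega> \<noteq> 0" using \<omega>s \<omega>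
    by (auto simp: power2_eq_square mult.assoc)
  have "\<zeta> * \<omega> = 1"
  proof -
    define N where "N = Max S"
    have N: "N \<in> S" "N + 1 \<notin> S" "2 + N \<notin> S"
      using Max_in[OF S] Max_ge[OF S(1), of "N + 1"] Max_ge[OF S(1), of "2 + N"]
      by (auto simp: N_def)
    have e1: "\<omega> *s (m 0 1 * F N) = \<omega>^2 *s (m 1 1 * G N)"
      using comp[of \<omega> "\<omega>^2" "\<omega>^2" 1 \<omega> "N + 1"] 1 N out by simp
    have e2: "\<omega>^2 *s (m 0 1 * F N) = (\<zeta> * \<omega>) *s (m 1 1 * G N)"
      using comp[of "\<omega>^2" \<omega> "\<zeta> * \<omega>" \<zeta> "\<zeta> * \<omega>^2" "N + 1"] 2 N out by simp
    have "\<omega>^2 *s (m 0 1 * F N) = 1 *s (m 1 1 * G N)"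
      using arg_cong[OF e1, of "\<lambda>t. \<omega> *s t"] \<omega>s by (simp add: power2_eq_square)
    then have "(\<zeta> * \<omega> - 1) *s (m 1 1 * G N) = 0" using e2 by (simp add: scale_left_diff_distrib)
    moreover have "G N \<noteq> 0"
    proof
      assume "G N = 0"
      then have "F N = 0" using e1 cube mD(4) by simp
      then show False using N \<open>G N = 0\<close> by (simp add: S_def)
    qed
    ultimately show ?thesis using mD(4) by simp
  qed
  moreover have "\<zeta> = \<omega>"
  proof -
    define N where "N = Min S"
    have N: "N \<in> S" "N - 1 \<notin> S" "N - 2 \<notin> S"
      using Min_in[OF S] Min_le[OF S(1), of "N - 1"] Min_le[OF S(1), of "N - 2"]
      by (auto simp: N_def)
    have e1: "\<omega>^2 *s (m (-1) (-1) * F N) = \<omega> *s (m 0 (-1) * G N)"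
      using comp[of \<omega> "\<omega>^2" "\<omega>^2" 1 \<omega> "N - 1"] 1 N out by simp
    have e2: "\<omega> *s (m (-1) (-1) * F N) = (\<zeta> * \<omega>^2) *s (m 0 (-1) * G N)"
      using comp[of "\<omega>^2" \<omega> "\<zeta> * \<omega>" \<zeta> "\<zeta> * \<omega>^2" "N - 1"] 2 N out by simp
    have "\<omega>^2 *s (m (-1) (-1) * F N) = \<zeta> *s (m 0 (-1) * G N)"
      using arg_cong[OF e2, of "\<lambda>t. \<omega> *s t"] \<omega>s by (simp add: power2_eq_square mult.left_commute)
    then have "(\<zeta> - \<omega>) *s (m 0 (-1) * G N) = 0"
      unfolding scale_left_diff_distrib e1 right_minus_eq by (rule sym)
    moreover have "G N \<noteq> 0"
    proof
      assume "G N = 0"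
      then have "F N = 0" using e1 cube mD(4) by simp
      then show False using N \<open>G N = 0\<close> by (simp add: S_def)
    qed
    ultimately show ?thesis using mD(4) by simp
  qed
  ultimately have "\<omega> * \<omega> = 1" by simp
  then show False using \<omega> by (simp add: power3_eq_cube)
qed


lemma span_subset_division_closure: "span X \<subseteq> division_closure X"
proof
  fix a assume "a \<in> span X"
  then show "a \<in> division_closure X"
  proof (induction rule: span_induct_alt)
    case base show ?case by (rule division_subalgebraD(2)[OF division_subalgebra_closure])
  qed (auto intro: division_closure.intros)
qed

lemma quantum_torus_power_int:
  assumes "quantum_torus h m"
  shows "m i 0 = m 1 0 powi i" "m 0 j = m 0 1 powi j"
    "m i j = h powi (i * j) *s (m 1 0 powi i * m 0 1 powi j)"
proof -
  note mD = quantum_torusD[OF assms]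
  have nat: "m (int n) 0 = m 1 0 ^ n \<and> m 0 (int n) = m 0 1 ^ n" for n
  proof (induction n)
    case (Suc n)
    have "m (int (Suc n)) 0 = m 1 0 * m (int n) 0" "m 0 (int (Suc n)) = m 0 1 * m 0 (int n)"
      unfolding mD(1) by simp_all
    with Suc show ?case by simp
  qed (simp add: mD)
  have inv: "m (- i) 0 = inverse (m i 0)" "m 0 (- i) = inverse (m 0 i)" for i by (simp_all add: mD)
  have pi: "m i 0 = m 1 0 powi i \<and> m 0 i = m 0 1 powi i" for i
  proof (cases "i \<ge> 0")
    case True then show ?thesis using nat[of "nat i"] by (simp add: power_int_def)
  next
    case False then show ?thesis using nat[of "nat (- i)"] inv[of "- i"]
      by (simp add: power_int_def power_inverse)
  qed
  then show "m i 0 = m 1 0 powi i" "m 0 j = m 0 1 powi j" by blast+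
  have "m 1 0 powi i * m 0 1 powi j = m i 0 * m 0 j" using pi[of i] pi[of j] by metis
  also have "\<dots> = h powi (- (i * j)) *s m i j" unfolding mD(1) by simp
  finally have "m 1 0 powi i * m 0 1 powi j = h powi (- (i * j)) *s m i j" .
  moreover have "h powi (i * j) * h powi (- (i * j)) = 1"
    using power_int_add[of h "i * j" "- (i * j)"] mD(3) by simp
  ultimately show "m i j = h powi (i * j) *s (m 1 0 powi i * m 0 1 powi j)" by simp
qed

lemma division_closure_quantum_torus:
  assumes "quantum_torus h m" shows "division_closure {m 1 0, m 0 1} = UNIV"
proof -
  let ?S = "division_closure {m 1 0, m 0 1}"
  note S = division_subalgebraD[OF division_subalgebra_closure[of "{m 1 0, m 0 1}"]]
  have pow: "a ^ n \<in> ?S" if "a \<in> ?S" for a n using that by (induction n) (auto intro: S)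
  have powi: "a powi n \<in> ?S" if "a \<in> ?S" for a n
    using that by (auto simp: power_int_def intro!: pow S)
  have "m i j \<in> ?S" for i j
    by (subst quantum_torus_power_int(3)[OF assms], intro S powi)
      (auto intro: division_closure.base)
  then have "division_closure (range (case_prod m)) \<subseteq> ?S"
    by (intro division_closure_least division_subalgebra_closure) auto
  then have sp: "span (range (case_prod m)) \<subseteq> ?S" using span_subset_division_closure by blast
  have "d \<in> ?S" for d
  proof -
    obtain a b where "a \<in> span (range (case_prod m))" "b \<in> span (range (case_prod m))" "b \<noteq> 0" "d * b = a"
      using assms unfolding quantum_torus_def by blast
    then have "d = a * inverse b" "a \<in> ?S" "b \<in> ?S" using sp by (auto simp: mult.assoc)
    then show ?thesis by (simp add: S)
  qed
  then show ?thesis by auto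
qed



section \<open>The automorphism of order three\<close>

text \<open>The three monomials \<open>m 1 0\<close>, \<open>m 0 1\<close>, \<open>m (-1) (-1)\<close> are permuted cyclically by the automorphism of
  order three; for \<open>s\<^sup>3 = 1\<close> this is an eigenvector.\<close>

definition lagrange_resolvent :: "(int \<Rightarrow> int \<Rightarrow> 'd) \<Rightarrow> 'k \<Rightarrow> 'd" where
  "lagrange_resolvent m s = m 1 0 + s *s m 0 1 + s^2 *s m (-1) (-1)"

lemma primitive_cube_root_square:
  fixes \<omega> :: 'k
  assumes "\<omega> ^ 3 = 1" "\<omega> \<noteq> 1"
  shows "\<omega> * \<omega> = - \<omega> - 1" "\<omega> * (\<omega> * c) = - (\<omega> * c) - c"
proof -
  have "(\<omega> - 1) * (\<omega> * \<omega> + (\<omega> + 1)) = 0" using assms(1) by (simp add: algebra_simps power3_eq_cube)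
  then have "\<omega> * \<omega> + (\<omega> + 1) = 0" using assms(2) by simp
  then show *: "\<omega> * \<omega> = - \<omega> - 1" by (simp add: eq_neg_iff_add_eq_0 algebra_simps)
  show "\<omega> * (\<omega> * c) = - (\<omega> * c) - c"
    using arg_cong[OF *, of "\<lambda>t. t * c"] by (simp add: algebra_simps)
qed

text \<open>The products of two resolvents \<open>a s\<close>, \<open>a t\<close> with the same \<open>s t\<close> all have the same squares of
  monomials, so they differ by multiples of a resolvent \<open>b\<close> of the inverse monomials. The last three
  identities are the Fourier transform of \<open>z z\<^sup>-\<^sup>1 = 1\<close> for the three monomials \<open>z\<close>.\<close>

lemma resolvent_products:
  assumes m: "quantum_torus h m" and \<omega>: "\<omega> ^ 3 = 1" "\<omega> \<noteq> 1"
  defines "a \<equiv> lagrange_resolvent m" and "b \<equiv> lagrange_resolvent (\<lambda>i j. m (-i) (-j))"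
    and "\<kappa> \<equiv> inverse h * (1 - \<omega>) + h * (1 - \<omega>^2)" and "\<kappa>' \<equiv> inverse h * (1 - \<omega>^2) + h * (1 - \<omega>)"
  shows "a \<omega> * a \<omega> - a 1 * a (\<omega>^2) = \<kappa> *s b (\<omega>^2)"
    "a \<omega> * a \<omega> - a (\<omega>^2) * a 1 = \<kappa>' *s b (\<omega>^2)"
    "a (\<omega>^2) * a (\<omega>^2) - a \<omega> * a 1 = \<kappa> *s b \<omega>"
    "a (\<omega>^2) * a (\<omega>^2) - a 1 * a \<omega> = \<kappa>' *s b \<omega>"
    "a \<omega> * a (\<omega>^2) = a 1 * a 1 - \<kappa>' *s b 1"
    "a (\<omega>^2) * a \<omega> = a 1 * a 1 - \<kappa> *s b 1"
    "a \<omega> * b 1 = - (a 1 * b \<omega>) - a (\<omega>^2) * b (\<omega>^2)"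
    "a (\<omega>^2) * b 1 = - (a 1 * b (\<omega>^2)) - a \<omega> * b \<omega>"
    "a 1 * b 1 + a \<omega> * b (\<omega>^2) + a (\<omega>^2) * b \<omega> = 9 *s 1"
proof -
  note mD = quantum_torusD[OF m]
  note ww = primitive_cube_root_square(1)[OF \<omega>] and wwc = primitive_cube_root_square(2)[OF \<omega>]
  have hh: "h * inverse h = 1" "inverse h * h = 1" "h * (inverse h * c) = c" "inverse h * (h * c) = c" for c
    using mD(3) by auto
  note sc = scale_left_distrib scale_left_diff_distrib scale_right_distrib scale_right_diff_distrib
  note ring = distrib_left distrib_right left_diff_distrib right_diff_distrib
  note ab = a_def b_def lagrange_resolvent_def power2_eq_square
  show "a \<omega> * a \<omega> - a 1 * a (\<omega>^2) = \<kappa> *s b (\<omega>^2)"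
    unfolding ab \<kappa>_def \<kappa>'_def
    by (simp add: mD(1) ring sc ww wwc; simp add: algebra_simps sc ww wwc hh scale_numeral)
  show "a \<omega> * a \<omega> - a (\<omega>^2) * a 1 = \<kappa>' *s b (\<omega>^2)"
    unfolding ab \<kappa>_def \<kappa>'_def
    by (simp add: mD(1) ring sc ww wwc; simp add: algebra_simps sc ww wwc hh scale_numeral)
  show "a (\<omega>^2) * a (\<omega>^2) - a \<omega> * a 1 = \<kappa> *s b \<omega>"
    unfolding ab \<kappa>_def \<kappa>'_def
    by (simp add: mD(1) ring sc ww wwc; simp add: algebra_simps sc ww wwc hh scale_numeral)
  show "a (\<omega>^2) * a (\<omega>^2) - a 1 * a \<omega> = \<kappa>' *s b \<omega>"
    unfolding ab \<kappa>_def \<kappa>'_def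
    by (simp add: mD(1) ring sc ww wwc; simp add: algebra_simps sc ww wwc hh scale_numeral)
  show "a \<omega> * a (\<omega>^2) = a 1 * a 1 - \<kappa>' *s b 1"
    unfolding ab \<kappa>_def \<kappa>'_def
    by (simp add: mD(1) ring sc ww wwc; simp add: algebra_simps sc ww wwc hh scale_numeral)
  show "a (\<omega>^2) * a \<omega> = a 1 * a 1 - \<kappa> *s b 1"
    unfolding ab \<kappa>_def \<kappa>'_def
    by (simp add: mD(1) ring sc ww wwc; simp add: algebra_simps sc ww wwc hh scale_numeral)
  show "a \<omega> * b 1 = - (a 1 * b \<omega>) - a (\<omega>^2) * b (\<omega>^2)"
    unfolding ab \<kappa>_def \<kappa>'_def
    by (simp add: mD(1) ring sc ww wwc; simp add: algebra_simps sc ww wwc hh scale_numeral)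
  show "a (\<omega>^2) * b 1 = - (a 1 * b (\<omega>^2)) - a \<omega> * b \<omega>"
    unfolding ab \<kappa>_def \<kappa>'_def
    by (simp add: mD(1) ring sc ww wwc; simp add: algebra_simps sc ww wwc hh scale_numeral)
  show "a 1 * b 1 + a \<omega> * b (\<omega>^2) + a (\<omega>^2) * b \<omega> = 9 *s 1"
    unfolding ab \<kappa>_def \<kappa>'_def
    by (simp add: mD(1) ring sc ww wwc; simp add: algebra_simps sc ww wwc hh scale_numeral mD(2))
qed

lemma lagrange_resolvent_nonzero:
  assumes m: "quantum_torus h m" and q: "\<forall>n::nat. n > 0 \<longrightarrow> (h * h) ^ n \<noteq> 1"
  shows "lagrange_resolvent m s \<noteq> 0"
proof -
  note mD = quantum_torusD[OF m]
  have qq: "h * h \<noteq> 1" "h * h * (h * h) \<noteq> 1" using q[rule_format, of 1] q[rule_format, of 2]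
    by (auto simp: power2_eq_square)
  have ineq: "1 \<noteq> inverse (h * h)" "1 \<noteq> h * h" "inverse (h * h) \<noteq> h * h" using qq mD(3)
    by (auto simp: field_simps)
  show ?thesis
  proof
    assume "lagrange_resolvent m s = 0"
    then have "m 1 0 + s *s m 0 1 + s^2 *s m (-1) (-1) = 0" by (simp add: lagrange_resolvent_def)
    then have "m 1 0 = 0"
    proof (rule three_eigenvectors[OF mD(4)[of 1 0]])
      note hs = homogeneous_scale[OF quantum_torusD(6)[OF m], unfolded homogeneous_def]
      show "m 1 0 * m 1 0 = 1 *s (m 1 0 * m 1 0)" by simp
      show "m 1 0 * (s *s m 0 1) = (h * h) powi (-1) *s ((s *s m 0 1) * m 1 0)" by (rule hs)
      show "m 1 0 * (s^2 *s m (-1) (-1)) = (h * h) powi (-(-1)) *s ((s^2 *s m (-1) (-1)) * m 1 0)"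
        by (rule hs)
    qed (use ineq in simp_all)
    then show False using mD(4) by simp
  qed
qed

text \<open>With \<open>a\<^sub>i = a (\<omega>\<^sup>i)\<close>, \<open>b\<^sub>i = b (\<omega>\<^sup>i)\<close>, the quotients \<open>u = a\<^sub>1\<^sup>-\<^sup>1 b\<^sub>1\<close> and \<open>v = a\<^sub>2\<^sup>-\<^sup>1 b\<^sub>2\<close> are invariant.
  The products of resolvents express \<open>b\<^sub>0\<close> in two ways through \<open>a\<^sub>0, u, v\<close>; equating them leaves a
  quadratic relation between \<open>u\<close> and \<open>v\<close> alone, which is the \<open>q\<close>-commutation of
  \<open>u - \<omega> v\<close> and \<open>u - \<omega>\<^sup>2 v\<close>. Inserting \<open>b\<^sub>0\<close> in \<open>a\<^sub>0 b\<^sub>0 + a\<^sub>1 b\<^sub>2 + a\<^sub>2 b\<^sub>1 = 9\<close> gives an equation that is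
  linear in \<open>a\<^sub>0\<close>, because its quadratic terms cancel. So \<open>a\<^sub>0\<close> and \<open>b\<^sub>0\<close> lie in the division subalgebra \<open>K\<close>
  generated by \<open>u\<close> and \<open>v\<close>, and \<open>K + a\<^sub>1 K + a\<^sub>2 K\<close> is stable under the resolvents, which generate \<open>D\<close>.\<close>

theorem fixed_subalgebra_of_order_3:
  assumes m: "quantum_torus h m" and q: "\<forall>n::nat. n > 0 \<longrightarrow> (h * h) ^ n \<noteq> 1"
    and \<omega>: "\<omega> ^ 3 = 1" "\<omega> \<noteq> 1"
    and \<sigma>: "alg_hom (*s) (*s) \<sigma>" "\<And>i j. \<sigma> (m i j) = m (- j) (i - j)"
  defines "a \<equiv> lagrange_resolvent m" and "b \<equiv> lagrange_resolvent (\<lambda>i j. m (-i) (-j))"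
  defines "u \<equiv> inverse (a \<omega>) * b \<omega>" and "v \<equiv> inverse (a (\<omega>^2)) * b (\<omega>^2)"
  shows "q_commuting (h * h) (u - \<omega> *s v) (u - \<omega>^2 *s v)"
    "division_closure {u - \<omega> *s v, u - \<omega>^2 *s v} = {r. \<sigma> r = r}"
proof -
  note mD = quantum_torusD[OF m]
  define \<kappa> where "\<kappa> = inverse h * (1 - \<omega>) + h * (1 - \<omega>^2)"
  define \<kappa>' where "\<kappa>' = inverse h * (1 - \<omega>^2) + h * (1 - \<omega>)"
  note prods = resolvent_products[OF m \<omega>, folded a_def b_def \<kappa>_def \<kappa>'_def]
  define a0 a1 a2 b0 b1 b2 where ab_def: "a0 = a 1" "a1 = a \<omega>" "a2 = a (\<omega>^2)" "b0 = b 1" "b1 = b \<omega>" "b2 = b (\<omega>^2)"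
  note P = prods[folded ab_def]
  note ww = primitive_cube_root_square(1)[OF \<omega>] and wwc = primitive_cube_root_square(2)[OF \<omega>]
  have w4: "\<omega>^2 * \<omega>^2 = \<omega>" "\<omega> * \<omega>^2 = 1" "\<omega>^2 * \<omega> = 1" "\<omega> * \<omega> = \<omega>^2" "\<omega> \<noteq> 0" "\<omega>^2 \<noteq> 0" "\<omega>^2 \<noteq> 1" "(\<omega>^2)^2 = \<omega>"
    using \<omega> by (auto simp: power2_eq_square power3_eq_cube mult.assoc)
  have w5: "\<omega> ^ 4 = \<omega>" using \<omega>(1) by (simp add: power4_eq_xxxx power3_eq_cube mult.assoc)
  have w0: "\<omega> \<noteq> \<omega>^2" using w4 \<omega> by auto
  have hh: "h * inverse h = 1" "inverse h * h = 1" "h * (inverse h * c) = c" "inverse h * (h * c) = c" for c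
    using mD(3) by auto
  have qq: "h * h \<noteq> 1" "h * h * (h * h) \<noteq> 1" using q[rule_format, of 1] q[rule_format, of 2]
    by (auto simp: power2_eq_square)
  have a12: "a1 \<noteq> 0" "a2 \<noteq> 0" using lagrange_resolvent_nonzero[OF m q] by (auto simp: ab_def a_def)
  have uv: "u = inverse a1 * b1" "v = inverse a2 * b2" by (simp_all add: u_def v_def ab_def)
  have bu: "b1 = a1 * u" "b2 = a2 * v" using a12 by (simp_all add: uv flip: mult.assoc)
  \<comment> \<open>Left multiplication by the resolvents on \<open>K + a1 K + a2 K\<close>.\<close>
  have a0a1: "a0 * a1 = a1 * (a0 + (\<kappa> - \<kappa>') *s u)"
    using P(3,4) unfolding bu by (simp add: distrib_left scale_left_diff_distrib algebra_simps)
  have a0a2: "a0 * a2 = a2 * (a0 + (\<kappa>' - \<kappa>) *s v)"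
    using P(1,2) unfolding bu by (simp add: distrib_left scale_left_diff_distrib algebra_simps)
  have a1a1: "a1 * a1 = a2 * (a0 + \<kappa>' *s v)"
    using P(2) unfolding bu by (simp add: algebra_simps)
  have a2a2: "a2 * a2 = a1 * (a0 + \<kappa> *s u)"
    using P(3) unfolding bu by (simp add: algebra_simps)
  define W where "W = (\<kappa> - \<kappa>') *s (u * u) + \<kappa> *s (u * v)"
  have b0: "b0 = - (a0 * (u + v)) - W"
  proof -
    have "a1 * b0 = - (a0 * a1) * u - (a2 * a2) * v" using P(7) unfolding bu
      by (simp add: mult.assoc)
    also have "\<dots> = a1 * (- (a0 * (u + v)) - W)"
      unfolding a0a1 a2a2 W_def by (simp add: algebra_simps)
    finally show ?thesis using a12 by simp
  qed
  have b0': "b0 = - (a0 * (u + v)) - ((\<kappa>' - \<kappa>) *s (v * v) + \<kappa>' *s (v * u))"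
  proof -
    have "a2 * b0 = - (a0 * a2) * v - (a1 * a1) * u" using P(8) unfolding bu
      by (simp add: mult.assoc)
    also have "\<dots> = a2 * (- (a0 * (u + v)) - ((\<kappa>' - \<kappa>) *s (v * v) + \<kappa>' *s (v * u)))"
      unfolding a0a2 a1a1 by (simp add: algebra_simps)
    finally show ?thesis using a12 by simp
  qed
  have rel: "(\<kappa> - \<kappa>') *s (u * u + v * v) + \<kappa> *s (u * v) - \<kappa>' *s (v * u) = 0"
    using b0 b0' by (simp add: W_def scale_left_diff_distrib scale_right_distrib algebra_simps)
  define p where "p = u - \<omega> *s v"
  define p' where "p' = u - \<omega>^2 *s v"
  have "(\<omega> - \<omega>^2) *s (p * p' - (h * h) *s (p' * p)) =
      (- h) *s ((\<kappa> - \<kappa>') *s (u * u + v * v) + \<kappa> *s (u * v) - \<kappa>' *s (v * u))"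
    unfolding p_def p'_def \<kappa>_def \<kappa>'_def power2_eq_square
    by (simp add: algebra_simps scale_left_distrib scale_left_diff_distrib ww wwc hh scale_numeral)
  then have pp': "p * p' = (h * h) *s (p' * p)" using rel w0 by simp
  have hom3: False if "u = \<zeta> *s v" for \<zeta>
  proof (rule no_common_quotient[OF m q \<omega>])
    show "(\<omega> *s m 0 1 + m 1 0 + \<omega>^2 *s m (-1) (-1)) * u = \<omega>^2 *s m 1 1 + m (-1) 0 + \<omega> *s m 0 (-1)"
      using bu(1) by (simp add: ab_def a_def b_def lagrange_resolvent_def algebra_simps)
    have "a2 * u = \<zeta> *s b2" using that bu(2) by simp
    then show "(\<omega>^2 *s m 0 1 + m 1 0 + \<omega> *s m (-1) (-1)) * u =
       (\<zeta> * \<omega>) *s m 1 1 + \<zeta> *s m (-1) 0 + (\<zeta> * \<omega>^2) *s m 0 (-1)"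
      by (simp add: ab_def a_def b_def lagrange_resolvent_def algebra_simps w4 w5)
  qed
  have p0: "p \<noteq> 0" "p' \<noteq> 0" using hom3[of \<omega>] hom3[of "\<omega>^2"] by (auto simp: p_def p'_def)
  show "q_commuting (h * h) (u - \<omega> *s v) (u - \<omega>^2 *s v)"
    using pp' p0 by (simp add: q_commuting_def p_def p'_def)
  define K where "K = division_closure {p, p'}"
  have K: "division_subalgebra K" unfolding K_def by (rule division_subalgebra_closure)
  note Kin = division_subalgebraD(1,3-8)[OF K]
  have pK: "p \<in> K" "p' \<in> K" by (auto simp: K_def intro: division_closure.intros)
  have "v = inverse (\<omega>^2 - \<omega>) *s (p - p')"
    using w0 by (simp add: p_def p'_def flip: scale_left_diff_distrib)
  then have vK: "v \<in> K" by (simp add: Kin pK)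
  have "u = p + \<omega> *s v" by (simp add: p_def)
  then have uK: "u \<in> K" using vK by (simp only: Kin pK)
  define S where "S = \<kappa> *s u + \<kappa>' *s v"
  define \<Delta> where "\<Delta> = (u + v) * S - W"
  have a0: "a0 * \<Delta> + W * S = 9 *s 1"
  proof -
    have "9 *s 1 = a0 * b0 + (a1 * a2) * v + (a2 * a1) * u"
      using P(9) unfolding bu by (simp add: mult.assoc)
    also have "\<dots> = a0 * b0 + a0 * a0 * (u + v) - b0 * S"
      unfolding P(5,6) S_def by (simp add: algebra_simps)
    also have "\<dots> = a0 * \<Delta> + W * S"
      unfolding b0 \<Delta>_def by (simp add: algebra_simps)
    finally show ?thesis by simp
  qed
  \<comment> \<open>Up to a nonzero scalar and the quadratic relation, \<open>\<Delta>\<close> is the commutator of \<open>v\<close> and \<open>u\<close>.\<close>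
  have \<Delta>0: "\<Delta> \<noteq> 0"
  proof
    assume "\<Delta> = 0"
    have "\<kappa> * \<kappa> - \<kappa> * \<kappa>' + \<kappa>' * \<kappa>' = 9"
      unfolding \<kappa>_def \<kappa>'_def power2_eq_square by (simp add: algebra_simps ww wwc hh)
    moreover have "(\<kappa> - \<kappa>') *s \<Delta> = (\<kappa> * \<kappa> - \<kappa> * \<kappa>' + \<kappa>' * \<kappa>') *s (v * u - u * v) +
       \<kappa>' *s ((\<kappa> - \<kappa>') *s (u * u + v * v) + \<kappa> *s (u * v) - \<kappa>' *s (v * u))"
      unfolding \<Delta>_def S_def W_def
      by (simp add: algebra_simps scale_left_distrib scale_left_diff_distrib)
    ultimately have "(\<kappa> - \<kappa>') *s \<Delta> = 9 *s (v * u - u * v) +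
       \<kappa>' *s ((\<kappa> - \<kappa>') *s (u * u + v * v) + \<kappa> *s (u * v) - \<kappa>' *s (v * u))" by simp
    then have "v * u = u * v" using rel \<open>\<Delta> = 0\<close> by simp
    then have "p * p' = p' * p" by (simp add: p_def p'_def algebra_simps)
    then have "(h * h - 1) *s (p' * p) = 0" using pp' by (simp add: scale_left_diff_distrib)
    then show False using p0 qq by simp
  qed
  have "a0 = (9 *s 1 - W * S) * inverse \<Delta>"
    using a0 \<Delta>0 by (metis add_diff_cancel_right' mult.assoc mult_1_right right_inverse)
  moreover have WK: "W \<in> K" "S \<in> K" unfolding W_def S_def by (simp_all add: Kin uK vK)
  ultimately have a0K: "a0 \<in> K" by (simp add: Kin uK vK \<Delta>_def)
  then have b0K: "b0 \<in> K" unfolding b0 by (simp add: Kin uK vK WK)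
  define e where "e i = (if i = 0 then 1 else if i = 1 then a1 else a2)" for i :: nat
  have span: "k + a1 * l + a2 * n \<in> right_span K 3 e" if "k \<in> K" "l \<in> K" "n \<in> K" for k l n
    unfolding right_span_def
    by (rule CollectI, rule exI[of _ "\<lambda>i. if i = 0 then k else if i = 1 then l else n"])
       (use that in \<open>auto simp: e_def numeral_3_eq_3\<close>)
  have zK: "0 \<in> K" by (rule division_subalgebraD(2)[OF K])
  have span1: "k \<in> K \<Longrightarrow> k \<in> right_span K 3 e" "k \<in> K \<Longrightarrow> a1 * k \<in> right_span K 3 e"
    "k \<in> K \<Longrightarrow> a2 * k \<in> right_span K 3 e" for k
    using span[of k 0 0] span[of 0 k 0] span[of 0 0 k] zK by simp_all
  have gen: "division_closure {a0, a1, a2} \<subseteq> right_span K 3 e"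
  proof (rule division_closure_subset_right_span[OF K])
    show "1 \<in> right_span K 3 e" using span1(1) by (simp add: Kin)
    fix c and i :: nat assume c: "c \<in> {a0, a1, a2}" and "i < 3"
    have Kk: "a0 + (\<kappa> - \<kappa>') *s u \<in> K" "a0 + (\<kappa>' - \<kappa>) *s v \<in> K" "a0 + \<kappa>' *s v \<in> K" "a0 + \<kappa> *s u \<in> K"
      "a1 * a2 \<in> K" "a2 * a1 \<in> K"
      unfolding P(5,6) by (simp_all add: Kin a0K uK vK b0K)
    have "i = 0 \<or> i = 1 \<or> i = 2" using \<open>i < 3\<close> by auto
    then have "e i = 1 \<or> e i = a1 \<or> e i = a2" by (auto simp: e_def)
    moreover have "a0 * a1 \<in> right_span K 3 e" "a1 * a1 \<in> right_span K 3 e"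
        "a0 * a2 \<in> right_span K 3 e" "a2 * a2 \<in> right_span K 3 e"
      unfolding a0a1 a1a1 a0a2 a2a2 using Kk by (simp_all add: span1)
    ultimately show "c * e i \<in> right_span K 3 e"
      using c Kk(5,6) span1(1)[OF a0K] span1(2,3)[of 1] by (auto simp: Kin intro: span1(1))
  qed
  have "division_closure {a0, a1, a2} = UNIV"
  proof -
    note D = division_subalgebraD[OF division_subalgebra_closure[of "{a0, a1, a2}"]]
    have A: "a0 \<in> division_closure {a0, a1, a2}" "a1 \<in> division_closure {a0, a1, a2}" "a2 \<in> division_closure {a0, a1, a2}"
      by (auto intro: division_closure.base)
    have "3 *s m 1 0 = a0 + a1 + a2" "3 *s m 0 1 = a0 + \<omega>^2 *s a1 + \<omega> *s a2"
      unfolding ab_def a_def lagrange_resolvent_def power2_eq_square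
      by (simp_all add: algebra_simps scale_numeral scale_left_distrib scale_left_diff_distrib ww wwc)
    then have "m 1 0 = inverse 3 *s (a0 + a1 + a2)" "m 0 1 = inverse 3 *s (a0 + \<omega>^2 *s a1 + \<omega> *s a2)"
      by (metis scale_scale scale_one left_inverse zero_neq_numeral)+
    then have "{m 1 0, m 0 1} \<subseteq> division_closure {a0, a1, a2}" using A by (auto intro!: D)
    then show ?thesis using division_closure_least[OF division_subalgebra_closure] division_closure_quantum_torus[OF m] by blast
  qed
  note \<sigma>s = alg_homD[OF \<sigma>(1)]
  have \<sigma>a: "\<sigma> a1 = \<omega>^2 *s a1" "\<sigma> a2 = \<omega> *s a2" "\<sigma> b1 = \<omega>^2 *s b1" "\<sigma> b2 = \<omega> *s b2"
    by (simp_all add: ab_def a_def b_def lagrange_resolvent_def \<sigma> \<sigma>s w4 w5 scale_right_distrib add_ac)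
  have \<sigma>uv: "\<sigma> u = u" "\<sigma> v = v" using w4 by (simp_all add: uv \<sigma>s \<sigma>a inverse_scale)
  have \<sigma>K: "\<sigma> k = k" if "k \<in> K" for k
    using division_closure_least[OF division_subalgebra_fixed[OF \<sigma>(1)], of "{p, p'}"] that \<sigma>uv
    by (auto simp: K_def p_def p'_def \<sigma>s)
  have "K = {r. \<sigma> r = r}"
  proof (intro equalityI subsetI)
    fix r assume "r \<in> {r. \<sigma> r = r}"
    then have r: "\<sigma> r = r" by simp
    have "r \<in> right_span K 3 e" using gen \<open>division_closure {a0, a1, a2} = UNIV\<close> by auto
    then obtain k where k: "\<forall>i<3. k i \<in> K" "r = (\<Sum>i<3. e i * k i)"
      by (auto simp: right_span_def)
    then have rr: "r = k 0 + a1 * k 1 + a2 * k 2" by (simp add: e_def numeral_3_eq_3 numeral_2_eq_2)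
    have \<sigma>k: "\<sigma> (k 0) = k 0" "\<sigma> (k 1) = k 1" "\<sigma> (k 2) = k 2" using k(1) by (auto intro!: \<sigma>K)
    have 1: "\<sigma> r = k 0 + \<omega>^2 *s (a1 * k 1) + \<omega> *s (a2 * k 2)"
      unfolding rr by (simp add: \<sigma>s \<sigma>k \<sigma>a del: One_nat_def)
    have 2: "\<sigma> (\<sigma> r) = k 0 + \<omega> *s (a1 * k 1) + \<omega>^2 *s (a2 * k 2)"
      unfolding 1 by (simp add: \<sigma>s \<sigma>k \<sigma>a w4 w5 del: One_nat_def)
    have "3 *s r = r + \<sigma> r + \<sigma> (\<sigma> r)" by (simp add: r scale_numeral)
    also have "\<dots> = 3 *s k 0"
      unfolding 2 unfolding 1 unfolding rr power2_eq_square ww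
        by (simp add: algebra_simps scale_numeral scale_left_diff_distrib)
    finally have "r = k 0" by simp
    then show "r \<in> K" using k(1) by simp
  qed (use \<sigma>K in auto)
  then show "division_closure {u - \<omega> *s v, u - \<omega>^2 *s v} = {r. \<sigma> r = r}"
    by (simp add: K_def p_def p'_def)
qed


section \<open>The torus of a q-division ring and the orders two, four and six\<close>

lemma q_commuting_power_int:
  assumes qc: "q_commuting q x y" and q: "q \<noteq> 0"
  shows "x powi j * y powi k = q powi (j * k) *s (y powi k * x powi j)"
proof -
  note inv = q_commuting_inverse[OF qc q]
  have xy: "x * y = q *s (y * x)" "x \<noteq> 0" "y \<noteq> 0" using qc by (auto simp: q_commuting_def)
  have 1: "x * y powi k = q powi k *s (y powi k * x)"
    using q_commuting_power[OF xy(1), of "nat k"] q_commuting_power[OF inv(1), of "nat (- k)"]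
    by (auto simp: power_int_def)
  have qc': "q_commuting (q powi k) x (y powi k)" using 1 xy by (simp add: q_commuting_def)
  have "x powi j * y powi k = (q powi k) powi j *s (y powi k * x powi j)"
    using q_commuting_power2[OF 1, of "nat j"]
      q_commuting_power2[OF q_commuting_inverse(2)[OF qc'], of "nat (- j)"] q
    by (auto simp: power_int_def)
  then show ?thesis using power_int_mult[of q k j] by (simp add: mult.commute)
qed

lemma quantum_torus_of_q_division_ring:
  assumes D: "is_q_division_ring (*s) (h * h) x y" and q: "h \<noteq> 0" "\<forall>n::nat. n > 0 \<longrightarrow> (h * h) ^ n \<noteq> 1"
  shows "quantum_torus h (\<lambda>i j. h powi (i * j) *s (y powi i * x powi j))" (is "quantum_torus h ?m")
proof -
  have qc: "q_commuting (h * h) x y" using universal_property(1)[OF D] q by simp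
  then have xy: "x \<noteq> 0" "y \<noteq> 0" by (auto simp: q_commuting_def)
  have mult: "?m i j * ?m k l = h powi (j * k - i * l) *s ?m (i + k) (j + l)" for i j k l :: int
  proof -
    have "?m i j * ?m k l = (h powi (i * j) * h powi (k * l)) *s (y powi i * (x powi j * y powi k) * x powi l)"
      by (simp add: mult.assoc)
    also have "\<dots> = (h powi (i * j) * h powi (k * l) * (h * h) powi (j * k)) *s
        (y powi (i + k) * x powi (j + l))"
      using xy q(1) by (subst q_commuting_power_int[OF qc]) (simp_all add: mult.assoc power_int_add)
    also have "h powi (i * j) * h powi (k * l) * (h * h) powi (j * k) =
        h powi (j * k - i * l) * h powi ((i + k) * (j + l))"
      using q(1) by (simp add: power_int_mult_distrib flip: power_int_add) (simp add: algebra_simps)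
    finally show ?thesis by simp
  qed
  define m where "m = ?m"
  have mult: "m i j * m k l = h powi (j * k - i * l) *s m (i + k) (j + l)" for i j k l
    unfolding m_def by (rule mult)
  let ?T = "span (range (case_prod m))"
  have m: "m i j \<in> ?T" for i j by (rule span_base) auto
  have left: "m i j * a \<in> ?T" if "a \<in> ?T" for i j a
    using that
  proof (induction rule: span_induct_alt)
    case base show ?case by (simp add: span_zero)
  next
    case (step c b a)
    then obtain k l where "b = m k l" by auto
    then show ?case
      using step.IH m by (auto simp: mult distrib_left intro!: span_add span_scale)
  qed
  have m1: "m 0 0 = 1" "m 0 1 = x" "m 1 0 = y" by (simp_all add: m_def)
  have "\<exists>a\<in>?T. \<exists>b\<in>?T. b \<noteq> 0 \<and> d * b = a" for d
    by (rule fractions_of_stable_subspace[OF D])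
      (use m[of 0 0] left[of _ 0 1] left[of _ 1 0] m1 in \<open>auto intro: span_add span_scale\<close>)
  then have "quantum_torus h m"
    unfolding quantum_torus_def using q(1) m1(1) mult by blast
  then show ?thesis by (simp only: m_def)
qed

lemma quantum_torus_change_of_basis:
  assumes m: "quantum_torus h m" and det: "a * d - b * c = 1"
  shows "quantum_torus h (\<lambda>i j. m (a * i + b * j) (c * i + d * j))"
proof -
  have "range (case_prod m) \<subseteq> range (\<lambda>(i, j). m (a * i + b * j) (c * i + d * j))"
  proof clarify
    fix i j
    have "a * (d * i - b * j) + b * (a * j - c * i) = (a * d - b * c) * i"
      "c * (d * i - b * j) + d * (a * j - c * i) = (a * d - b * c) * j"
        by (simp_all add: algebra_simps)
    then have "m i j = (\<lambda>(i, j). m (a * i + b * j) (c * i + d * j)) (d * i - b * j, a * j - c * i)"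
      using det by simp
    then show "m i j \<in> range (\<lambda>(i, j). m (a * i + b * j) (c * i + d * j))" by (rule range_eqI)
  qed
  then have "range (\<lambda>(i, j). m (a * i + b * j) (c * i + d * j)) = range (case_prod m)" by auto
  moreover have "m (a * i + b * j) (c * i + d * j) * m (a * k + b * l) (c * k + d * l) =
      h powi (j * k - i * l) *s m (a * (i + k) + b * (j + l)) (c * (i + k) + d * (j + l))" for i j k l
  proof -
    have "(c * i + d * j) * (a * k + b * l) - (a * i + b * j) * (c * k + d * l) = (a * d - b * c) * (j * k - i * l)"
      by (simp add: algebra_simps)
    then have "(c * i + d * j) * (a * k + b * l) - (a * i + b * j) * (c * k + d * l) = j * k - i * l"
      using det by simp
    moreover have "a * i + b * j + (a * k + b * l) = a * (i + k) + b * (j + l)"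
      "c * i + d * j + (c * k + d * l) = c * (i + k) + d * (j + l)" by (simp_all add: algebra_simps)
    ultimately show ?thesis using quantum_torusD(1)[OF m] by metis
  qed
  ultimately show ?thesis
    using m unfolding quantum_torus_def by simp
qed

text \<open>This is the involution theorem for \<open>\<epsilon> = 1\<close>, \<open>\<alpha> = 0\<close>, \<open>\<beta> = 1\<close>. Here \<open>w = b p\<close>, so \<open>p\<close> itself
  \<open>q\<close>-commutes with \<open>b\<close>.\<close>

theorem fixed_subalgebra_of_order_2:
  assumes m: "quantum_torus h m" and q: "\<forall>n::nat. n > 0 \<longrightarrow> (h * h) ^ n \<noteq> 1"
    and \<tau>: "alg_hom (*s) (*s) \<tau>" "\<And>i j. \<tau> (m i j) = m (- i) (- j)"
  defines "e \<equiv> inverse (m 1 0 - m (-1) 0)"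
  defines "b \<equiv> e * (m 0 1 - m 0 (-1))" and "p \<equiv> e * (m (-1) 0 * m 0 1 - m 1 0 * m 0 (-1))"
    and "r \<equiv> e * (m 1 0 * m 0 1 - m (-1) 0 * m 0 (-1))"
  shows "q_commuting (h * h) p b" "division_closure {p, b} = {r. \<tau> r = r}"
    "r * p = inverse (h * h) *s (b * b) - 1"
proof -
  note mD = quantum_torusD[OF m]
  have q0: "h * h \<noteq> 0" using mD(3) by simp
  have inv: "inverse (m 1 0) = m (-1) 0" "inverse (m 0 1) = m 0 (-1)" by (simp_all add: mD)
  have qc: "q_commuting (h * h) (m 0 1) (m 1 0)"
    using mD(3,4) by (simp add: q_commuting_def mD(1) power_int_minus)
  note F = fixed_subalgebra_of_involution[OF q0 q qc, of 1 \<tau> 0 1, simplified \<tau> inv, simplified]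
  have F': "q_commuting (h * h) (b * p) b" "division_closure {b * p, b} = {r. \<tau> r = r}"
    "r * p = inverse (h * h) *s (b * b) - 1"
    using F \<tau>(1) by (simp_all add: b_def p_def r_def e_def division_closure_quantum_torus[OF m] insert_commute[of "m 0 1"])
  have bp: "b \<noteq> 0" "p \<noteq> 0" using F'(1) by (auto simp: q_commuting_def)
  have "b * (p * b) = b * ((h * h) *s (b * p))" using F'(1)
    by (simp add: q_commuting_def mult.assoc)
  then have "b * (p * b - (h * h) *s (b * p)) = 0" by (simp add: right_diff_distrib)
  then show "q_commuting (h * h) p b" using bp by (simp add: q_commuting_def)
  have "p = inverse b * (b * p)" using bp by (simp flip: mult.assoc)
  then have "p \<in> division_closure {b * p, b}"
    by (metis division_closure.base division_closure.inverse division_closure.mult insertCI)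
  then have "division_closure {p, b} \<subseteq> division_closure {b * p, b}"
    by (intro division_closure_least division_subalgebra_closure)
      (auto intro: division_closure.base)
  moreover have "division_closure {b * p, b} \<subseteq> division_closure {p, b}"
    by (intro division_closure_least division_subalgebra_closure)
      (auto intro: division_closure.intros)
  ultimately show "division_closure {p, b} = {r. \<tau> r = r}" using F'(2) by simp
  show "r * p = inverse (h * h) *s (b * b) - 1" by (rule F')
qed

text \<open>The square of \<open>\<rho>\<close> inverts all monomials, so its fixed ring is generated by \<open>p\<close> and \<open>b\<close> as for order
  two. On these generators \<open>\<rho> b = - b\<^sup>-\<^sup>1\<close> and \<open>\<rho> p = (q b\<^sup>-\<^sup>1 - b) p\<^sup>-\<^sup>1\<close>, the latter by the relation for
  \<open>r p\<close>. This is an involution as above with \<open>\<epsilon> = -1\<close>, \<open>\<alpha> = -1\<close>, \<open>\<beta> = 0\<close>.\<close>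

theorem fixed_subalgebra_of_order_4:
  assumes m: "quantum_torus h m" and q: "\<forall>n::nat. n > 0 \<longrightarrow> (h * h) ^ n \<noteq> 1"
    and \<rho>: "alg_hom (*s) (*s) \<rho>" "\<And>i j. \<rho> (m i j) = m (- j) i"
  obtains u v where "q_commuting (h * h) u v" "division_closure {u, v} = {r. \<rho> r = r}"
proof -
  note mD = quantum_torusD[OF m]
  note \<rho>s = alg_homD[OF \<rho>(1)]
  have q0: "h * h \<noteq> 0" using mD(3) by simp
  have \<tau>: "alg_hom (*s) (*s) (\<rho> \<circ> \<rho>)" "(\<rho> \<circ> \<rho>) (m i j) = m (- i) (- j)" for i j
    by (auto simp: alg_hom_iff \<rho>s \<rho>(2))
  define e where "e = inverse (m 1 0 - m (-1) 0)"
  define f where "f = m 0 1 - m 0 (-1)"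
  define b where "b = e * f"
  define p where "p = e * (m (-1) 0 * m 0 1 - m 1 0 * m 0 (-1))"
  define r where "r = e * (m 1 0 * m 0 1 - m (-1) 0 * m 0 (-1))"
  have T: "q_commuting (h * h) p b" "division_closure {p, b} = {r. (\<rho> \<circ> \<rho>) r = r}"
      "r * p = inverse (h * h) *s (b * b) - 1"
    unfolding r_def p_def b_def e_def f_def by - (rule fixed_subalgebra_of_order_2[where m = m and \<tau> = "\<rho> \<circ> \<rho>", OF m q \<tau>])+
  have bp: "b \<noteq> 0" "p \<noteq> 0" using T(1) by (auto simp: q_commuting_def)
  have ef: "e \<noteq> 0" "f \<noteq> 0" using bp by (auto simp: b_def)
  have \<rho>ie: "\<rho> (inverse e) = f" and \<rho>f: "\<rho> f = - inverse e"
    by (simp_all add: e_def f_def \<rho>s(7) \<rho>(2))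
  have \<rho>e: "\<rho> e = inverse f" using \<rho>ie by (simp add: \<rho>s(8)) (metis inverse_inverse_eq)
  have ib: "inverse b = inverse f * inverse e" using ef
    by (simp add: b_def nonzero_inverse_mult_distrib)
  have \<rho>b: "\<rho> b = - inverse b" by (simp add: b_def[THEN arg_cong, of \<rho>] \<rho>s(3) \<rho>e \<rho>f ib)
  have "\<rho> p = inverse f * (m 0 (-1) * m (-1) 0 - m 0 1 * m 1 0)"
    by (simp add: p_def \<rho>s(3,7) \<rho>e \<rho>(2))
  also have "m 0 (-1) * m (-1) 0 - m 0 1 * m 1 0 = - ((h * h) *s (m 1 0 * m 0 1 - m (-1) 0 * m 0 (-1)))"
    using mD(3) by (simp add: mD(1) power_int_minus scale_right_diff_distrib mult.assoc)
  also have "m 1 0 * m 0 1 - m (-1) 0 * m 0 (-1) = inverse e * r"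
    using ef by (simp add: r_def flip: mult.assoc)
  finally have "\<rho> p = - ((h * h) *s (inverse b * r))" by (simp add: ib mult.assoc)
  then have "\<rho> p * p = - ((h * h) *s (inverse b * (inverse (h * h) *s (b * b) - 1)))"
    using T(3) by (simp add: mult.assoc)
  also have "\<dots> = (h * h) *s inverse b - b"
  proof -
    have "inverse b * (b * b) = b" using bp by (simp flip: mult.assoc)
    moreover have "(h * h) * inverse (h * h) = 1" by (rule right_inverse[OF q0])
    ultimately show ?thesis
      by (simp only: right_diff_distrib scale_out scale_right_diff_distrib scale_scale scale_one mult_1_right)
        simp
  qed
  also have "\<dots> = - 1 *s (b + ((- 1) * (h * h)) *s inverse b) + 0 *s 1"
    by (simp add: scale_right_distrib)
  finally have "\<rho> p = (- 1 *s (b + ((- 1) * (h * h)) *s inverse b) + 0 *s 1) * inverse p"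
    using bp by (metis mult.assoc mult_1_right right_inverse)
  moreover have "\<rho> b = (- 1) *s inverse b" using \<rho>b by simp
  ultimately obtain u v where "q_commuting (h * h) u v" "division_closure {u, v} = {r \<in> division_closure {p, b}. \<rho> r = r}"
    using fixed_subalgebra_of_involution(1,2)[OF q0 q T(1) _ \<rho>(1), of "-1" "-1" 0] by blast
  moreover have "{r \<in> division_closure {p, b}. \<rho> r = r} = {r. \<rho> r = r}" unfolding T(2) by auto
  ultimately show ?thesis using that by simp
qed

text \<open>The automorphism \<open>\<tau>\<close> exchanges the resolvents of the monomials and of their inverses, so it inverts
  \<open>u\<close> and \<open>v\<close>. With \<open>p = u - \<omega> v\<close>, \<open>p' = u - \<omega>\<^sup>2 v\<close> the ratio \<open>r = p p'\<^sup>-\<^sup>1\<close> is mapped to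
  \<open>\<omega>\<^sup>2 q\<^sup>-\<^sup>1 r\<^sup>-\<^sup>1\<close>, and the rescaled ratio \<open>\<omega>\<^sup>2 h r\<close> to its inverse. Together with \<open>p'\<^sup>-\<^sup>1\<close> it
  generates the fixed ring of \<open>\<sigma>\<close>, and \<open>\<tau>\<close> acts on this pair as an involution of the shape treated
  above with \<open>\<epsilon> = 1\<close>, \<open>\<alpha> = \<omega> h\<^sup>-\<^sup>1 / 3\<close>, \<open>\<beta> = \<omega> / 3\<close>.\<close>

theorem fixed_subalgebra_of_order_6:
  fixes \<omega> :: 'k
  assumes m: "quantum_torus h m" and q: "\<forall>n::nat. n > 0 \<longrightarrow> (h * h) ^ n \<noteq> 1"
    and \<omega>: "\<omega> ^ 3 = 1" "\<omega> \<noteq> 1"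
    and \<sigma>: "alg_hom (*s) (*s) \<sigma>" "\<And>i j. \<sigma> (m i j) = m (- j) (i - j)"
    and \<tau>: "alg_hom (*s) (*s) \<tau>" "\<And>i j. \<tau> (m i j) = m (- i) (- j)"
  obtains w z where "q_commuting (h * h) w z" "division_closure {w, z} = {r. \<sigma> r = r \<and> \<tau> r = r}"
proof -
  note mD = quantum_torusD[OF m]
  note \<tau>s = alg_homD[OF \<tau>(1)]
  have q0: "h * h \<noteq> 0" and h0: "h \<noteq> 0" using mD(3) by simp_all
  note ww = primitive_cube_root_square(1)[OF \<omega>] and wwc = primitive_cube_root_square(2)[OF \<omega>]
  have w2: "\<omega>^2 = - \<omega> - 1" using ww by (simp add: power2_eq_square)
  have w0: "\<omega> \<noteq> 0" "\<omega>^2 \<noteq> \<omega>" "\<omega>^2 \<noteq> 0" using \<omega> by (auto simp: power2_eq_square)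
  have wi: "inverse \<omega> = \<omega>^2"
    by (rule inverse_unique) (use \<omega>(1) in \<open>simp add: power2_eq_square power3_eq_cube mult.assoc\<close>)
  let ?b = "lagrange_resolvent (\<lambda>i j. m (-i) (-j))"
  define u where "u = inverse (lagrange_resolvent m \<omega>) * ?b \<omega>"
  define v where "v = inverse (lagrange_resolvent m (\<omega>^2)) * ?b (\<omega>^2)"
  define p where "p = u - \<omega> *s v"
  define p' where "p' = u - \<omega>^2 *s v"
  have T: "q_commuting (h * h) p p'" "division_closure {p, p'} = {r. \<sigma> r = r}"
    unfolding p_def p'_def u_def v_def by - (rule fixed_subalgebra_of_order_3[where m = m and \<sigma> = \<sigma>, OF m q \<omega> \<sigma>])+
  have p0: "p \<noteq> 0" "p' \<noteq> 0" and pp': "p * p' = (h * h) *s (p' * p)"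
    using T(1) unfolding q_commuting_def by blast+
  have \<tau>res: "\<tau> (lagrange_resolvent m s) = ?b s" "\<tau> (?b s) = lagrange_resolvent m s" for s
    by (simp_all add: lagrange_resolvent_def \<tau> \<tau>s)
  have res0: "lagrange_resolvent m s \<noteq> 0" "?b s \<noteq> 0" for s
    using lagrange_resolvent_nonzero[OF m q, of s] \<tau>s(9)[of "lagrange_resolvent m s"] \<tau>res(1)[of s]
    by metis+
  have uv0: "u \<noteq> 0" "v \<noteq> 0" using res0 by (simp_all add: u_def v_def)
  have \<tau>uv: "\<tau> u = inverse u" "\<tau> v = inverse v"
    using res0 by (simp_all add: u_def v_def \<tau>s \<tau>res nonzero_inverse_mult_distrib)
  define k where "k = inverse u"
  define l where "l = inverse v"
  have kl: "u * k = 1" "k * u = 1" "v * l = 1" "l * v = 1" "u * (k * c) = c" "k * (u * c) = c"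
      "v * (l * c) = c" "l * (v * c) = c" for c
    using uv0 by (simp_all add: k_def l_def flip: mult.assoc)
  have \<tau>p: "\<tau> p = - (\<omega> *s (k * p' * l))"
    unfolding p_def p'_def \<tau>s \<tau>uv k_def[symmetric] l_def[symmetric]
    using \<omega>(1) by (simp add: algebra_simps kl power2_eq_square power3_eq_cube)
  have \<tau>p': "\<tau> p' = - (\<omega>^2 *s (k * p * l))"
    unfolding p_def p'_def \<tau>s \<tau>uv k_def[symmetric] l_def[symmetric]
    using \<omega>(1) by (simp add: algebra_simps kl power2_eq_square power3_eq_cube)
  define P where "P = inverse p"
  define P' where "P' = inverse p'"
  have PP: "p * P = 1" "P * p = 1" "p' * P' = 1" "P' * p' = 1" "p * (P * c) = c" "P * (p * c) = c"
      "p' * (P' * c) = c" "P' * (p' * c) = c" for c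
    using p0 by (simp_all add: P_def P'_def flip: mult.assoc)
  have u: "u = inverse (\<omega> - 1) *s (\<omega> *s p - p')" and v: "v = inverse (\<omega>^2 - \<omega>) *s (p - p')"
  proof -
    have "\<omega> *s p - p' = (\<omega> - 1) *s u" by (simp add: p_def p'_def algebra_simps power2_eq_square)
    then show "u = inverse (\<omega> - 1) *s (\<omega> *s p - p')" using \<omega>(2) by simp
    have "p - p' = (\<omega>^2 - \<omega>) *s v" by (simp add: p_def p'_def algebra_simps)
    then show "v = inverse (\<omega>^2 - \<omega>) *s (p - p')" using w0 by simp
  qed
  define r where "r = p * P'"
  define r' where "r' = p' * P"
  have rr': "inverse r = r'" using p0
    by (simp add: r_def r'_def P_def P'_def nonzero_inverse_mult_distrib)
  have p'P: "p' * P = (h * h) *s (P * p')"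
  proof -
    have "p' * P = P * (p * p') * P" by (simp add: mult.assoc PP)
    also have "\<dots> = (h * h) *s (P * p')" unfolding pp' by (simp add: mult.assoc PP)
    finally show ?thesis .
  qed
  have r'u: "(h * h) *s (r' * u) = u * r'"
  proof -
    have "(h * h) *s (r' * (\<omega> *s p - p')) = (\<omega> *s p - p') * r'"
    proof -
      have "p * (p' * P) = (h * h) *s p'" unfolding p'P by (simp add: PP)
      moreover have "p' * (p' * P) = (h * h) *s (p' * (P * p'))" by (subst p'P) simp
      ultimately show ?thesis
        by (simp add: r'_def right_diff_distrib left_diff_distrib mult.assoc PP scale_right_diff_distrib
            mult.commute[of \<omega>])
    qed
    from arg_cong[OF this, of "\<lambda>t. inverse (\<omega> - 1) *s t"] show ?thesis
      unfolding u by (simp add: mult.commute[of "inverse (\<omega> - 1)"])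
  qed
  have \<tau>r: "\<tau> r = (\<omega>^2 * inverse (h * h)) *s r'"
  proof -
    have "\<tau> r = \<tau> p * inverse (\<tau> p')" by (simp add: r_def P'_def \<tau>s)
    also have "\<tau> p = \<omega>^2 *s (k * r' * u * \<tau> p')"
      unfolding \<tau>p \<tau>p' r'_def
      using \<omega>(1) w0 by (simp add: mult.assoc kl PP power2_eq_square power3_eq_cube)
    also have "\<omega>^2 *s (k * r' * u * \<tau> p') * inverse (\<tau> p') = \<omega>^2 *s (k * (r' * u))"
      using p0 \<tau>s(9)[of p'] by (simp add: mult.assoc)
    also have "r' * u = inverse (h * h) *s (u * r')" using r'u q0
      by (metis scale_scale left_inverse scale_one)
    finally show ?thesis by (simp add: kl)
  qed
  define y where "y = (\<omega>^2 * h) *s r"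
  have iy: "inverse y = (\<omega> * inverse h) *s r'"
    unfolding y_def inverse_scale rr' using wi by (metis inverse_inverse_eq inverse_mult_distrib)
  have \<tau>y: "\<tau> y = 1 *s inverse y"
    unfolding iy unfolding y_def \<tau>s \<tau>r using \<omega>(1) h0
    by (simp add: power2_eq_square power3_eq_cube field_simps)
  have xy: "q_commuting (h * h) P' y"
  proof -
    have "P' * p = (h * h) *s (p * P')"
    proof -
      have "P' * p = P' * (p * p') * P'" by (simp add: mult.assoc PP)
      also have "\<dots> = (h * h) *s (p * P')" unfolding pp' by (simp add: mult.assoc PP)
      finally show ?thesis .
    qed
    from arg_cong[OF this, of "\<lambda>t. t * P'"] have "P' * r = (h * h) *s (r * P')"
      by (simp add: r_def mult.assoc)
    moreover have "P' \<noteq> 0" "r \<noteq> 0" using p0 by (simp_all add: P'_def r_def)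
    ultimately show ?thesis
      using w0(1) h0 by (simp add: q_commuting_def y_def mult.commute)
  qed
  have \<tau>x: "\<tau> P' = ((\<omega> * inverse h * inverse 3) *s (y + (1 * (h * h)) *s inverse y) + (\<omega> * inverse 3) *s 1) * inverse P'"
  proof -
    have "\<tau> P' = inverse (\<tau> p')" by (simp add: P'_def \<tau>s)
    also have "\<dots> = - (\<omega> *s (v * P * u))"
    proof (rule inverse_unique)
      show "\<tau> p' * - (\<omega> *s (v * P * u)) = 1"
        unfolding \<tau>p' using \<omega>(1) by (simp add: mult.assoc kl PP power2_eq_square power3_eq_cube)
    qed
    also have "\<dots> = (- \<omega> * inverse (\<omega>^2 - \<omega>) * inverse (\<omega> - 1)) *s ((p - p') * P * (\<omega> *s p - p'))"
      unfolding u v by (simp add: mult.assoc)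
    also have "- \<omega> * inverse (\<omega>^2 - \<omega>) * inverse (\<omega> - 1) = \<omega>^2 * inverse 3"
    proof -
      have "(\<omega>^2 - \<omega>) * (\<omega> - 1) * \<omega>^2 = - \<omega> * 3"
        unfolding w2 by (simp add: algebra_simps ww wwc)
      moreover have "- w * inverse A * inverse B = c * inverse 3"
        if "A * B * c = - w * 3" "A \<noteq> 0" "B \<noteq> 0" for A B c w :: 'k
      proof -
        have "- w = A * B * c * inverse 3" using that(1) by simp
        then have "- w * inverse A * inverse B = (A * inverse A) * (B * inverse B) * (c * inverse 3)"
          by (simp only: mult_ac)
        then show ?thesis using that(2,3) by simp
      qed
      ultimately show ?thesis using w0 \<omega>(2) by simp
    qed
    also have "(p - p') * P * (\<omega> *s p - p') = \<omega> *s p - (\<omega> + 1) *s p' + r' * p'"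
      by (simp add: r'_def algebra_simps PP scale_left_distrib)
    also have "\<omega> + 1 = - (\<omega>^2)" using w2 by simp
    also have "(\<omega>^2 * inverse 3) *s (\<omega> *s p - - (\<omega>^2) *s p' + r' * p') =
       inverse 3 *s (p + \<omega>^2 *s (r' * p') + \<omega> *s p')"
    proof -
      have "\<omega>^2 * \<omega> = 1" "\<omega>^2 * \<omega>^2 = \<omega>" using \<omega>(1)
        by (simp_all add: power2_eq_square power3_eq_cube mult.assoc)
      then show ?thesis by (simp add: scale_right_distrib mult.commute[of _ "inverse 3"] mult.assoc add_ac)
    qed
    also have "p = r * p'" by (simp add: r_def mult.assoc PP)
    also have "inverse 3 *s (r * p' + \<omega>^2 *s (r' * p') + \<omega> *s p') =
        ((\<omega> * inverse h * inverse 3) *s (y + (1 * (h * h)) *s inverse y) + (\<omega> * inverse 3) *s 1) * p'"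
    proof -
      have "\<omega> * inverse h * inverse 3 * (\<omega>^2 * h) = inverse 3"
        "\<omega> * inverse h * inverse 3 * (h * h * (\<omega> * inverse h)) = inverse 3 * \<omega>^2"
        using \<omega>(1) h0 by (simp_all add: field_simps power2_eq_square power3_eq_cube)
      then show ?thesis
        unfolding iy unfolding y_def
        by (simp add: scale_right_distrib distrib_right mult.commute[of _ "inverse 3"])
    qed
    finally show ?thesis by (simp add: P'_def)
  qed
  have gen: "division_closure {P', y} = division_closure {p, p'}"
  proof
    show "division_closure {P', y} \<subseteq> division_closure {p, p'}"
      unfolding y_def r_def P'_def by (intro division_closure_least division_subalgebra_closure)
        (auto intro!: division_closure.scale division_closure.mult division_closure.inverse intro: division_closure.base)
    have "y * inverse P' = (\<omega>^2 * h) *s p"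
      by (simp add: P'_def y_def r_def mult.assoc PP[unfolded P'_def])
    then have "p = inverse (\<omega>^2 * h) *s (y * inverse P')"
      using w0 h0 by (simp only: scale_scale left_inverse mult_eq_0_iff scale_one simp_thms)
    moreover have "p' = inverse P'" by (simp add: P'_def)
    ultimately have "p' \<in> division_closure {P', y}" "p \<in> division_closure {P', y}"
      by (metis division_closure.base division_closure.inverse insertCI, metis division_closure.base division_closure.inverse division_closure.scale division_closure.mult insertCI)
    then show "division_closure {p, p'} \<subseteq> division_closure {P', y}"
      by (intro division_closure_least division_subalgebra_closure) auto
  qed
  obtain w z where "q_commuting (h * h) w z" "division_closure {w, z} = {r \<in> division_closure {P', y}. \<tau> r = r}"
    using fixed_subalgebra_of_involution(1,2)[OF q0 q xy _ \<tau>(1) \<tau>y \<tau>x] by blast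
  then show ?thesis using that gen T(2) by simp
qed

end

section \<open>Finite subgroups of SL2(Z)\<close>

lemma small_residue:
  fixes A B :: int assumes "A \<noteq> 0"
  obtains k where "\<bar>B + 2 * A * k\<bar> \<le> \<bar>A\<bar>"
proof -
  define r where "r = (B + \<bar>A\<bar>) mod (2 * \<bar>A\<bar>)"
  have r: "0 \<le> r" "r < 2 * \<bar>A\<bar>" using assms by (simp_all add: r_def)
  have "B + \<bar>A\<bar> = 2 * \<bar>A\<bar> * ((B + \<bar>A\<bar>) div (2 * \<bar>A\<bar>)) + r" by (simp add: r_def)
  moreover have "2 * A * (- sgn A * s) = - (2 * \<bar>A\<bar> * s)" for s by (simp add: abs_sgn algebra_simps)
  ultimately have "B + 2 * A * (- sgn A * ((B + \<bar>A\<bar>) div (2 * \<bar>A\<bar>))) = r - \<bar>A\<bar>"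
    by (metis add_diff_cancel_right' diff_conv_add_uminus add.commute diff_diff_eq2)
  then show ?thesis using r by (intro that[of "- sgn A * ((B + \<bar>A\<bar>) div (2 * \<bar>A\<bar>))"]) linarith
qed

text \<open>Gauss reduction. If \<open>|A| > 1\<close>, a shear makes \<open>|B| \<le> |A|\<close>; the discriminant then forces the last
  coefficient to be smaller than \<open>A\<close> in absolute value, and the two outer coefficients are exchanged.\<close>

lemma form_represents_unit:
  fixes A B C :: int
  assumes "B\<^sup>2 - 4 * A * C = - 3 \<or> B\<^sup>2 - 4 * A * C = - 4"
  shows "\<exists>p r. \<bar>A * p\<^sup>2 + B * p * r + C * r\<^sup>2\<bar> = 1"
  using assms
proof (induction "nat \<bar>A\<bar>" arbitrary: A B C rule: less_induct)
  case less
  have "A \<noteq> 0"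
  proof
    assume "A = 0"
    then have "B\<^sup>2 = - 3 \<or> B\<^sup>2 = - 4" using less.prems by simp
    then show False using zero_le_power2[of B] by linarith
  qed
  show ?case
  proof (cases "\<bar>A\<bar> = 1")
    case True then show ?thesis by (intro exI[of _ 1] exI[of _ 0]) simp
  next
    case False
    then have A2: "\<bar>A\<bar> \<ge> 2" using \<open>A \<noteq> 0\<close> by linarith
    obtain k where k: "\<bar>B + 2 * A * k\<bar> \<le> \<bar>A\<bar>" using small_residue[OF \<open>A \<noteq> 0\<close>] .
    define B' where "B' = B + 2 * A * k"
    define C' where "C' = A * k\<^sup>2 + B * k + C"
    have disc: "B'\<^sup>2 - 4 * A * C' = B\<^sup>2 - 4 * A * C"
      by (simp add: B'_def C'_def power2_eq_square algebra_simps)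
    have "\<bar>C'\<bar> < \<bar>A\<bar>"
    proof (rule ccontr)
      assume "\<not> \<bar>C'\<bar> < \<bar>A\<bar>"
      then have "\<bar>A\<bar> * \<bar>A\<bar> \<le> \<bar>A\<bar> * \<bar>C'\<bar>" by (intro mult_left_mono) auto
      moreover have "4 * (A * C') = B'\<^sup>2 + 3 \<or> 4 * (A * C') = B'\<^sup>2 + 4" using less.prems disc
        by auto
      moreover from this have "0 \<le> A * C'" using zero_le_power2[of B'] by linarith
      then have "\<bar>A\<bar> * \<bar>C'\<bar> = A * C'" by (simp flip: abs_mult)
      ultimately have "4 * (\<bar>A\<bar> * \<bar>C'\<bar>) \<le> B'\<^sup>2 + 4" "\<bar>A\<bar> * \<bar>A\<bar> \<le> \<bar>A\<bar> * \<bar>C'\<bar>" by auto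
      moreover have "B'\<^sup>2 \<le> \<bar>A\<bar> * \<bar>A\<bar>" using k power_mono[OF k, of 2]
        by (simp add: B'_def power2_eq_square)
      moreover have "2 * 2 \<le> \<bar>A\<bar> * \<bar>A\<bar>" using A2 by (intro mult_mono) auto
      ultimately show False by linarith
    qed
    moreover have "(- B')\<^sup>2 - 4 * C' * A = - 3 \<or> (- B')\<^sup>2 - 4 * C' * A = - 4"
      using less.prems disc by (simp add: mult.commute mult.left_commute)
    ultimately obtain p r where pr: "\<bar>C' * p\<^sup>2 + - B' * p * r + A * r\<^sup>2\<bar> = 1"
      using less.hyps[of C' "- B'" A] \<open>A \<noteq> 0\<close> by auto
    have "A * (k * p - r)\<^sup>2 + B * (k * p - r) * p + C * p\<^sup>2 = C' * p\<^sup>2 + - B' * p * r + A * r\<^sup>2"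
      by (simp add: B'_def C'_def power2_eq_square algebra_simps)
    then show ?thesis using pr by metis
  qed
qed

text \<open>A vector \<open>(p, r)\<close> that forms a basis of \<open>\<int>\<^sup>2\<close> together with its image under the matrix. The
  determinant of the two vectors is a quadratic form in \<open>(p, r)\<close> of discriminant \<open>(a + d)\<^sup>2 - 4\<close>.\<close>

lemma cyclic_vector:
  fixes a b c d :: int
  assumes det: "a * d - b * c = 1" and tr: "\<bar>a + d\<bar> \<le> 1"
  shows "\<exists>p r. \<bar>p * (c * p + d * r) - r * (a * p + b * r)\<bar> = 1"
proof -
  have "(d - a)\<^sup>2 - 4 * c * (- b) = (a + d)\<^sup>2 - 4 * (a * d - b * c)"
    by (simp add: power2_eq_square algebra_simps)
  moreover have "(a + d)\<^sup>2 = 0 \<or> (a + d)\<^sup>2 = 1"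
    using tr by (auto simp: abs_le_iff power2_eq_1_iff)
  ultimately have "(d - a)\<^sup>2 - 4 * c * (- b) = - 3 \<or> (d - a)\<^sup>2 - 4 * c * (- b) = - 4" using det
    by auto
  then obtain p r where "\<bar>c * p\<^sup>2 + (d - a) * p * r + - b * r\<^sup>2\<bar> = 1" using form_represents_unit
    by blast
  then show ?thesis by (intro exI[of _ p] exI[of _ r]) (simp add: power2_eq_square algebra_simps)
qed

text \<open>For a matrix \<open>g\<close> of determinant one, the numbers \<open>a + d\<close> and \<open>b - c\<close> are the traces of \<open>g\<close> and of
  \<open>\<rho> g\<close>, where \<open>\<rho>\<close> is the rotation of order four. They determine the complex linear part of \<open>g\<close>, whose
  squared norm exceeds that of the antilinear part by the determinant.\<close>

lemma trace_bound_4: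
  fixes a b c d :: int
  assumes "a * d - b * c = 1" "\<bar>a + d\<bar> \<le> 1" "\<bar>b - c\<bar> \<le> 1"
  shows False
proof -
  have "(a + d)\<^sup>2 + (b - c)\<^sup>2 = a\<^sup>2 + b\<^sup>2 + c\<^sup>2 + d\<^sup>2 + 2 * (a * d - b * c)"
    by (simp add: power2_eq_square algebra_simps)
  moreover have "(a + d)\<^sup>2 \<le> 1" "(b - c)\<^sup>2 \<le> 1" using assms by (simp_all add: abs_square_le_1)
  moreover have "X + Y = S + 2 * E \<Longrightarrow> X \<le> 1 \<Longrightarrow> Y \<le> 1 \<Longrightarrow> E = 1 \<Longrightarrow> S \<le> 0" for X Y S E :: int by linarith
  ultimately have "a\<^sup>2 + b\<^sup>2 + c\<^sup>2 + d\<^sup>2 \<le> 0" using assms(1) by blast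
  then have "a\<^sup>2 \<le> 0" "b\<^sup>2 \<le> 0"
    using zero_le_power2[of a] zero_le_power2[of b] zero_le_power2[of c] zero_le_power2[of d] by linarith+
  then show False using assms(1) by simp
qed

text \<open>The same with the three powers of the standard matrix of order three: the numbers are the traces
  of \<open>g\<close>, \<open>\<sigma> g\<close> and \<open>\<sigma>\<^sup>2 g\<close>.\<close>

lemma trace_bound_3:
  fixes a b c d :: int
  assumes "a * d - b * c = 1" "\<bar>a + d\<bar> \<le> 1" "\<bar>b - c - d\<bar> \<le> 1" "\<bar>c - a - b\<bar> \<le> 1"
  shows False
proof -
  have "2 * ((a + d)\<^sup>2 + (b - c - d)\<^sup>2 + (c - a - b)\<^sup>2) =
      12 * (a * d - b * c) + ((2 * (a - d) + (b - c))\<^sup>2 + 3 * (b + c)\<^sup>2)"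
    by (simp add: power2_eq_square algebra_simps)
  moreover have "(a + d)\<^sup>2 \<le> 1" "(b - c - d)\<^sup>2 \<le> 1" "(c - a - b)\<^sup>2 \<le> 1"
    using assms by (simp_all add: abs_square_le_1)
  moreover have False if "2 * (X + Y + Z) = 12 * E + (U + 3 * V)" "X \<le> 1" "Y \<le> 1" "Z \<le> 1" "E = 1"
      "0 \<le> U" "0 \<le> V" for X Y Z E U V :: int using that by presburger
  ultimately show False using assms(1) zero_le_power2 by blast
qed

text \<open>The second kind polynomials \<open>U\<^sub>n\<^sub>-\<^sub>1(t / 2)\<close>: a matrix \<open>M\<close> of trace \<open>t\<close> and determinant one satisfies
  \<open>M\<^sup>n\<^sup>+\<^sup>1 = chebyshev t (n + 1) M - chebyshev t n\<close>.\<close>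

fun chebyshev :: "int \<Rightarrow> nat \<Rightarrow> int" where
  "chebyshev t 0 = 0"
| "chebyshev t (Suc 0) = 1"
| "chebyshev t (Suc (Suc n)) = t * chebyshev t (Suc n) - chebyshev t n"

lemma chebyshev_growth:
  assumes "2 \<le> \<bar>t\<bar>" shows "\<bar>chebyshev t n\<bar> < \<bar>chebyshev t (Suc n)\<bar>"
proof (induction n)
  case (Suc n)
  have "2 * \<bar>chebyshev t (Suc n)\<bar> \<le> \<bar>t * chebyshev t (Suc n)\<bar>"
    unfolding abs_mult using assms by (intro mult_right_mono) auto
  then show ?case using Suc by simp
qed simp

context division_algebra_char_0 begin

text \<open>The matrix with rows \<open>(a, b)\<close> and \<open>(c, d)\<close> acts on column vectors of exponents.\<close>

definition acts_by :: "(int \<Rightarrow> int \<Rightarrow> 'd) \<Rightarrow> ('d \<Rightarrow> 'd) \<Rightarrow> int \<Rightarrow> int \<Rightarrow> int \<Rightarrow> int \<Rightarrow> bool" where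
  "acts_by m f a b c d \<longleftrightarrow> a * d - b * c = 1 \<and> (\<forall>i j. f (m i j) = m (a * i + b * j) (c * i + d * j))"

lemma acts_by_comp:
  assumes "acts_by m f a b c d" "acts_by m g a' b' c' d'"
  shows "acts_by m (f \<circ> g) (a * a' + b * c') (a * b' + b * d') (c * a' + d * c') (c * b' + d * d')"
proof -
  have "(a * a' + b * c') * (c * b' + d * d') - (a * b' + b * d') * (c * a' + d * c') =
     (a * d - b * c) * (a' * d' - b' * c')" by (simp add: algebra_simps)
  then show ?thesis using assms by (simp add: acts_by_def) (simp add: algebra_simps)
qed

lemma quantum_torus_injective:
  assumes m: "quantum_torus h m" and q: "\<forall>n::nat. n > 0 \<longrightarrow> (h * h) ^ n \<noteq> 1" and eq: "m i j = m k l"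
  shows "i = k" "j = l"
proof -
  note mD = quantum_torusD[OF m]
  have h2: "h * h \<noteq> 0" using mD(3) by simp
  have com: "m r s * m i j = (h * h) powi (s * i - r * j) *s (m i j * m r s)" for r s i j
    unfolding mD(1) using mD(3)
    by (simp add: power_int_mult_distrib add.commute flip: power_int_add) (simp add: algebra_simps)
  have "s * i - r * j = s * k - r * l" for r s
  proof -
    have "(h * h) powi (s * i - r * j) *s (m i j * m r s) = (h * h) powi (s * k - r * l) *s (m i j * m r s)"
      using com[of r s i j] com[of r s k l] eq by metis
    then have "(h * h) powi (s * i - r * j) = (h * h) powi (s * k - r * l)" using mD(4) by simp
    then show ?thesis using injD[OF inj_power_int[OF h2 q], of "s * i - r * j" "s * k - r * l"]
      by simp
  qed
  from this[of 0 1] this[of 1 0] show "i = k" "j = l" by auto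
qed

text \<open>If \<open>|a + d| \<ge> 2\<close>, the coefficient of \<open>M\<close> in \<open>M\<^sup>n\<close> grows with \<open>n\<close> and does not vanish, so \<open>M\<^sup>n = 1\<close>
  makes \<open>M\<close> a scalar matrix.\<close>

lemma small_trace:
  assumes m: "quantum_torus h m" and q: "\<forall>n::nat. n > 0 \<longrightarrow> (h * h) ^ n \<noteq> 1"
    and f: "acts_by m f a b c d" and fin: "f ^^ n = id" "n > 0"
  shows "\<bar>a + d\<bar> \<le> 1 \<or> (b = 0 \<and> c = 0 \<and> a = d \<and> (a = 1 \<or> a = -1))"
proof (rule disjCI, rule ccontr)
  assume not: "\<not> (b = 0 \<and> c = 0 \<and> a = d \<and> (a = 1 \<or> a = -1))" and "\<not> \<bar>a + d\<bar> \<le> 1"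
  then have t: "2 \<le> \<bar>a + d\<bar>" by linarith
  have det: "a * d - b * c = 1" using f by (simp add: acts_by_def)
  let ?U = "chebyshev (a + d)"
  have pow: "(f ^^ Suc n) (m i j) = m (?U (Suc n) * (a * i + b * j) - ?U n * i) (?U (Suc n) * (c * i + d * j) - ?U n * j)"
    for n i j
  proof (induction n)
    case (Suc n)
    have "(f ^^ Suc (Suc n)) (m i j) = f ((f ^^ Suc n) (m i j))" by simp
    also have "\<dots> = m (a * (?U (Suc n) * (a * i + b * j) - ?U n * i) + b * (?U (Suc n) * (c * i + d * j) - ?U n * j))
       (c * (?U (Suc n) * (a * i + b * j) - ?U n * i) + d * (?U (Suc n) * (c * i + d * j) - ?U n * j))"
      unfolding Suc using f by (simp add: acts_by_def)
    also have "a * (?U (Suc n) * (a * i + b * j) - ?U n * i) + b * (?U (Suc n) * (c * i + d * j) - ?U n * j) =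
       ?U (Suc (Suc n)) * (a * i + b * j) - ?U (Suc n) * ((a * d - b * c) * i)" by (simp add: algebra_simps)
    also have "c * (?U (Suc n) * (a * i + b * j) - ?U n * i) + d * (?U (Suc n) * (c * i + d * j) - ?U n * j) =
       ?U (Suc (Suc n)) * (c * i + d * j) - ?U (Suc n) * ((a * d - b * c) * j)" by (simp add: algebra_simps)
    finally show ?case using det by simp
  qed (use f in \<open>simp add: acts_by_def\<close>)
  obtain k where k: "n = Suc k" using fin(2) by (cases n) auto
  have id: "(f ^^ Suc k) (m i j) = m i j" for i j using fin(1) k by simp
  have inj: "?U (Suc k) * (a * i + b * j) - ?U k * i = i" "?U (Suc k) * (c * i + d * j) - ?U k * j = j" for i j
    using quantum_torus_injective[OF m q] id[of i j, unfolded pow] by blast+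
  have U: "?U (Suc k) \<noteq> 0" using chebyshev_growth[OF t, of k] by auto
  have "?U (Suc k) * a - ?U k = 1" "?U (Suc k) * c = 0" "?U (Suc k) * b = 0" "?U (Suc k) * d - ?U k = 1"
    using inj[of 1 0] inj[of 0 1] by simp_all
  moreover from this have "?U (Suc k) * a = ?U (Suc k) * d" by linarith
  ultimately have "c = 0" "b = 0" "a = d" using U by simp_all
  moreover from this have "a * a = 1" using det by simp
  ultimately show False using not by (simp add: square_eq_1_iff)
qed

lemma finite_order:
  assumes "finite G" "id \<in> G" "\<And>f g. f \<in> G \<Longrightarrow> g \<in> G \<Longrightarrow> f \<circ> g \<in> G" "f \<in> G" "inj (f :: 'd \<Rightarrow> 'd)"
  obtains n where "n > 0" "f ^^ n = id"
proof -
  have "f ^^ n \<in> G" for n by (induction n) (simp_all only: funpow.simps assms)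
  then have "range (\<lambda>n. f ^^ n) \<subseteq> G" by auto
  then have "\<not> inj (\<lambda>n. f ^^ n)" using assms(1) finite_subset finite_imageD infinite_UNIV_nat
    by blast
  then obtain i j where "f ^^ i = f ^^ j" "i < j" by (metis linorder_injI)
  then have "(f ^^ i) ((f ^^ (j - i)) z) = (f ^^ i) z" for z
    by (metis add.commute comp_apply funpow_add le_add_diff_inverse2 less_imp_le)
  moreover have "inj (f ^^ i)" using assms(5) by (rule inj_fn)
  ultimately have "(f ^^ (j - i)) z = z" for z by (metis injD)
  then show ?thesis using that[of "j - i"] \<open>i < j\<close> by (auto simp: fun_eq_iff)
qed

lemma alg_hom_eq_on_torus:
  assumes "quantum_torus h m" "alg_hom (*s) (*s) f" "alg_hom (*s) (*s) g" "\<And>i j. f (m i j) = g (m i j)"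
  shows "f r = g r"
  using alg_hom_eq_on_division_closure[OF assms(2,3), of "{m 1 0, m 0 1}" r] assms(4) division_closure_quantum_torus[OF assms(1)]
  by auto

text \<open>If some element has trace \<open>0\<close>, a change of basis and possibly passing to its inverse turn it into the
  rotation \<open>\<rho>\<close> of order four; by the trace bound, for every \<open>g\<close> in the group one of \<open>g\<close> and \<open>\<rho> g\<close> is
  \<open>\<plusminus>1\<close>, so whatever \<open>\<rho>\<close> fixes is fixed by the group. If some element has trace \<open>\<plusminus>1\<close>, it or its square has
  trace \<open>-1\<close> and becomes the standard \<open>\<sigma>\<close> of order three; now one of \<open>g\<close>, \<open>\<sigma> g\<close>, \<open>\<sigma>\<^sup>2 g\<close> is \<open>\<plusminus>1\<close>, and
  the invariants are those of \<open>\<sigma>\<close> or of \<open>\<sigma>\<close> and \<open>-1\<close>. Otherwise the group is contained in \<open>{1, -1}\<close>.\<close>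

theorem fixed_subalgebra_of_finite_monomial_group:
  fixes \<omega> :: 'k
  assumes m: "quantum_torus h m" and q: "\<forall>n::nat. n > 0 \<longrightarrow> (h * h) ^ n \<noteq> 1"
    and \<omega>: "\<omega> ^ 3 = 1" "\<omega> \<noteq> 1"
    and G: "finite G" "id \<in> G" "\<And>f g. f \<in> G \<Longrightarrow> g \<in> G \<Longrightarrow> f \<circ> g \<in> G"
    and hom: "\<And>f. f \<in> G \<Longrightarrow> alg_hom (*s) (*s) f"
    and acts: "\<And>f. f \<in> G \<Longrightarrow> \<exists>a b c d. acts_by m f a b c d"
  obtains u v where "q_commuting (h * h) u v" "division_closure {u, v} = fixed_ring G"
proof -
  have small: "\<bar>a + d\<bar> \<le> 1 \<or> (b = 0 \<and> c = 0 \<and> a = d \<and> (a = 1 \<or> a = -1))"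
    if f: "f \<in> G" "quantum_torus h m'" "acts_by m' f a b c d" for f a b c d m'
  proof -
    obtain n where "n > 0" "f ^^ n = id"
      using finite_order[OF G f(1) alg_hom_inj[OF hom[OF f(1)]]] .
    then show ?thesis using small_trace[OF f(2) q f(3)] by blast
  qed
  have ident: "f r = r" if "f \<in> G" "quantum_torus h m'" "acts_by m' f 1 0 0 1" for f m' r
    using alg_hom_eq_on_torus[OF that(2) hom[OF that(1)] hom[OF G(2)]] that(3)
      by (simp add: acts_by_def)
  have cancel: "f r = r" if "f \<in> G" "g \<in> G" "g r = r" "(g \<circ> f) r = r" for f g r
    using that injD[OF alg_hom_inj[OF hom[OF that(2)]], of "f r" r] by simp
  \<comment> \<open>A power \<open>f'\<close> of \<open>f\<close> with the same trace \<open>t\<close> is a companion matrix in the basis that consists of the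
    cyclic vector \<open>(p, r)\<close> and its image \<open>(s, z)\<close>. The inverse \<open>f\<^sup>3\<close> or \<open>f\<^sup>2\<close> replaces \<open>f\<close> when this basis is
    negatively oriented.\<close>
  have basis: "\<exists>m' f'. quantum_torus h m' \<and> f' \<in> G \<and> (\<forall>i j. f' (m' i j) = m' (- j) (i + t * j)) \<and>
      (\<forall>g\<in>G. \<exists>a b c d. acts_by m' g a b c d)"
    if f: "f \<in> G" "acts_by m f a b c d" and t: "t = a + d" "t = 0 \<or> t = -1" for f a b c d t
  proof -
    have det: "a * d - b * c = 1" using f(2) by (simp add: acts_by_def)
    obtain p r where pr: "\<bar>p * (c * p + d * r) - r * (a * p + b * r)\<bar> = 1"
      using cyclic_vector[OF det] t by auto
    have "\<exists>f'\<in>G. \<exists>a b c d. acts_by m f' a b c d \<and> a + d = t \<and> p * (c * p + d * r) - r * (a * p + b * r) = 1"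
    proof (cases "p * (c * p + d * r) - r * (a * p + b * r) = 1")
      case True then show ?thesis using f t by blast
    next
      case False
      then have neg: "p * (c * p + d * r) - r * (a * p + b * r) = -1" using pr by linarith
      have ff: "acts_by m (f \<circ> f) (a * a + b * c) (a * b + b * d) (c * a + d * c) (c * b + d * d)"
        using acts_by_comp[OF f(2) f(2)] .
      have sq: "a * a + b * c = t * a - 1" "a * b + b * d = t * b" "c * a + d * c = t * c" "c * b + d * d = t * d - 1"
        using det t(1) by (simp_all add: algebra_simps)
      show ?thesis
      proof (cases "t = 0")
        case True
        have "acts_by m (f \<circ> (f \<circ> f)) (a * (-1) + b * 0) (a * 0 + b * (-1)) (c * (-1) + d * 0) (c * 0 + d * (-1))"
          using acts_by_comp[OF f(2) ff[unfolded sq]] True by simp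
        then have "acts_by m (f \<circ> (f \<circ> f)) (- a) (- b) (- c) (- d)" by simp
        moreover have "f \<circ> (f \<circ> f) \<in> G" using G f by blast
        moreover have "- a + - d = t" using True t by simp
        moreover have "p * (- c * p + - d * r) - r * (- a * p + - b * r) = 1" using neg
          by (simp add: algebra_simps)
        ultimately show ?thesis by blast
      next
        case False
        then have t1: "t = -1" using t by simp
        have "acts_by m (f \<circ> f) (- a - 1) (- b) (- c) (- d - 1)" using ff[unfolded sq] t1 by simp
        moreover have "f \<circ> f \<in> G" using G f by blast
        moreover have "(- a - 1) + (- d - 1) = t" using t1 t by simp
        moreover have "p * (- c * p + (- d - 1) * r) - r * ((- a - 1) * p + - b * r) = 1" using neg
          by (simp add: algebra_simps)
        ultimately show ?thesis by blast
      qed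
    qed
    then obtain f' a b c d where f': "f' \<in> G" "acts_by m f' a b c d" "a + d = t"
      and one: "p * (c * p + d * r) - r * (a * p + b * r) = 1" by blast
    define s where "s = a * p + b * r"
    define z where "z = c * p + d * r"
    have psz: "p * z - s * r = 1" using one by (simp add: s_def z_def mult.commute)
    define m' where "m' i j = m (p * i + s * j) (r * i + z * j)" for i j
    have m': "quantum_torus h m'"
      unfolding m'_def using quantum_torus_change_of_basis[OF m psz] by simp
    have det': "a * d - b * c = 1" using f'(2) by (simp add: acts_by_def)
    have M2: "a * s + b * z = t * s - p" "c * s + d * z = t * z - r"
    proof -
      have "a * s + b * z = (a + d) * s - (a * d - b * c) * p" "c * s + d * z = (a + d) * z - (a * d - b * c) * r"
        by (simp_all add: s_def z_def algebra_simps)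
      then show "a * s + b * z = t * s - p" "c * s + d * z = t * z - r" using det' f'(3) by simp_all
    qed
    have "f' (m' i j) = m' (- j) (i + t * j)" for i j
    proof -
      have "f' (m' i j) = m (a * (p * i + s * j) + b * (r * i + z * j)) (c * (p * i + s * j) + d * (r * i + z * j))"
        using f'(2) by (simp add: acts_by_def m'_def)
      also have "a * (p * i + s * j) + b * (r * i + z * j) = s * i + (a * s + b * z) * j"
        by (simp add: s_def algebra_simps)
      also have "c * (p * i + s * j) + d * (r * i + z * j) = z * i + (c * s + d * z) * j"
        by (simp add: z_def algebra_simps)
      finally show ?thesis unfolding M2 m'_def by (simp add: algebra_simps)
    qed
    moreover have "\<exists>a' b' c' d'. acts_by m' g a' b' c' d'" if "g \<in> G" for g
    proof -
      obtain A B C D where g: "acts_by m g A B C D" using acts \<open>g \<in> G\<close> by blast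
      define X where "X = A * p + B * r"
      define Y where "Y = C * p + D * r"
      define Z where "Z = A * s + B * z"
      define W where "W = C * s + D * z"
      have e1: "p * (z * X - s * Y) + s * (p * Y - r * X) = X" "r * (z * X - s * Y) + z * (p * Y - r * X) = Y"
        "p * (z * Z - s * W) + s * (p * W - r * Z) = Z" "r * (z * Z - s * W) + z * (p * W - r * Z) = W"
      proof -
        have *: "p * (z * X - s * Y) + s * (p * Y - r * X) = (p * z - s * r) * X"
          "r * (z * X - s * Y) + z * (p * Y - r * X) = (p * z - s * r) * Y" for X Y
            by (simp_all add: algebra_simps)
        show "p * (z * X - s * Y) + s * (p * Y - r * X) = X" "r * (z * X - s * Y) + z * (p * Y - r * X) = Y"
          "p * (z * Z - s * W) + s * (p * W - r * Z) = Z" "r * (z * Z - s * W) + z * (p * W - r * Z) = W"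
          unfolding * psz by simp_all
      qed
      have "(z * X - s * Y) * (p * W - r * Z) - (z * Z - s * W) * (p * Y - r * X) = (p * z - s * r) * (X * W - Y * Z)"
        by (simp add: algebra_simps)
      also have "X * W - Y * Z = (A * D - B * C) * (p * z - s * r)"
        by (simp add: X_def Y_def Z_def W_def algebra_simps)
      also have "A * D - B * C = 1" using g by (simp add: acts_by_def)
      finally have det: "(z * X - s * Y) * (p * W - r * Z) - (z * Z - s * W) * (p * Y - r * X) = 1"
        using psz by simp
      have "g (m' i j) = m' ((z * X - s * Y) * i + (z * Z - s * W) * j) ((p * Y - r * X) * i + (p * W - r * Z) * j)" for i j
      proof -
        have "g (m' i j) = m (A * (p * i + s * j) + B * (r * i + z * j)) (C * (p * i + s * j) + D * (r * i + z * j))"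
          using g by (simp add: acts_by_def m'_def)
        also have "A * (p * i + s * j) + B * (r * i + z * j) = X * i + Z * j"
          by (simp add: X_def Z_def algebra_simps)
        also have "C * (p * i + s * j) + D * (r * i + z * j) = Y * i + W * j"
          by (simp add: Y_def W_def algebra_simps)
        also have "X * i + Z * j = p * ((z * X - s * Y) * i + (z * Z - s * W) * j) + s * ((p * Y - r * X) * i + (p * W - r * Z) * j)"
          using arg_cong[OF e1(1), of "\<lambda>t. t * i"] arg_cong[OF e1(3), of "\<lambda>t. t * j"]
            by (simp add: algebra_simps)
        also have "Y * i + W * j = r * ((z * X - s * Y) * i + (z * Z - s * W) * j) + z * ((p * Y - r * X) * i + (p * W - r * Z) * j)"
          using arg_cong[OF e1(2), of "\<lambda>t. t * i"] arg_cong[OF e1(4), of "\<lambda>t. t * j"]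
            by (simp add: algebra_simps)
        finally show ?thesis by (simp add: m'_def)
      qed
      then show ?thesis using det unfolding acts_by_def by blast
    qed
    ultimately show ?thesis using m' f'(1) by blast
  qed
  consider (four) f a b c d where "f \<in> G" "acts_by m f a b c d" "a + d = 0"
    | (three) f a b c d where "f \<in> G" "acts_by m f a b c d" "\<bar>a + d\<bar> = 1"
    | (two) "\<And>f a b c d. f \<in> G \<Longrightarrow> acts_by m f a b c d \<Longrightarrow> b = 0 \<and> c = 0 \<and> a = d \<and> (a = 1 \<or> a = -1)"
  proof -
    have "\<bar>t\<bar> \<le> 1 \<Longrightarrow> t = 0 \<or> \<bar>t\<bar> = 1" for t :: int by linarith
    then show ?thesis using small[OF _ m] that by metis
  qed
  then show ?thesis
  proof cases
    case two
    have cases2: "acts_by m f 1 0 0 1 \<or> acts_by m f (-1) 0 0 (-1)" if "f \<in> G" for f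
      using two[OF that] acts[OF that] by (metis)
    show ?thesis
    proof (cases "\<exists>\<tau>\<in>G. acts_by m \<tau> (-1) 0 0 (-1)")
      case True
      then obtain \<tau> where \<tau>: "\<tau> \<in> G" "acts_by m \<tau> (-1) 0 0 (-1)" by blast
      have "\<tau> (m i j) = m (- i) (- j)" for i j using \<tau>(2) by (simp add: acts_by_def)
      note F = fixed_subalgebra_of_order_2[where m = m and \<tau> = \<tau>, OF m q hom[OF \<tau>(1)] this]
      have "fixed_ring G = {r. \<tau> r = r}"
      proof -
        have "f r = r" if f: "f \<in> G" and r: "\<tau> r = r" for f r
          using cases2[OF f]
        proof
          assume "acts_by m f (-1) 0 0 (-1)"
          then show ?thesis
            using alg_hom_eq_on_torus[OF m hom[OF f] hom[OF \<tau>(1)]] \<tau>(2) r by (simp add: acts_by_def)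
        qed (rule ident[OF f m])
        then show ?thesis using \<tau>(1) by (auto simp: fixed_ring_def)
      qed
      then show ?thesis using F(1,2) that by simp
    next
      case False
      then have "fixed_ring G = UNIV" using cases2 ident[OF _ m] by (auto simp: fixed_ring_def)
      moreover have "q_commuting (h * h) (m 0 1) (m 1 0)"
        using quantum_torusD[OF m] by (simp add: q_commuting_def power_int_minus)
      moreover have "division_closure {m 0 1, m 1 0} = UNIV"
        using division_closure_quantum_torus[OF m] by (simp add: insert_commute)
      ultimately show ?thesis using that by simp
    qed
  next
    case four
    obtain m' \<rho> where m': "quantum_torus h m'" and \<rho>: "\<rho> \<in> G" "\<And>i j. \<rho> (m' i j) = m' (- j) (i + 0 * j)"
      and acts': "\<And>g. g \<in> G \<Longrightarrow> \<exists>a b c d. acts_by m' g a b c d"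
      using basis[OF four(1,2), of 0] four(3) by auto
    have \<rho>a: "acts_by m' \<rho> 0 (-1) 1 0" using \<rho>(2) by (simp add: acts_by_def)
    have "g r = r" if g: "g \<in> G" and r: "\<rho> r = r" for g r
    proof -
      have PM: "f r = r" if "f \<in> G" "acts_by m' f a 0 0 a" "a = 1 \<or> a = -1" for f a
      proof (cases "a = 1")
        case True then show ?thesis using ident[OF that(1) m'] that(2) by simp
      next
        case False
        then have "f (m' i j) = (\<rho> \<circ> \<rho>) (m' i j)" for i j
          using that(2,3) \<rho>(2) by (simp add: acts_by_def)
        then have "f r = (\<rho> \<circ> \<rho>) r"
          using alg_hom_eq_on_torus[OF m' hom[OF that(1)] hom[OF G(3)[OF \<rho>(1) \<rho>(1)]]] by blast
        then show ?thesis using r by simp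
      qed
      obtain a b c d where ga: "acts_by m' g a b c d" using acts'[OF g] by blast
      then have det: "a * d - b * c = 1" by (simp add: acts_by_def)
      have \<rho>g: "acts_by m' (\<rho> \<circ> g) (- c) (- d) a b" using acts_by_comp[OF \<rho>a ga] by simp
      have \<rho>gG: "\<rho> \<circ> g \<in> G" using G(3) \<rho>(1) g by blast
      have "\<not> (\<bar>a + d\<bar> \<le> 1 \<and> \<bar>- c + b\<bar> \<le> 1)" using trace_bound_4[OF det] by auto
      then consider "b = 0 \<and> c = 0 \<and> a = d \<and> (a = 1 \<or> a = -1)"
        | "- d = 0 \<and> a = 0 \<and> - c = b \<and> (- c = 1 \<or> - c = -1)"
        using small[OF g m' ga] small[OF \<rho>gG m' \<rho>g] by blast
      then show ?thesis
      proof cases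
        case 1 then show ?thesis using PM[OF g, of a] ga by auto
      next
        case 2
        then have "(\<rho> \<circ> g) r = r" using PM[OF \<rho>gG, of "- c"] \<rho>g by auto
        then show ?thesis using cancel[OF g \<rho>(1) r] by blast
      qed
    qed
    then have "fixed_ring G = {r. \<rho> r = r}" using \<rho>(1) by (auto simp: fixed_ring_def)
    moreover obtain u v where "q_commuting (h * h) u v" "division_closure {u, v} = {r. \<rho> r = r}"
      using fixed_subalgebra_of_order_4[where m = m' and \<rho> = \<rho>, OF m' q hom[OF \<rho>(1)]] \<rho>(2) by auto
    ultimately show ?thesis using that by simp
  next
    case three
    have "\<exists>f\<in>G. \<exists>a b c d. acts_by m f a b c d \<and> a + d = -1"
    proof (cases "a + d = -1")
      case True then show ?thesis using three by blast
    next
      case False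
      then have t: "a + d = 1" using three(3) by linarith
      have det: "a * d - b * c = 1" using three(2) by (simp add: acts_by_def)
      have "(a * a + b * c) + (c * b + d * d) = (a + d) * (a + d) - 2 * (a * d - b * c)"
        by (simp add: algebra_simps)
      then have "(a * a + b * c) + (c * b + d * d) = -1" using t det by simp
      then show ?thesis using acts_by_comp[OF three(2,2)] G(3)[OF three(1,1)] by blast
    qed
    then obtain f a b c d where f: "f \<in> G" "acts_by m f a b c d" "a + d = -1" by blast
    obtain m' \<sigma> where m': "quantum_torus h m'" and \<sigma>: "\<sigma> \<in> G" "\<And>i j. \<sigma> (m' i j) = m' (- j) (i + (-1) * j)"
      and acts': "\<And>g. g \<in> G \<Longrightarrow> \<exists>a b c d. acts_by m' g a b c d"
      using basis[OF f(1,2), of "-1"] f(3) by auto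
    have \<sigma>': "\<sigma> (m' i j) = m' (- j) (i - j)" for i j using \<sigma>(2) by simp
    have \<sigma>a: "acts_by m' \<sigma> 0 (-1) 1 (-1)" using \<sigma>(2) by (simp add: acts_by_def)
    have reduce: "\<exists>f\<in>G. ((f r = r) \<longrightarrow> g r = r) \<and> (acts_by m' f 1 0 0 1 \<or> acts_by m' f (-1) 0 0 (-1))"
      if g: "g \<in> G" and r: "\<sigma> r = r" for g r
    proof -
      obtain a b c d where ga: "acts_by m' g a b c d" using acts'[OF g] by blast
      then have det: "a * d - b * c = 1" by (simp add: acts_by_def)
      have \<sigma>g: "acts_by m' (\<sigma> \<circ> g) (- c) (- d) (a - c) (b - d)" using acts_by_comp[OF \<sigma>a ga] by simp
      have \<sigma>\<sigma>g: "acts_by m' (\<sigma> \<circ> (\<sigma> \<circ> g)) (c - a) (d - b) (- a) (- b)" using acts_by_comp[OF \<sigma>a \<sigma>g]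
        by simp
      have mem: "\<sigma> \<circ> g \<in> G" "\<sigma> \<circ> (\<sigma> \<circ> g) \<in> G" using G(3) \<sigma>(1) g by blast+
      have "\<not> (\<bar>a + d\<bar> \<le> 1 \<and> \<bar>- c + (b - d)\<bar> \<le> 1 \<and> \<bar>c - a + - b\<bar> \<le> 1)"
        using trace_bound_3[OF det] by (auto simp: algebra_simps)
      then consider "b = 0 \<and> c = 0 \<and> a = d \<and> (a = 1 \<or> a = -1)"
        | "- d = 0 \<and> a - c = 0 \<and> - c = b - d \<and> (- c = 1 \<or> - c = -1)"
        | "d - b = 0 \<and> - a = 0 \<and> c - a = - b \<and> (c - a = 1 \<or> c - a = -1)"
        using small[OF g m' ga] small[OF mem(1) m' \<sigma>g] small[OF mem(2) m' \<sigma>\<sigma>g] by blast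
      then show ?thesis
      proof cases
        case 1 then show ?thesis using g ga by auto
      next
        case 2
        then have "acts_by m' (\<sigma> \<circ> g) 1 0 0 1 \<or> acts_by m' (\<sigma> \<circ> g) (-1) 0 0 (-1)"
          using \<sigma>g by (elim conjE disjE) simp_all
        then show ?thesis using mem(1) cancel[OF g \<sigma>(1) r] by blast
      next
        case 3
        then have "acts_by m' (\<sigma> \<circ> (\<sigma> \<circ> g)) 1 0 0 1 \<or> acts_by m' (\<sigma> \<circ> (\<sigma> \<circ> g)) (-1) 0 0 (-1)"
          using \<sigma>\<sigma>g by (elim conjE disjE) simp_all
        then show ?thesis using mem cancel[OF g \<sigma>(1) r] cancel[OF mem(1) \<sigma>(1) r] by blast
      qed
    qed
    show ?thesis
    proof (cases "\<exists>\<tau>\<in>G. acts_by m' \<tau> (-1) 0 0 (-1)")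
      case True
      then obtain \<tau> where \<tau>: "\<tau> \<in> G" "acts_by m' \<tau> (-1) 0 0 (-1)" by blast
      have \<tau>': "\<tau> (m' i j) = m' (- i) (- j)" for i j using \<tau>(2) by (simp add: acts_by_def)
      have "g r = r" if g: "g \<in> G" and r: "\<sigma> r = r" "\<tau> r = r" for g r
      proof -
        obtain f where f: "f \<in> G" "f r = r \<longrightarrow> g r = r"
          "acts_by m' f 1 0 0 1 \<or> acts_by m' f (-1) 0 0 (-1)" using reduce[OF g r(1)] by blast
        from f(3) have "f r = r"
        proof
          assume "acts_by m' f (-1) 0 0 (-1)"
          then have "f r = \<tau> r"
            using alg_hom_eq_on_torus[OF m' hom[OF f(1)] hom[OF \<tau>(1)]] \<tau>' by (simp add: acts_by_def)
          then show ?thesis using r by simp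
        qed (rule ident[OF f(1) m'])
        then show ?thesis using f(2) by simp
      qed
      then have "fixed_ring G = {r. \<sigma> r = r \<and> \<tau> r = r}" using \<sigma>(1) \<tau>(1)
        by (auto simp: fixed_ring_def)
      moreover obtain u v where "q_commuting (h * h) u v" "division_closure {u, v} = {r. \<sigma> r = r \<and> \<tau> r = r}"
        using fixed_subalgebra_of_order_6[where m = m' and \<sigma> = \<sigma> and \<tau> = \<tau>, OF m' q \<omega> hom[OF \<sigma>(1)] \<sigma>' hom[OF \<tau>(1)] \<tau>']
        by blast
      ultimately show ?thesis using that by simp
    next
      case False
      have "g r = r" if g: "g \<in> G" and r: "\<sigma> r = r" for g r
        using reduce[OF g r] False ident[OF _ m'] by blast
      then have "fixed_ring G = {r. \<sigma> r = r}" using \<sigma>(1) by (auto simp: fixed_ring_def)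
      then show ?thesis
        using fixed_subalgebra_of_order_3[where m = m' and \<sigma> = \<sigma>, OF m' q \<omega> hom[OF \<sigma>(1)] \<sigma>'] that
          by simp
    qed
  qed
qed


end

section \<open>Fixed rings isomorphic to the whole algebra\<close>

context division_algebra begin

lemma iso_to_whole_division_closure:
  assumes D: "is_q_division_ring (*s) q x y" and q: "q \<noteq> 0" "\<forall>n::nat. n > 0 \<longrightarrow> q ^ n \<noteq> 1"
    and "q_commuting q u v"
  shows "iso_to_whole (*s) (division_closure {u, v})"
proof -
  obtain f where "alg_hom (*s) (*s) f" "range f = division_closure {u, v}"
    using universal_property(3)[OF D q assms(4)] by blast
  then show ?thesis
    unfolding iso_to_whole_def bij_betw_def using alg_hom_inj by blast
qed

lemma fixed_ring_generate:
  assumes "\<phi> \<in> alg_auts (*s)"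
  shows "fixed_ring (generate (aut_group (*s)) {\<phi>}) = {r. \<phi> r = r}"
proof -
  interpret group "aut_group (*s)" by (rule group_aut_group) (rule k_algebra_axioms)
  have \<phi>: "\<phi> \<in> carrier (aut_group (*s))" using assms by (simp add: aut_group_def)
  have "g r = r" if "g \<in> generate (aut_group (*s)) {\<phi>}" "\<phi> r = r" for g r
    using that
  proof (induction rule: generate.induct)
    case (inv a)
    then have "inv\<^bsub>aut_group (*s)\<^esub> a \<circ> a = id" using l_inv[OF \<phi>] by (simp add: aut_group_def)
    then show ?case using inv by (metis comp_apply id_apply singletonD)
  qed (auto simp: aut_group_def)
  then show ?thesis by (auto simp: fixed_ring_def intro: generate.incl)
qed

text \<open>An endomorphism is determined by the images of \<open>x\<close> and \<open>y\<close>, so its square is the identity as soon as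
  it fixes \<open>x\<close> and \<open>y\<close>.\<close>

lemma unique_automorphism_if_involutive:
  assumes D: "is_q_division_ring (*s) q x y" and q: "q \<noteq> 0" "\<forall>n::nat. n > 0 \<longrightarrow> q ^ n \<noteq> 1"
    and uv: "q_commuting q u v"
    and inv: "\<And>\<phi>. alg_hom (*s) (*s) \<phi> \<Longrightarrow> \<phi> x = u \<Longrightarrow> \<phi> y = v \<Longrightarrow> \<phi> u = x \<and> \<phi> v = y"
  shows "\<exists>!\<phi>. \<phi> \<in> alg_auts (*s) \<and> \<phi> x = u \<and> \<phi> y = v"
proof -
  note U = universal_property[OF D q]
  have eq: "f r = g r" if "alg_hom (*s) (*s) f" "alg_hom (*s) (*s) g" "f x = g x" "f y = g y" for f g r
    using alg_hom_eq_on_division_closure[OF that(1,2), of "{x, y}" r] that(3,4) U(2) by auto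
  obtain \<phi> where \<phi>: "alg_hom (*s) (*s) \<phi>" "\<phi> x = u" "\<phi> y = v" using U(3)[OF uv] by blast
  have "alg_hom (*s) (*s) (\<phi> \<circ> \<phi>)" "alg_hom (*s) (*s) id" using \<phi>(1) by (simp_all add: alg_hom_iff)
  from eq[OF this] have "(\<phi> \<circ> \<phi>) r = id r" for r using inv[OF \<phi>] \<phi>(2,3) by simp
  then have "\<phi> \<circ> \<phi> = id" by (rule ext)
  then have "bij \<phi>" using o_bij by blast
  show ?thesis
  proof (rule ex1I[of _ \<phi>])
    show "\<phi> \<in> alg_auts (*s) \<and> \<phi> x = u \<and> \<phi> y = v"
      using \<phi> \<open>bij \<phi>\<close> by (simp add: alg_auts_def)
    fix \<psi> assume "\<psi> \<in> alg_auts (*s) \<and> \<psi> x = u \<and> \<psi> y = v"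
    then have "\<psi> r = \<phi> r" for r using eq[of \<psi> \<phi> r] \<phi> by (simp add: alg_auts_def)
    then show "\<psi> = \<phi>" by (rule ext)
  qed
qed

end

theorem theorem1p3p3:
  fixes scale :: "'k::field_char_0 \<Rightarrow> 'd::division_ring \<Rightarrow> 'd"
    and q :: 'k and x y :: 'd
  assumes "q \<noteq> 0"
    and "\<forall>n::nat. n > 0 \<longrightarrow> q ^ n \<noteq> 1"
    and "is_q_division_ring scale q x y"
  shows
    "((\<exists>!\<phi>. \<phi> \<in> alg_auts scale \<and>
          \<phi> x = (inverse y - scale (inverse q) y) * inverse x \<and> \<phi> y = - inverse y) \<and>
      (\<forall>\<phi>. \<phi> \<in> alg_auts scale \<and>
          \<phi> x = (inverse y - scale (inverse q) y) * inverse x \<and> \<phi> y = - inverse y \<longrightarrow>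
          iso_to_whole scale (fixed_ring (generate (aut_group scale) {\<phi>}))))
     \<and>
     (\<forall>(\<omega> :: 'k) (h :: 'k) (p :: 'k). \<omega> ^ 3 = 1 \<and> \<omega> \<noteq> 1 \<and> h ^ 2 = q \<and> p ^ 3 = q \<longrightarrow>
        (\<forall>G. subgroup G (aut_group scale) \<and> finite G \<and> (\<forall>g\<in>G. is_monomial_aut scale h x y g) \<longrightarrow>
          iso_to_whole scale (fixed_ring G)))"
proof -
  have "k_algebra scale" using assms(3) by (simp add: is_q_division_ring_def)
  then interpret division_algebra_char_0 scale
    by (simp add: division_algebra_char_0_def division_algebra_def)
  have q: "q \<noteq> 0" "\<forall>n::nat. n > 0 \<longrightarrow> q ^ n \<noteq> 1" using assms by auto
  note D = assms(3)
  note U = universal_property[OF D q]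
  have xy: "x \<noteq> 0" "y \<noteq> 0" and com: "x * y = scale q (y * x)" using U(1)
    by (auto simp: q_commuting_def)
  note inv = q_commuting_inverse[OF U(1) q(1)]
  define f where "f = inverse y - scale (inverse q) y"
  define u where "u = f * inverse x"
  have f0: "f \<noteq> 0"
  proof
    assume "f = 0"
    then have "x * f = 0" by simp
    then have "scale (inverse q) (inverse y * x) - y * x = 0"
      using q(1) by (simp add: f_def right_diff_distrib inv com)
    moreover have "y * (scale (inverse q) (inverse y * x) - y * x) = scale (inverse q) x - y * (y * x)"
      using xy by (simp add: right_diff_distrib flip: mult.assoc)
    ultimately have "y * y * x = scale (inverse q) x" by (simp add: mult.assoc)
    moreover have "y * f * x = x - scale (inverse q) (y * y * x)"
      using xy by (simp add: f_def right_diff_distrib left_diff_distrib flip: mult.assoc)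
    ultimately have "scale (1 - inverse q * inverse q) x = 0" using \<open>f = 0\<close>
      by (simp add: scale_left_diff_distrib)
    then have "q * q = 1" using xy q(1) by (simp add: field_simps)
    then show False using q(2)[rule_format, of 2] by (simp add: power2_eq_square)
  qed
  have fy: "f * inverse y = inverse y * f" using xy by (simp add: f_def algebra_simps)
  have uv: "q_commuting q u (- inverse y)"
  proof -
    have "u * inverse y = scale q (inverse y * u)"
      by (simp add: u_def mult.assoc inv) (simp add: fy flip: mult.assoc)
    then show ?thesis using f0 xy by (simp add: q_commuting_def u_def)
  qed
  have "\<exists>!\<phi>. \<phi> \<in> alg_auts scale \<and> \<phi> x = u \<and> \<phi> y = - inverse y"
  proof (rule unique_automorphism_if_involutive[OF D q uv])
    fix \<phi> assume \<phi>: "alg_hom scale scale \<phi>" "\<phi> x = u" "\<phi> y = - inverse y"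
    note \<phi>s = alg_homD[OF \<phi>(1)]
    have "\<phi> f * x = x * f"
      using q(1) by (simp add: f_def \<phi>s \<phi>(3) right_diff_distrib left_diff_distrib inv com)
    then have "\<phi> f = x * f * inverse x" using xy by (metis mult.assoc mult_1_right right_inverse)
    then have "\<phi> u = x * f * inverse x * inverse u"
      by (simp add: u_def[THEN arg_cong, of \<phi>] \<phi>s \<phi>(2))
    also have "\<dots> = x" proof -
      have "inverse u = x * inverse f" using f0 xy by (simp add: u_def nonzero_inverse_mult_distrib)
      then show ?thesis using f0 xy by (metis mult.assoc mult_1_right left_inverse right_inverse)
    qed
    finally show "\<phi> u = x \<and> \<phi> (- inverse y) = y" using xy by (simp add: \<phi>s \<phi>(3))
  qed
  moreover have "iso_to_whole scale (fixed_ring (generate (aut_group scale) {\<phi>}))"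
    if "\<phi> \<in> alg_auts scale" "\<phi> x = u" "\<phi> y = - inverse y" for \<phi>
  proof -
    have \<phi>: "alg_hom scale scale \<phi>" using that(1) by (simp add: alg_auts_def)
    have \<phi>y: "\<phi> y = scale (-1) (inverse y)" using that(3) by simp
    have \<phi>x: "\<phi> x = (scale (- inverse q) (y + scale (-1 * q) (inverse y)) + scale 0 1) * inverse x"
      using that(2) q(1) by (simp add: u_def f_def scale_right_diff_distrib)
    note F = fixed_subalgebra_of_involution(1,2)[OF q U(1) disjI2[OF refl] \<phi> \<phi>y \<phi>x]
    show ?thesis
      using iso_to_whole_division_closure[OF D q F(1)]
        unfolding F(2) fixed_ring_generate[OF that(1)] U(2) by simp
  qed
  moreover have "iso_to_whole scale (fixed_ring G)"
    if \<omega>: "\<omega> ^ 3 = 1" "\<omega> \<noteq> 1" and h: "h ^ 2 = q"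
      and G: "subgroup G (aut_group scale)" "finite G" "\<And>g. g \<in> G \<Longrightarrow> is_monomial_aut scale h x y g"
    for \<omega> h :: 'k and G
  proof -
    have hq: "q = h * h" using h by (simp add: power2_eq_square)
    have h0: "h \<noteq> 0" using q(1) hq by auto
    define m where "m i j = scale (h powi (i * j)) (y powi i * x powi j)" for i j
    have m: "quantum_torus h m"
      unfolding m_def using quantum_torus_of_q_division_ring[OF D[unfolded hq] h0] q(2) hq by simp
    have hom: "alg_hom scale scale g" if "g \<in> G" for g
      using subgroup.subset[OF G(1)] that by (auto simp: aut_group_def alg_auts_def)
    have "\<exists>a b c d. acts_by m g a b c d" if g: "g \<in> G" for g
    proof -
      obtain a b c d where det: "a * d - b * c = 1" and gy: "g y = m a c" and gx: "g x = m b d"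
        using G(3)[OF g] by (auto simp: is_monomial_aut_def m_def)
      have "g (m i j) = m (a * i + b * j) (c * i + d * j)" for i j
      proof -
        note hs = alg_homD[OF hom[OF g]] alg_hom_power_int[OF hom[OF g]]
        have "g (m i j) = scale (h powi (i * j)) (m a c powi i * m b d powi j)"
          by (simp add: m_def[of i j] hs gy gx)
        then show ?thesis
          using quantum_torus_power_int(3)[OF quantum_torus_change_of_basis[OF m det], of i j]
            by simp
      qed
      then show ?thesis using det by (auto simp: acts_by_def)
    qed
    moreover have "id \<in> G" using subgroup.one_closed[OF G(1)] by (simp add: aut_group_def)
    moreover have "f \<circ> g \<in> G" if "f \<in> G" "g \<in> G" for f g
      using subgroup.m_closed[OF G(1) that] by (simp add: aut_group_def)
    moreover have "\<forall>n::nat. n > 0 \<longrightarrow> (h * h) ^ n \<noteq> 1" using q(2) hq by simp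
    ultimately obtain u v where "q_commuting (h * h) u v" "division_closure {u, v} = fixed_ring G"
      using fixed_subalgebra_of_finite_monomial_group[OF m _ \<omega> G(2) _ _ hom] by metis
    then show ?thesis using iso_to_whole_division_closure[OF D q] hq by metis
  qed
  ultimately show ?thesis unfolding u_def f_def by blast
qed

end
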